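(* Let $G$ be a countable abelian group. Let $a,b\in\mathbb{Z}$ be integers such that $(b-a)G$ has finite index in $G$. Then for any ergodic $G$-system $(X,\mathcal{X},\mu,(T_g)_{g\in G})$, any $A\in\mathcal{X}$, and any $\varepsilon>0$, the set $$\left\{g\in G : \mu\left(A\cap T_{ag}^{-1}A\cap T_{bg}^{-1}A\right)>\mu(A)^3-\varepsilon\right\}$$ is syndetic in $G$.
   Context: For $c\in\mathbb{Z}$, $cG=\{cg : g\in G\}$. A $G$-system $(X,\mathcal{X},\mu,(T_g)_{g\in G})$ consists of a standard Borel probability space $(X,\mathcal{X},\mu)$ and measure-preserving transformations $T_g:X\to X$ with $T_{g+h}=T_g\circ T_h$ for all $g,h\in G$ and $T_0=\mathrm{Id}$. It is ergodic if the only measurable $(T_g)_{g\in G}$-invariant functions are the (a.e.) constant functions. A set $S\subseteq G$ is syndetic if there is a finite set $F\subseteq G$ with $S+F=\{s+f : s\in S, f\in F\}=G$. *)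

theory Defs
  imports "HOL-Probability.Probability" "HOL-Algebra.Coset"
begin

text \<open>Groups are those of HOL-Algebra, written multiplicatively: for \<open>c :: int\<close> the multiple \<open>cg\<close> is
  \<open>g [^]\<^bsub>G\<^esub> c\<close>, and the identity \<open>0\<close> is \<open>\<one>\<^bsub>G\<^esub>\<close>.\<close>

definition multiples :: "('g, 'm) monoid_scheme \<Rightarrow> int \<Rightarrow> 'g set" where
  "multiples G c = (\<lambda>g. g [^]\<^bsub>G\<^esub> c) ` carrier G"

definition finite_index :: "'g set \<Rightarrow> ('g, 'm) monoid_scheme \<Rightarrow> bool" where
  "finite_index H G \<longleftrightarrow> subgroup H G \<and> finite (rcosets\<^bsub>G\<^esub> H)"

definition syndetic :: "('g, 'm) monoid_scheme \<Rightarrow> 'g set \<Rightarrow> bool" where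
  "syndetic G S \<longleftrightarrow>
     S \<subseteq> carrier G \<and> (\<exists>F. finite F \<and> F \<subseteq> carrier G \<and> S <#>\<^bsub>G\<^esub> F = carrier G)"

definition standard_borel :: "'x measure \<Rightarrow> bool" where
  "standard_borel M \<longleftrightarrow>
     (\<exists>X. topspace X = space M \<and> completely_metrizable_space X \<and> separable_space X \<and>
          sets M = sigma_sets (space M) {U. openin X U})"

definition measure_preserving :: "'x measure \<Rightarrow> ('x \<Rightarrow> 'x) \<Rightarrow> bool" where
  "measure_preserving M f \<longleftrightarrow> f \<in> M \<rightarrow>\<^sub>M M \<and> distr M M f = M"

locale group_system = prob_space M
  for G :: "('g, 'm) monoid_scheme" (structure)
    and M :: "'x measure"
    and T :: "'g \<Rightarrow> 'x \<Rightarrow> 'x" +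
  assumes standard_borel: "standard_borel M"
    and measure_preserving: "g \<in> carrier G \<Longrightarrow> measure_preserving M (T g)"
    and action_mult:
      "\<lbrakk>g \<in> carrier G; h \<in> carrier G; x \<in> space M\<rbrakk> \<Longrightarrow> T (g \<otimes> h) x = T g (T h x)"
    and action_one: "x \<in> space M \<Longrightarrow> T \<one> x = x"

text \<open>Invariance in \<open>ergodic\<close> is required at every point. As \<open>G\<close> is countable, the notion obtained
  from invariance almost everywhere is the same.\<close>

locale ergodic_group_system = group_system G M T
  for G :: "('g, 'm) monoid_scheme" (structure)
    and M :: "'x measure"
    and T :: "'g \<Rightarrow> 'x \<Rightarrow> 'x" +
  assumes ergodic:
    "\<And>f :: 'x \<Rightarrow> complex. \<lbrakk>f \<in> borel_measurable M;
       \<And>g x. \<lbrakk>g \<in> carrier G; x \<in> space M\<rbrakk> \<Longrightarrow> f (T g x) = f x\<rbrakk>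
     \<Longrightarrow> \<exists>c. AE x in M. f x = c"

end

theory Submission
  imports Defs
begin

text \<open>Write \<open>U\<^sub>g f = f \<circ> T\<^sub>g\<close> and let \<open>f\<close> be the indicator of \<open>A\<close>, so that the quantity in question is
  \<open>u(g) = \<integral> f \<cdot> U\<^sub>a\<^sub>g f \<cdot> U\<^sub>b\<^sub>g f\<close>. The idea is that \<open>u(g)\<close> only sees the part of the middle factor that is almost
  periodic under \<open>g \<mapsto> T\<^sub>a\<^sub>g\<close> and the part of the last factor that is almost periodic under
  \<open>g \<mapsto> T\<^sub>b\<^sub>g\<close>, and that almost periodic functions return close to themselves simultaneously for a
  syndetic set of \<open>g\<close>.

  Let \<open>p\<close> and \<open>q\<close> be the projections of \<open>f\<close> onto the functions with totally bounded orbit under the two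
  powers of the action (\<open>almost_periodic_projection\<close>). They are conditional expectations, whence
  \<open>\<integral> f p q \<ge> (\<integral> f)\<^sup>3\<close> (\<open>cube_le_integral_product\<close>). On the syndetic set \<open>R\<close> where both \<open>p\<close>
  and \<open>q\<close> are almost fixed, \<open>\<integral> f \<cdot> U\<^sub>a\<^sub>g p \<cdot> U\<^sub>b\<^sub>g q\<close> is therefore nearly at least \<open>\<mu>(A)\<^sup>3\<close>, and it
  remains to control the two error terms that contain \<open>f - p\<close> or \<open>f - q\<close>.

  The function \<open>f - p\<close> is orthogonal to all almost periodic ones, and hence its correlations with its
  translates are zero in mean square (\<open>weak_mixing\<close>). So one finds finitely many shifts \<open>h\<^sub>1, \<dots>, h\<^sub>N\<close>
  inside \<open>R\<close> for which the translates of \<open>f - p\<close> are almost orthogonal to each other, even after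
  restriction to any of finitely many prescribed sets, and likewise for \<open>f - q\<close>. The average of an
  error term over \<open>g + h\<^sub>1, \<dots>, g + h\<^sub>N\<close> is then small for most \<open>g\<close>, by van der Corput's trick
  (\<open>van_der_Corput\<close>): its square is governed by correlations along \<open>(b - a) g\<close>, whose means depend only
  on the functions invariant under \<open>(b - a) G\<close>. This is where finite index and ergodicity enter: these
  functions are combinations of finitely many indicators (\<open>invariant_functions_finite_dim\<close>), and those
  give the prescribed sets.

  For a syndetic set of \<open>g\<close> in \<open>R\<close> both averaged errors are small, and all \<open>g + h\<^sub>j\<close> still almost fix \<open>p\<close> and
  \<open>q\<close>. So some \<open>u(g + h\<^sub>j)\<close> is large, and as the \<open>h\<^sub>j\<close> form a finite set, this suffices. Averaging only over
  shifts that stay in \<open>R\<close> avoids a weighted average over almost periods, and so any use of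
  characters of \<open>G\<close>.\<close>

section \<open>Means over finite lists of group elements\<close>

definition avg :: "'g list \<Rightarrow> ('g \<Rightarrow> real) \<Rightarrow> real" where
  "avg gs \<phi> = (\<Sum>g\<leftarrow>gs. \<phi> g) / real (length gs)"

lemma avg_add: "avg gs (\<lambda>g. \<phi> g + \<psi> g) = avg gs \<phi> + avg gs \<psi>"
  by (simp add: avg_def sum_list_addf add_divide_distrib)

lemma avg_cmult: "avg gs (\<lambda>g. c * \<phi> g) = c * avg gs \<phi>"
  by (simp add: avg_def sum_list_const_mult)

lemma avg_multc: "avg gs (\<lambda>g. \<phi> g * c) = avg gs \<phi> * c"
  by (simp add: avg_def sum_list_mult_const)

lemma avg_diff: "avg gs (\<lambda>g. \<phi> g - \<psi> g) = avg gs \<phi> - avg gs \<psi>"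
  by (simp add: avg_def sum_list_subtractf diff_divide_distrib)

lemma avg_const: "gs \<noteq> [] \<Longrightarrow> avg gs (\<lambda>g. c) = c"
  by (simp add: avg_def sum_list_triv)

lemma avg_cong: "(\<And>g. g \<in> set gs \<Longrightarrow> \<phi> g = \<psi> g) \<Longrightarrow> avg gs \<phi> = avg gs \<psi>"
  by (simp add: avg_def cong: map_cong)

lemma avg_mono: "(\<And>g. g \<in> set gs \<Longrightarrow> \<phi> g \<le> \<psi> g) \<Longrightarrow> avg gs \<phi> \<le> avg gs \<psi>"
  unfolding avg_def by (intro divide_right_mono sum_list_mono) auto

lemma avg_le: "gs \<noteq> [] \<Longrightarrow> (\<And>g. g \<in> set gs \<Longrightarrow> \<phi> g \<le> c) \<Longrightarrow> avg gs \<phi> \<le> c"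
  using avg_mono[of gs \<phi> "\<lambda>_. c"] by (simp add: avg_const)

lemma avg_ge: "gs \<noteq> [] \<Longrightarrow> (\<And>g. g \<in> set gs \<Longrightarrow> c \<le> \<phi> g) \<Longrightarrow> c \<le> avg gs \<phi>"
  using avg_mono[of gs "\<lambda>_. c" \<phi>] by (simp add: avg_const)

lemma abs_avg_le: "\<bar>avg gs \<phi>\<bar> \<le> avg gs (\<lambda>g. \<bar>\<phi> g\<bar>)"
proof -
  have "\<bar>\<Sum>g\<leftarrow>gs. \<phi> g\<bar> \<le> (\<Sum>g\<leftarrow>gs. \<bar>\<phi> g\<bar>)"
    by (induction gs) auto
  then show ?thesis by (simp add: avg_def divide_right_mono)
qed

lemma avg_swap: "avg gs (\<lambda>g. avg hs (\<lambda>h. F g h)) = avg hs (\<lambda>h. avg gs (\<lambda>g. F g h))"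
proof -
  have "(\<Sum>g\<leftarrow>gs. \<Sum>h\<leftarrow>hs. F g h) = (\<Sum>h\<leftarrow>hs. \<Sum>g\<leftarrow>gs. F g h)"
    by (induction gs) (simp_all add: sum_list_addf)
  then show ?thesis
    by (simp add: avg_def sum_list_mult_const divide_inverse mult.commute
        sum_list_const_mult mult.left_commute)
qed

lemma avg_exists_le: "gs \<noteq> [] \<Longrightarrow> avg gs \<phi> < c \<Longrightarrow> \<exists>g\<in>set gs. \<phi> g < c"
  by (meson avg_ge leD leI)

lemma avg_measurable [measurable]:
  "(\<And>g. g \<in> set gs \<Longrightarrow> (\<lambda>x. f g x) \<in> borel_measurable M) \<Longrightarrow>
    (\<lambda>x. avg gs (\<lambda>g. f g x)) \<in> borel_measurable M"
proof -
  assume "\<And>g. g \<in> set gs \<Longrightarrow> (\<lambda>x. f g x) \<in> borel_measurable M"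
  then have [measurable]: "(\<lambda>x. \<Sum>g\<leftarrow>gs. f g x) \<in> borel_measurable M"
    by (induction gs) auto
  show ?thesis unfolding avg_def by measurable
qed

lemma avg_integrable:
  assumes "\<And>g. g \<in> set gs \<Longrightarrow> integrable M (f g)"
  shows "integrable M (\<lambda>x. avg gs (\<lambda>g. f g x))"
    and "(\<integral>x. avg gs (\<lambda>g. f g x) \<partial>M) = avg gs (\<lambda>g. \<integral>x. f g x \<partial>M)"
proof -
  have *: "integrable M (\<lambda>x. \<Sum>g\<leftarrow>gs. f g x) \<and>
      (\<integral>x. (\<Sum>g\<leftarrow>gs. f g x) \<partial>M) = (\<Sum>g\<leftarrow>gs. \<integral>x. f g x \<partial>M)"
    using assms by (induction gs) auto
  then show "integrable M (\<lambda>x. avg gs (\<lambda>g. f g x))"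
    and "(\<integral>x. avg gs (\<lambda>g. f g x) \<partial>M) = avg gs (\<lambda>g. \<integral>x. f g x \<partial>M)"
    by (auto simp: avg_def)
qed

definition (in comm_group) conv :: "'a list \<Rightarrow> 'a list \<Rightarrow> 'a list" where
  "conv gs hs = map (\<lambda>(g, h). g \<otimes> h) (List.product gs hs)"

definition (in comm_group) averaging :: "'a list \<Rightarrow> bool" where
  "averaging gs \<longleftrightarrow> gs \<noteq> [] \<and> set gs \<subseteq> carrier G"

text \<open>An upper bound for all invariant means of \<open>\<phi>\<close> at once. The bound is uniform over translates, which
  is what turns means into syndetic sets. As convolution commutes, lists found for several functions
  merge into one that serves them all; this makes the upper mean sublinear, with no invariant
  mean or Folner sequence to choose.\<close>

definition (in comm_group) mean_le :: "('a \<Rightarrow> real) \<Rightarrow> real \<Rightarrow> bool" where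
  "mean_le \<phi> c \<longleftrightarrow>
    (\<forall>\<epsilon>>0. \<exists>gs. averaging gs \<and> (\<forall>t\<in>carrier G. avg gs (\<lambda>g. \<phi> (g \<otimes> t)) \<le> c + \<epsilon>))"

context comm_group
begin

lemma avg_conv: "avg (conv gs hs) \<phi> = avg gs (\<lambda>g. avg hs (\<lambda>h. \<phi> (g \<otimes> h)))"
proof -
  have "(\<Sum>k\<leftarrow>conv gs hs. \<phi> k) = (\<Sum>g\<leftarrow>gs. \<Sum>h\<leftarrow>hs. \<phi> (g \<otimes> h))"
    unfolding conv_def by (induction gs) (auto simp: o_def)
  then show ?thesis
    by (simp add: avg_def conv_def divide_inverse sum_list_mult_const)
qed

lemma averaging_conv: "averaging gs \<Longrightarrow> averaging hs \<Longrightarrow> averaging (conv gs hs)"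
  by (auto simp: averaging_def conv_def neq_Nil_conv subset_iff)

lemma averaging_in: "averaging gs \<Longrightarrow> g \<in> set gs \<Longrightarrow> g \<in> carrier G"
  by (auto simp: averaging_def)

lemma averaging_nonempty: "averaging gs \<Longrightarrow> gs \<noteq> []"
  by (auto simp: averaging_def)

lemma mean_leE:
  assumes "mean_le \<phi> c" "\<epsilon> > 0"
  obtains gs where "averaging gs" "\<And>t. t \<in> carrier G \<Longrightarrow> avg gs (\<lambda>g. \<phi> (g \<otimes> t)) \<le> c + \<epsilon>"
  using assms unfolding mean_le_def by blast

lemma mean_le_mono:
  assumes "mean_le \<psi> c" and "\<And>g. g \<in> carrier G \<Longrightarrow> \<phi> g \<le> \<psi> g" and "c \<le> d"
  shows "mean_le \<phi> d"
  unfolding mean_le_def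
proof (intro allI impI)
  fix \<epsilon> :: real assume "\<epsilon> > 0"
  then obtain gs where gs: "averaging gs" "\<forall>t\<in>carrier G. avg gs (\<lambda>g. \<psi> (g \<otimes> t)) \<le> c + \<epsilon>"
    using assms(1) unfolding mean_le_def by blast
  have "avg gs (\<lambda>g. \<phi> (g \<otimes> t)) \<le> d + \<epsilon>" if "t \<in> carrier G" for t
  proof -
    have "avg gs (\<lambda>g. \<phi> (g \<otimes> t)) \<le> avg gs (\<lambda>g. \<psi> (g \<otimes> t))"
      using gs(1) that assms(2) by (intro avg_mono) (auto simp: averaging_def)
    then show ?thesis using gs(2) that assms(3) by force
  qed
  then show "\<exists>gs. averaging gs \<and> (\<forall>t\<in>carrier G. avg gs (\<lambda>g. \<phi> (g \<otimes> t)) \<le> d + \<epsilon>)"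
    using gs(1) by blast
qed

lemma mean_le_const: "mean_le (\<lambda>_. c) c"
  unfolding mean_le_def
  by (intro allI impI exI[of _ "[\<one>]"]) (auto simp: averaging_def avg_const)

lemma mean_le_add:
  assumes "mean_le \<phi> c" "mean_le \<psi> d"
  shows "mean_le (\<lambda>g. \<phi> g + \<psi> g) (c + d)"
  unfolding mean_le_def
proof (intro allI impI)
  fix \<epsilon> :: real assume "\<epsilon> > 0"
  then have "\<epsilon> / 2 > 0" by simp
  obtain gs where
    gs: "averaging gs" "\<And>t. t \<in> carrier G \<Longrightarrow> avg gs (\<lambda>g. \<phi> (g \<otimes> t)) \<le> c + \<epsilon>/2"
    using mean_leE[OF assms(1) \<open>\<epsilon> / 2 > 0\<close>] by blast
  obtain hs where
    hs: "averaging hs" "\<And>t. t \<in> carrier G \<Longrightarrow> avg hs (\<lambda>g. \<psi> (g \<otimes> t)) \<le> d + \<epsilon>/2"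
    using mean_leE[OF assms(2) \<open>\<epsilon> / 2 > 0\<close>] by blast
  have "avg (conv gs hs) (\<lambda>g. \<phi> (g \<otimes> t) + \<psi> (g \<otimes> t)) \<le> c + d + \<epsilon>" if t: "t \<in> carrier G" for t
  proof -
    have "avg (conv gs hs) (\<lambda>g. \<phi> (g \<otimes> t)) = avg hs (\<lambda>h. avg gs (\<lambda>g. \<phi> (g \<otimes> (h \<otimes> t))))"
      unfolding avg_conv avg_swap[of gs]
      using gs(1) hs(1) t by (intro avg_cong) (auto simp: m_assoc averaging_def subset_iff)
    also have "\<dots> \<le> c + \<epsilon>/2"
      using hs(1) t by (intro avg_le gs(2)) (auto simp: averaging_def)
    finally have 1: "avg (conv gs hs) (\<lambda>g. \<phi> (g \<otimes> t)) \<le> c + \<epsilon>/2" .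
    have "avg (conv gs hs) (\<lambda>g. \<psi> (g \<otimes> t)) = avg gs (\<lambda>g. avg hs (\<lambda>h. \<psi> (h \<otimes> (g \<otimes> t))))"
      unfolding avg_conv
      using gs(1) hs(1) t
      by (intro avg_cong) (auto simp: m_ac averaging_def subset_iff)
    also have "\<dots> \<le> d + \<epsilon>/2"
      using gs(1) t by (intro avg_le hs(2)) (auto simp: averaging_def)
    finally show ?thesis using 1 by (simp add: avg_add)
  qed
  then show "\<exists>gs. averaging gs \<and> (\<forall>t\<in>carrier G. avg gs (\<lambda>g. \<phi> (g \<otimes> t) + \<psi> (g \<otimes> t)) \<le> c + d + \<epsilon>)"
    using averaging_conv[OF gs(1) hs(1)] by blast
qed

lemma mean_le_cmult:
  assumes "mean_le \<phi> c" "0 \<le> k"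
  shows "mean_le (\<lambda>g. k * \<phi> g) (k * c)"
proof (cases "k = 0")
  case True
  then show ?thesis using mean_le_const[of 0] by simp
next
  case False
  with assms(2) have k: "k > 0" by simp
  show ?thesis
    unfolding mean_le_def
  proof (intro allI impI)
    fix \<epsilon> :: real assume "\<epsilon> > 0"
    then have "\<epsilon> / k > 0" using k by simp
    then obtain gs where
      gs: "averaging gs" "\<And>t. t \<in> carrier G \<Longrightarrow> avg gs (\<lambda>g. \<phi> (g \<otimes> t)) \<le> c + \<epsilon>/k"
      using mean_leE[OF assms(1)] by blast
    have "avg gs (\<lambda>g. k * \<phi> (g \<otimes> t)) \<le> k * c + \<epsilon>" if "t \<in> carrier G" for t
      using mult_left_mono[OF gs(2)[OF that], of k] k by (simp add: avg_cmult distrib_left)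
    then show "\<exists>gs. averaging gs \<and> (\<forall>t\<in>carrier G. avg gs (\<lambda>g. k * \<phi> (g \<otimes> t)) \<le> k * c + \<epsilon>)"
      using gs(1) by blast
  qed
qed

lemma mean_le_sum:
  assumes "finite I" "\<And>i. i \<in> I \<Longrightarrow> mean_le (\<phi> i) (c i)"
  shows "mean_le (\<lambda>g. \<Sum>i\<in>I. \<phi> i g) (\<Sum>i\<in>I. c i)"
  using assms by (induction I) (auto simp: mean_le_const mean_le_add)

lemma mean_le_exists:
  assumes "mean_le \<phi> c" "c < d"
  shows "\<exists>g\<in>carrier G. \<phi> g < d"
proof -
  have "(d - c) / 2 > 0" using assms(2) by simp
  then obtain gs where gs: "averaging gs" "\<And>t. t \<in> carrier G \<Longrightarrow> avg gs (\<lambda>g. \<phi> (g \<otimes> t)) \<le> c + (d-c)/2"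
    using mean_leE[OF assms(1)] by blast
  have "avg gs (\<lambda>g. \<phi> (g \<otimes> \<one>)) < d" using gs(2)[OF one_closed] assms(2) by argo
  then obtain g where "g \<in> set gs" "\<phi> (g \<otimes> \<one>) < d"
    using avg_exists_le gs(1) by (metis averaging_nonempty)
  then show ?thesis using gs(1) by (auto simp: averaging_def)
qed

lemma syndeticI:
  assumes "S \<subseteq> carrier G" "finite K" "K \<subseteq> carrier G"
    and "\<And>t. t \<in> carrier G \<Longrightarrow> \<exists>k\<in>K. k \<otimes> t \<in> S"
  shows "syndetic G S"
proof -
  have "S <#> (\<lambda>k. inv k) ` K = carrier G"
  proof (intro equalityI subsetI)
    fix t assume t: "t \<in> carrier G"
    then obtain k where k: "k \<in> K" "k \<otimes> t \<in> S" using assms(4) by blast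
    have "t = (k \<otimes> t) \<otimes> inv k"
    proof -
      have kc: "k \<in> carrier G" using k assms(3) by blast
      have "k \<otimes> t = t \<otimes> k" using kc t by (rule m_comm)
      then show ?thesis using kc t by (simp add: m_assoc)
    qed
    then show "t \<in> S <#> (\<lambda>k. inv k) ` K"
      using k unfolding set_mult_def by blast
  qed (use assms in \<open>auto simp: set_mult_def subset_iff\<close>)
  then show ?thesis
    unfolding syndetic_def using assms by (intro conjI exI[of _ "(\<lambda>k. inv k) ` K"]) auto
qed

lemma syndeticE:
  assumes "syndetic G S"
  obtains K where "finite K" "K \<subseteq> carrier G" "\<And>t. t \<in> carrier G \<Longrightarrow> \<exists>k\<in>K. k \<otimes> t \<in> S"
proof -
  obtain F where F: "finite F" "F \<subseteq> carrier G" "S <#> F = carrier G" and S: "S \<subseteq> carrier G"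
    using assms unfolding syndetic_def by blast
  have "\<exists>k\<in>(\<lambda>k. inv k) ` F. k \<otimes> t \<in> S" if "t \<in> carrier G" for t
  proof -
    have "t \<in> S <#> F" using that F(3) by simp
    then obtain s f where sf: "s \<in> S" "f \<in> F" "t = s \<otimes> f"
      unfolding set_mult_def by auto
    have "inv f \<otimes> t = s"
    proof -
      have c: "s \<in> carrier G" "f \<in> carrier G" using sf S F(2) by blast+
      have "s \<otimes> f = f \<otimes> s" using c by (rule m_comm)
      then have "inv f \<otimes> t = inv f \<otimes> f \<otimes> s" using c sf(3) by (simp only: m_assoc inv_closed)
      then show ?thesis using c by simp
    qed
    then show ?thesis using sf(1,2) by auto
  qed
  moreover have "finite ((\<lambda>k. inv k) ` F)" "(\<lambda>k. inv k) ` F \<subseteq> carrier G"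
    using F(1,2) by auto
  ultimately show thesis by (rule that[rotated 2])
qed

text \<open>The list along which the averages are below \<open>d\<close> must meet the sublevel set in each of its
  translates, so its elements witness syndeticity.\<close>

lemma syndetic_level:
  assumes "mean_le \<phi> c" "c < d"
  shows "syndetic G {g \<in> carrier G. \<phi> g < d}"
proof -
  have "(d - c) / 2 > 0" using assms(2) by simp
  then obtain gs where gs: "averaging gs" "\<And>t. t \<in> carrier G \<Longrightarrow> avg gs (\<lambda>g. \<phi> (g \<otimes> t)) \<le> c + (d-c)/2"
    using mean_leE[OF assms(1)] by blast
  show ?thesis
  proof (rule syndeticI[of _ "set gs"])
    fix t assume t: "t \<in> carrier G"
    then have "avg gs (\<lambda>g. \<phi> (g \<otimes> t)) < d" using gs(2)[OF t] assms(2) by argo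
    then obtain g where "g \<in> set gs" "\<phi> (g \<otimes> t) < d"
      using avg_exists_le gs(1) by (metis averaging_nonempty)
    then show "\<exists>k\<in>set gs. k \<otimes> t \<in> {g \<in> carrier G. \<phi> g < d}"
      using gs(1) t by (auto simp: averaging_def)
  qed (use gs in \<open>auto simp: averaging_def\<close>)
qed

text \<open>A syndetic set has positive lower density: every translate of a witness \<open>K\<close> meets it, so the
  average of its complement along \<open>K\<close> misses at least one of \<open>card K\<close> terms.\<close>

lemma syndetic_mean_le:
  assumes "syndetic G S"
  obtains \<kappa> :: real where "\<kappa> > 0" "mean_le (\<lambda>g. indicator (- S) g) (1 - \<kappa>)"
proof -
  obtain K where K: "finite K" "K \<subseteq> carrier G" "\<And>t. t \<in> carrier G \<Longrightarrow> \<exists>k\<in>K. k \<otimes> t \<in> S"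
    using syndeticE[OF assms] by blast
  obtain ks where ks: "set ks = K" "distinct ks" using K(1) finite_distinct_list by blast
  have ne: "ks \<noteq> []" using K(3)[of \<one>] ks by auto
  define \<kappa> where "\<kappa> = 1 / real (length ks)"
  have avg: "avg ks (\<lambda>g. indicator (- S) (g \<otimes> t)) \<le> 1 - \<kappa>" if t: "t \<in> carrier G" for t
  proof -
    obtain k where k: "k \<in> set ks" "k \<otimes> t \<in> S" using K(3)[OF t] ks by blast
    have "(\<Sum>g\<leftarrow>ks. indicator (- S) (g \<otimes> t)) = (\<Sum>g\<in>set ks. indicat_real (- S) (g \<otimes> t))"
      by (simp add: ks(2) sum_list_distinct_conv_sum_set)
    also have "\<dots> = (\<Sum>g\<in>set ks - {k}. indicat_real (- S) (g \<otimes> t))"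
      using k by (intro sum.mono_neutral_right) (auto simp: indicator_def)
    also have "\<dots> \<le> real (card (set ks - {k}))"
      using sum_bounded_above[of "set ks - {k}" "\<lambda>g. indicat_real (- S) (g \<otimes> t)" 1]
      by (simp add: indicator_def)
    also have "card (set ks - {k}) = length ks - 1"
      using k(1) ks(2) by (simp add: distinct_card)
    finally have "(\<Sum>g\<leftarrow>ks. indicat_real (- S) (g \<otimes> t)) \<le> real (length ks) - 1"
      using ne by (cases ks) auto
    then show ?thesis using ne by (simp add: avg_def \<kappa>_def field_simps)
  qed
  show thesis
  proof (rule that)
    show "\<kappa> > 0" using ne by (simp add: \<kappa>_def)
    show "mean_le (\<lambda>g. indicator (- S) g) (1 - \<kappa>)"
      unfolding mean_le_def
    proof (intro allI impI exI[of _ ks] conjI ballI)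
      show "averaging ks" using ne ks K(2) by (simp add: averaging_def)
      show "avg ks (\<lambda>g. indicator (- S) (g \<otimes> t)) \<le> 1 - \<kappa> + \<epsilon>"
        if "\<epsilon> > 0" "t \<in> carrier G" for \<epsilon> t
        using avg[OF that(2)] that(1) by simp
    qed
  qed
qed

end

section \<open>Actions of abelian groups and the mean ergodic theorem\<close>

definition unit_ball :: "'x measure \<Rightarrow> ('x \<Rightarrow> real) set" where
  "unit_ball M = {f \<in> borel_measurable M. \<forall>x\<in>space M. \<bar>f x\<bar> \<le> 1}"

lemma unit_ballI: "f \<in> borel_measurable M \<Longrightarrow> (\<And>x. x \<in> space M \<Longrightarrow> \<bar>f x\<bar> \<le> 1) \<Longrightarrow> f \<in> unit_ball M"
  by (simp add: unit_ball_def)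

lemma unit_ball_measurable: "f \<in> unit_ball M \<Longrightarrow> f \<in> borel_measurable M"
  by (simp add: unit_ball_def)

lemma unit_ball_bound: "f \<in> unit_ball M \<Longrightarrow> x \<in> space M \<Longrightarrow> \<bar>f x\<bar> \<le> 1"
  by (simp add: unit_ball_def)

lemma unit_ball_mult:
  assumes "f \<in> unit_ball M" "g \<in> unit_ball M"
  shows "(\<lambda>x. f x * g x) \<in> unit_ball M"
proof (rule unit_ballI)
  show "\<bar>f x * g x\<bar> \<le> 1" if "x \<in> space M" for x
    using assms that mult_mono[of "\<bar>f x\<bar>" 1 "\<bar>g x\<bar>" 1] by (simp add: unit_ball_def abs_mult)
qed (use assms in \<open>auto simp: unit_ball_def\<close>)

lemma unit_ball_avg:
  assumes "gs \<noteq> []" "\<And>g. g \<in> set gs \<Longrightarrow> f g \<in> unit_ball M"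
  shows "(\<lambda>x. avg gs (\<lambda>g. f g x)) \<in> unit_ball M"
proof (rule unit_ballI)
  show "\<bar>avg gs (\<lambda>g. f g x)\<bar> \<le> 1" if "x \<in> space M" for x
    using assms that by (intro order.trans[OF abs_avg_le] avg_le) (auto simp: unit_ball_def)
qed (use assms in \<open>auto intro!: avg_measurable simp: unit_ball_def\<close>)

lemma unit_ball_indicator: "A \<in> sets M \<Longrightarrow> indicator A \<in> unit_ball M"
  by (intro unit_ballI) (auto simp: indicator_def)

context prob_space
begin

lemma unit_ball_integrable: "f \<in> unit_ball M \<Longrightarrow> integrable M f"
  by (rule integrable_const_bound[where B = 1]) (auto simp: unit_ball_def)

lemma abs_integral_unit_ball_le: "f \<in> unit_ball M \<Longrightarrow> \<bar>\<integral>x. f x \<partial>M\<bar> \<le> 1"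
proof -
  assume f: "f \<in> unit_ball M"
  have "\<bar>\<integral>x. f x \<partial>M\<bar> \<le> (\<integral>x. \<bar>f x\<bar> \<partial>M)" by simp
  also have "\<dots> \<le> (\<integral>x. 1 \<partial>M)"
    using f unit_ball_integrable[OF f] by (intro integral_mono) (auto simp: unit_ball_def)
  finally show ?thesis by (simp add: prob_space)
qed

lemma abs_integral_mult_le:
  assumes "f \<in> unit_ball M" "integrable M h"
  shows "integrable M (\<lambda>x. f x * h x)" "\<bar>\<integral>x. f x * h x \<partial>M\<bar> \<le> (\<integral>x. \<bar>h x\<bar> \<partial>M)"
proof -
  have [measurable]: "f \<in> borel_measurable M" "h \<in> borel_measurable M"
    using assms by (auto simp: unit_ball_def)
  have le: "\<bar>f x * h x\<bar> \<le> \<bar>h x\<bar>" if "x \<in> space M" for x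
    using unit_ball_bound[OF assms(1) that] mult_right_mono[of "\<bar>f x\<bar>" 1 "\<bar>h x\<bar>"]
    by (simp add: abs_mult)
  show i: "integrable M (\<lambda>x. f x * h x)"
  proof (rule Bochner_Integration.integrable_bound[OF assms(2)])
    show "AE x in M. norm (f x * h x) \<le> norm (h x)"
      unfolding real_norm_def by (rule AE_I2) (rule le)
  qed measurable
  have "\<bar>\<integral>x. f x * h x \<partial>M\<bar> \<le> (\<integral>x. \<bar>f x * h x\<bar> \<partial>M)" by simp
  also have "\<dots> \<le> (\<integral>x. \<bar>h x\<bar> \<partial>M)"
    by (rule integral_mono[OF integrable_abs[OF i] integrable_abs[OF assms(2)] le])
  finally show "\<bar>\<integral>x. f x * h x \<partial>M\<bar> \<le> (\<integral>x. \<bar>h x\<bar> \<partial>M)" .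
qed

lemma L1_le_L2:
  fixes h :: "'a \<Rightarrow> real"
  assumes "integrable M h" "integrable M (\<lambda>x. (h x)\<^sup>2)"
  shows "(\<integral>x. \<bar>h x\<bar> \<partial>M)\<^sup>2 \<le> (\<integral>x. (h x)\<^sup>2 \<partial>M)"
proof -
  have "0 \<le> variance (\<lambda>x. \<bar>h x\<bar>)" by (rule variance_positive)
  also have "\<dots> = (\<integral>x. (h x)\<^sup>2 \<partial>M) - (\<integral>x. \<bar>h x\<bar> \<partial>M)\<^sup>2"
    using variance_eq[of "\<lambda>x. \<bar>h x\<bar>"] assms by simp
  finally show ?thesis by simp
qed

lemma L1_triangle:
  fixes f g h :: "'a \<Rightarrow> real"
  assumes "integrable M f" "integrable M g" "integrable M h"
  shows "(\<integral>x. \<bar>f x - h x\<bar> \<partial>M) \<le> (\<integral>x. \<bar>f x - g x\<bar> \<partial>M) + (\<integral>x. \<bar>g x - h x\<bar> \<partial>M)"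
proof -
  have "(\<integral>x. \<bar>f x - h x\<bar> \<partial>M) \<le> (\<integral>x. \<bar>f x - g x\<bar> + \<bar>g x - h x\<bar> \<partial>M)"
    using assms by (intro integral_mono) auto
  then show ?thesis using assms by simp
qed

lemma unit_ball_L1_complete:
  fixes s :: "nat \<Rightarrow> 'a \<Rightarrow> real"
  assumes s: "\<And>n. s n \<in> unit_ball M"
    and cauchy: "\<And>e. e > 0 \<Longrightarrow> \<exists>N. \<forall>i\<ge>N. \<forall>j\<ge>N. (\<integral>x. \<bar>s i x - s j x\<bar> \<partial>M) < e"
  obtains F r where "F \<in> unit_ball M" "strict_mono r"
    "(\<lambda>n. \<integral>x. \<bar>s (r n) x - F x\<bar> \<partial>M) \<longlonglongrightarrow> 0"
proof -
  obtain r :: "nat \<Rightarrow> nat" where r: "strict_mono r" and AE: "AE x in M. Cauchy (\<lambda>i. s (r i) x)"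
    using cauchy_L1_AE_cauchy_subseq[of M s] s cauchy by (auto simp: unit_ball_integrable)
  have [measurable]: "s n \<in> borel_measurable M" for n using s by (auto simp: unit_ball_def)
  \<comment> \<open>Clipping keeps the limit in the unit ball also where the sequence diverges.\<close>
  define F where "F x = max (- 1) (min 1 (lim (\<lambda>i. s (r i) x)))" for x
  have F: "F \<in> unit_ball M"
    by (rule unit_ballI) (auto simp: F_def[abs_def])
  then have [measurable]: "F \<in> borel_measurable M" by (auto simp: unit_ball_def)
  have conv: "AE x in M. (\<lambda>n. \<bar>s (r n) x - F x\<bar>) \<longlonglongrightarrow> 0"
    using AE AE_space
  proof eventually_elim
    fix x assume x: "Cauchy (\<lambda>i. s (r i) x)" "x \<in> space M"
    then have l: "(\<lambda>i. s (r i) x) \<longlonglongrightarrow> lim (\<lambda>i. s (r i) x)"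
      by (simp add: Cauchy_convergent_iff convergent_LIMSEQ_iff)
    have "(\<lambda>i. max (- 1) (min 1 (s (r i) x))) \<longlonglongrightarrow> F x"
      unfolding F_def by (intro tendsto_intros l)
    moreover have "max (- 1) (min 1 (s (r i) x)) = s (r i) x" for i
      using unit_ball_bound[OF s x(2), of "r i"] by (auto simp: max_def min_def)
    ultimately have "(\<lambda>i. s (r i) x) \<longlonglongrightarrow> F x" by simp
    then show "(\<lambda>n. \<bar>s (r n) x - F x\<bar>) \<longlonglongrightarrow> 0"
      by (simp add: LIM_zero_iff tendsto_rabs_zero_iff)
  qed
  have "(\<lambda>n. \<integral>x. \<bar>s (r n) x - F x\<bar> \<partial>M) \<longlonglongrightarrow> (\<integral>x. 0 \<partial>M)"
  proof (rule integral_dominated_convergence[where w = "\<lambda>_. 2"])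
    show "AE x in M. norm \<bar>s (r n) x - F x\<bar> \<le> 2" for n
    proof (rule AE_I2)
      fix x assume "x \<in> space M"
      then show "norm \<bar>s (r n) x - F x\<bar> \<le> 2"
        using unit_ball_bound[OF s, of x "r n"] unit_ball_bound[OF F, of x] by simp
    qed
  qed (use conv in auto)
  then show thesis using that F r by simp
qed

end

locale abelian_action = comm_group G + prob_space M
  for G :: "('g, 'm) monoid_scheme" (structure)
    and M :: "'x measure"
    and S :: "'g \<Rightarrow> 'x \<Rightarrow> 'x" +
  assumes S_preserves: "g \<in> carrier G \<Longrightarrow> measure_preserving M (S g)"
    and S_mult: "\<lbrakk>g \<in> carrier G; h \<in> carrier G; x \<in> space M\<rbrakk> \<Longrightarrow> S (g \<otimes> h) x = S g (S h x)"
    and S_one: "x \<in> space M \<Longrightarrow> S \<one> x = x"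
begin

lemma S_measurable: "g \<in> carrier G \<Longrightarrow> S g \<in> M \<rightarrow>\<^sub>M M"
  using S_preserves by (simp add: measure_preserving_def)

lemma S_space: "g \<in> carrier G \<Longrightarrow> x \<in> space M \<Longrightarrow> S g x \<in> space M"
  using S_measurable by (meson measurable_space)

lemma S_comp_measurable:
  "g \<in> carrier G \<Longrightarrow> f \<in> borel_measurable M \<Longrightarrow> (\<lambda>x. f (S g x)) \<in> borel_measurable M"
  using measurable_compose[OF S_measurable] by blast

lemma unit_ball_S: "g \<in> carrier G \<Longrightarrow> f \<in> unit_ball M \<Longrightarrow> (\<lambda>x. f (S g x)) \<in> unit_ball M"
  by (simp add: unit_ball_def S_comp_measurable S_space)

lemma distr_S: "g \<in> carrier G \<Longrightarrow> distr M M (S g) = M"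
  using S_preserves by (simp add: measure_preserving_def)

lemma integral_S:
  fixes f :: "'x \<Rightarrow> real"
  assumes "g \<in> carrier G" "f \<in> borel_measurable M"
  shows "(\<integral>x. f (S g x) \<partial>M) = (\<integral>x. f x \<partial>M)"
  using integral_distr[OF S_measurable[OF assms(1)] assms(2)] distr_S[OF assms(1)] by simp

lemma integrable_S:
  fixes f :: "'x \<Rightarrow> real"
  assumes "g \<in> carrier G" "integrable M f"
  shows "integrable M (\<lambda>x. f (S g x))"
  using integrable_distr[OF S_measurable[OF assms(1)], of f] distr_S[OF assms(1)] assms(2) by simp

lemma AE_S:
  assumes "g \<in> carrier G" "AE x in M. P x"
  shows "AE x in M. P (S g x)"
  using AE_distrD[OF S_measurable[OF assms(1)], of P, unfolded distr_S[OF assms(1)], OF assms(2)] .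

abbreviation ergodic_avg :: "'g list \<Rightarrow> ('x \<Rightarrow> real) \<Rightarrow> 'x \<Rightarrow> real" where
  "ergodic_avg gs f x \<equiv> avg gs (\<lambda>g. f (S g x))"

lemma ergodic_avg_unit_ball:
  "averaging gs \<Longrightarrow> f \<in> unit_ball M \<Longrightarrow> ergodic_avg gs f \<in> unit_ball M"
  by (intro unit_ball_avg unit_ball_S) (auto simp: averaging_def)

lemma ergodic_avg_conv:
  assumes "averaging gs" "averaging hs" "x \<in> space M"
  shows "ergodic_avg (conv gs hs) f x = ergodic_avg hs (ergodic_avg gs f) x"
  unfolding avg_conv avg_swap[of gs] using assms
  by (intro avg_cong) (auto simp: averaging_def subset_iff S_mult)

lemma ergodic_avg_commute:
  assumes "averaging gs" "averaging hs" "x \<in> space M"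
  shows "ergodic_avg hs (ergodic_avg gs f) x = ergodic_avg gs (ergodic_avg hs f) x"
  unfolding avg_swap[of hs] using assms
  by (intro avg_cong) (auto simp: averaging_def subset_iff S_mult[symmetric] m_comm)

text \<open>An average whose \<open>L\<^sup>2\<close> norm is nearly minimal is nearly invariant: otherwise, by
  the parallelogram law, its midpoint with a translate would be a still shorter average.\<close>

lemma nearly_minimal_nearly_invariant:
  assumes f: "f \<in> unit_ball M" and gs: "averaging gs" and g: "g \<in> carrier G"
    and min: "\<And>hs. averaging hs \<Longrightarrow>
      (\<integral>x. (ergodic_avg gs f x)\<^sup>2 \<partial>M) \<le> (\<integral>x. (ergodic_avg hs f x)\<^sup>2 \<partial>M) + \<delta>"
  shows "(\<integral>x. \<bar>ergodic_avg gs f (S g x) - ergodic_avg gs f x\<bar> \<partial>M)\<^sup>2 \<le> 4 * \<delta>"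
proof -
  define F where "F = ergodic_avg gs f"
  have F: "F \<in> unit_ball M" unfolding F_def by (rule ergodic_avg_unit_ball[OF gs f])
  have Fg: "(\<lambda>x. F (S g x)) \<in> unit_ball M" by (rule unit_ball_S[OF g F])
  have i: "integrable M (\<lambda>x. (F x)\<^sup>2)" "integrable M (\<lambda>x. (F (S g x))\<^sup>2)"
    "integrable M (\<lambda>x. F x * F (S g x))"
    using F Fg by (auto intro!: unit_ball_integrable unit_ball_mult simp: power2_eq_square)
  have *: "averaging (conv gs [\<one>, g])"
    using g by (intro averaging_conv gs) (simp add: averaging_def)
  have "(\<integral>x. (F x)\<^sup>2 \<partial>M) \<le> (\<integral>x. (ergodic_avg (conv gs [\<one>, g]) f x)\<^sup>2 \<partial>M) + \<delta>"
    unfolding F_def by (rule min[OF *])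
  also have "(\<integral>x. (ergodic_avg (conv gs [\<one>, g]) f x)\<^sup>2 \<partial>M) =
      (\<integral>x. ((F x)\<^sup>2 + (F (S g x))\<^sup>2 + 2 * (F x * F (S g x))) / 4 \<partial>M)"
  proof (rule Bochner_Integration.integral_cong[OF refl])
    fix x assume x: "x \<in> space M"
    have "ergodic_avg (conv gs [\<one>, g]) f x = ergodic_avg [\<one>, g] F x"
      unfolding F_def using g x by (intro ergodic_avg_conv gs) (simp_all add: averaging_def)
    also have "\<dots> = (F x + F (S g x)) / 2"
      using x by (simp add: avg_def S_one)
    finally have eq: "ergodic_avg (conv gs [\<one>, g]) f x = (F x + F (S g x)) / 2" .
    show "(ergodic_avg (conv gs [\<one>, g]) f x)\<^sup>2 =
        ((F x)\<^sup>2 + (F (S g x))\<^sup>2 + 2 * (F x * F (S g x))) / 4"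
      unfolding eq by (simp add: power2_eq_square field_simps)
  qed
  also have "\<dots> = ((\<integral>x. (F x)\<^sup>2 \<partial>M) + (\<integral>x. (F (S g x))\<^sup>2 \<partial>M) + 2 * (\<integral>x. F x * F (S g x) \<partial>M)) / 4"
    using i by simp
  also have "(\<integral>x. (F (S g x))\<^sup>2 \<partial>M) = (\<integral>x. (F x)\<^sup>2 \<partial>M)"
    using F by (intro integral_S[OF g]) (auto simp: unit_ball_def)
  finally have 1: "2 * (\<integral>x. (F x)\<^sup>2 \<partial>M) - 2 * (\<integral>x. F x * F (S g x) \<partial>M) \<le> 4 * \<delta>"
    by (simp add: field_simps)
  have eq2: "(F (S g x) - F x)\<^sup>2 = (F (S g x))\<^sup>2 + (F x)\<^sup>2 - 2 * (F x * F (S g x))" for x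
    by (simp add: power2_diff mult.commute mult.left_commute)
  have "(\<integral>x. (F (S g x) - F x)\<^sup>2 \<partial>M) = (\<integral>x. (F (S g x))\<^sup>2 \<partial>M) + (\<integral>x. (F x)\<^sup>2 \<partial>M) - 2 * (\<integral>x. F x * F (S g x) \<partial>M)"
    unfolding eq2 using i by simp
  also have "(\<integral>x. (F (S g x))\<^sup>2 \<partial>M) = (\<integral>x. (F x)\<^sup>2 \<partial>M)"
    using F by (intro integral_S[OF g]) (auto simp: unit_ball_def)
  finally have 2: "(\<integral>x. (F (S g x) - F x)\<^sup>2 \<partial>M) \<le> 4 * \<delta>" using 1 by simp
  have "(\<integral>x. \<bar>F (S g x) - F x\<bar> \<partial>M)\<^sup>2 \<le> (\<integral>x. (F (S g x) - F x)\<^sup>2 \<partial>M)"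
  proof (rule L1_le_L2)
    show "integrable M (\<lambda>x. F (S g x) - F x)"
      using F Fg by (auto intro: unit_ball_integrable)
    show "integrable M (\<lambda>x. (F (S g x) - F x)\<^sup>2)"
      unfolding eq2 using i
      by (intro Bochner_Integration.integrable_diff Bochner_Integration.integrable_add
          integrable_mult_right)
  qed
  then show ?thesis using 2 by (simp add: F_def)
qed

lemma exists_nearly_invariant_avg:
  assumes f: "f \<in> unit_ball M" and e: "e > 0"
  shows "\<exists>gs. averaging gs \<and>
    (\<forall>g\<in>carrier G. (\<integral>x. \<bar>ergodic_avg gs f (S g x) - ergodic_avg gs f x\<bar> \<partial>M) \<le> e)"
proof -
  define E where "E gs = (\<integral>x. (ergodic_avg gs f x)\<^sup>2 \<partial>M)" for gs
  define X where "X = E ` Collect averaging"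
  have ne: "X \<noteq> {}" unfolding X_def by (auto simp: averaging_def intro!: exI[of _ "[\<one>]"])
  have bdd: "bdd_below X" by (rule bdd_belowI[of _ 0]) (auto simp: X_def E_def)
  have "Inf X < Inf X + (e/2)\<^sup>2" using e by simp
  then obtain gs where gs: "averaging gs" "E gs < Inf X + (e/2)\<^sup>2"
    using cInf_lessD[OF ne, of "Inf X + (e/2)\<^sup>2"] by (auto simp: X_def)
  have min: "E gs \<le> E hs + (e/2)\<^sup>2" if "averaging hs" for hs
    using cInf_lower[OF _ bdd, of "E hs"] gs(2) that by (force simp: X_def)
  have "(\<integral>x. \<bar>ergodic_avg gs f (S g x) - ergodic_avg gs f x\<bar> \<partial>M) \<le> e" if g: "g \<in> carrier G" for g
  proof (rule power2_le_imp_le)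
    show "(\<integral>x. \<bar>ergodic_avg gs f (S g x) - ergodic_avg gs f x\<bar> \<partial>M)\<^sup>2 \<le> e\<^sup>2"
      using nearly_minimal_nearly_invariant[OF f gs(1) g, of "(e/2)\<^sup>2"] min
      by (simp add: E_def power_divide)
  qed (use e in simp)
  then show ?thesis using gs(1) by blast
qed

text \<open>Nearly invariant averages are close to each other, since averaging two of them again, along
  each other's lists, gives the same function in either order. Hence they form a Cauchy sequence.\<close>

theorem mean_ergodic:
  assumes f: "f \<in> unit_ball M"
  obtains F where "F \<in> unit_ball M"
    "\<And>g. g \<in> carrier G \<Longrightarrow> AE x in M. F (S g x) = F x"
    "\<And>\<epsilon>. \<epsilon> > 0 \<Longrightarrow> \<exists>gs. averaging gs \<and> (\<integral>x. \<bar>ergodic_avg gs f x - F x\<bar> \<partial>M) < \<epsilon>"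
proof -
  have "\<forall>n. \<exists>gs. averaging gs \<and>
      (\<forall>g\<in>carrier G. (\<integral>x. \<bar>ergodic_avg gs f (S g x) - ergodic_avg gs f x\<bar> \<partial>M) \<le> 1 / real (Suc n))"
    by (intro allI exists_nearly_invariant_avg[OF f]) simp
  from choice[OF this] obtain gs where gs: "\<And>n. averaging (gs n)" and
    inv: "\<And>n g. g \<in> carrier G \<Longrightarrow>
      (\<integral>x. \<bar>ergodic_avg (gs n) f (S g x) - ergodic_avg (gs n) f x\<bar> \<partial>M) \<le> 1 / real (Suc n)"
    by blast
  define s where "s n = ergodic_avg (gs n) f" for n
  have s: "s n \<in> unit_ball M" for n
    unfolding s_def by (rule ergodic_avg_unit_ball[OF gs f])
  have avg_s: "(\<integral>x. \<bar>ergodic_avg hs (s n) x - s n x\<bar> \<partial>M) \<le> 1 / real (Suc n)"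
    if hs: "averaging hs" for hs n
  proof -
    have i: "integrable M (\<lambda>x. \<bar>s n (S h x) - s n x\<bar>)" if "h \<in> set hs" for h
      using s unit_ball_S[of h "s n"] averaging_in[OF hs that]
      by (intro integrable_abs Bochner_Integration.integrable_diff unit_ball_integrable) auto
    have "\<bar>ergodic_avg hs (s n) x - s n x\<bar> \<le> avg hs (\<lambda>h. \<bar>s n (S h x) - s n x\<bar>)" for x
      using abs_avg_le[of hs "\<lambda>h. s n (S h x) - s n x"] averaging_nonempty[OF hs]
      by (simp add: avg_diff avg_const)
    then have "(\<integral>x. \<bar>ergodic_avg hs (s n) x - s n x\<bar> \<partial>M)
        \<le> (\<integral>x. avg hs (\<lambda>h. \<bar>s n (S h x) - s n x\<bar>) \<partial>M)"
      using ergodic_avg_unit_ball[OF hs s] s i unit_ball_S[OF averaging_in[OF hs] s]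
      by (intro integral_mono avg_integrable integrable_abs
          Bochner_Integration.integrable_diff unit_ball_integrable) auto
    also have "\<dots> = avg hs (\<lambda>h. \<integral>x. \<bar>s n (S h x) - s n x\<bar> \<partial>M)"
      using i by (rule avg_integrable)
    also have "\<dots> \<le> 1 / real (Suc n)"
      using inv averaging_in[OF hs] averaging_nonempty[OF hs] unfolding s_def by (intro avg_le) auto
    finally show ?thesis .
  qed
  have dist: "(\<integral>x. \<bar>s i x - s j x\<bar> \<partial>M) \<le> 1 / real (Suc i) + 1 / real (Suc j)" for i j
  proof -
    have "(\<integral>x. \<bar>s i x - s j x\<bar> \<partial>M) \<le>
        (\<integral>x. \<bar>s i x - ergodic_avg (gs j) (s i) x\<bar> \<partial>M) + (\<integral>x. \<bar>ergodic_avg (gs j) (s i) x - s j x\<bar> \<partial>M)"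
      by (intro L1_triangle unit_ball_integrable s ergodic_avg_unit_ball gs)
    also have "(\<integral>x. \<bar>ergodic_avg (gs j) (s i) x - s j x\<bar> \<partial>M) =
        (\<integral>x. \<bar>ergodic_avg (gs i) (s j) x - s j x\<bar> \<partial>M)"
      unfolding s_def
      by (intro Bochner_Integration.integral_cong refl) (simp add: ergodic_avg_commute[OF gs gs])
    finally show ?thesis
      using avg_s[OF gs, of i j] avg_s[OF gs, of j i] by (simp add: abs_minus_commute)
  qed
  have cauchy: "\<exists>N. \<forall>i\<ge>N. \<forall>j\<ge>N. (\<integral>x. \<bar>s i x - s j x\<bar> \<partial>M) < e" if "e > 0" for e
  proof -
    obtain N where N: "1 / real (Suc N) < e / 2"
      using reals_Archimedean[of "e/2"] \<open>e > 0\<close> by (auto simp: inverse_eq_divide)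
    have "(\<integral>x. \<bar>s i x - s j x\<bar> \<partial>M) < e" if "i \<ge> N" "j \<ge> N" for i j
    proof -
      have "1 / real (Suc i) \<le> 1 / real (Suc N)" "1 / real (Suc j) \<le> 1 / real (Suc N)"
        using that by (auto intro!: divide_left_mono)
      then show ?thesis using dist[of i j] N by linarith
    qed
    then show ?thesis by blast
  qed
  obtain F r where F: "F \<in> unit_ball M" and r: "strict_mono r"
    and lim: "(\<lambda>n. \<integral>x. \<bar>s (r n) x - F x\<bar> \<partial>M) \<longlonglongrightarrow> 0"
    using unit_ball_L1_complete[OF s cauchy] by blast
  have inv_F: "AE x in M. F (S g x) = F x" if g: "g \<in> carrier G" for g
  proof -
    have Fg: "(\<lambda>x. F (S g x)) \<in> unit_ball M" by (rule unit_ball_S[OF g F])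
    have "(\<integral>x. \<bar>F (S g x) - F x\<bar> \<partial>M) \<le> 2 * (\<integral>x. \<bar>s (r n) x - F x\<bar> \<partial>M) + 1 / real (Suc (r n))" for n
    proof -
      have sg: "(\<lambda>x. s (r n) (S g x)) \<in> unit_ball M" by (rule unit_ball_S[OF g s])
      have "(\<integral>x. \<bar>F (S g x) - F x\<bar> \<partial>M) \<le> (\<integral>x. \<bar>F (S g x) - s (r n) (S g x)\<bar> \<partial>M)
          + (\<integral>x. \<bar>s (r n) (S g x) - F x\<bar> \<partial>M)"
        by (intro L1_triangle unit_ball_integrable F s Fg sg)
      also have "(\<integral>x. \<bar>F (S g x) - s (r n) (S g x)\<bar> \<partial>M) = (\<integral>x. \<bar>F x - s (r n) x\<bar> \<partial>M)"
        by (intro integral_S[OF g, of "\<lambda>x. \<bar>F x - s (r n) x\<bar>"] borel_measurable_abs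
            borel_measurable_diff unit_ball_measurable[OF F] unit_ball_measurable[OF s])
      also have "(\<integral>x. \<bar>s (r n) (S g x) - F x\<bar> \<partial>M) \<le> (\<integral>x. \<bar>s (r n) (S g x) - s (r n) x\<bar> \<partial>M)
          + (\<integral>x. \<bar>s (r n) x - F x\<bar> \<partial>M)"
        by (intro L1_triangle unit_ball_integrable F s Fg sg)
      finally show ?thesis
        using inv[OF g, of "r n"] by (simp add: s_def abs_minus_commute)
    qed
    moreover have "(\<lambda>n. 1 / real (Suc (r n))) \<longlonglongrightarrow> 0"
      using LIMSEQ_subseq_LIMSEQ[OF LIMSEQ_inverse_real_of_nat r]
      by (simp add: o_def inverse_eq_divide)
    then have "(\<lambda>n. 2 * (\<integral>x. \<bar>s (r n) x - F x\<bar> \<partial>M) + 1 / real (Suc (r n))) \<longlonglongrightarrow> 2 * 0 + 0"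
      by (intro tendsto_intros lim)
    ultimately have "(\<integral>x. \<bar>F (S g x) - F x\<bar> \<partial>M) \<le> 0"
      by (intro LIMSEQ_le_const[where a = "\<integral>x. \<bar>F (S g x) - F x\<bar> \<partial>M"]) auto
    then have "(\<integral>x. \<bar>F (S g x) - F x\<bar> \<partial>M) = 0" by (simp add: antisym)
    then have "AE x in M. \<bar>F (S g x) - F x\<bar> = 0"
      using integral_nonneg_eq_0_iff_AE[OF integrable_abs[OF Bochner_Integration.integrable_diff[OF
            unit_ball_integrable[OF Fg] unit_ball_integrable[OF F]]]] by simp
    then show ?thesis by simp
  qed
  have "\<exists>gs. averaging gs \<and> (\<integral>x. \<bar>ergodic_avg gs f x - F x\<bar> \<partial>M) < \<epsilon>" if "\<epsilon> > 0" for \<epsilon>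
  proof -
    have "eventually (\<lambda>n. (\<integral>x. \<bar>s (r n) x - F x\<bar> \<partial>M) < \<epsilon>) sequentially"
      using order_tendstoD(2)[OF lim that] .
    then obtain n where "(\<integral>x. \<bar>s (r n) x - F x\<bar> \<partial>M) < \<epsilon>"
      using eventually_happens by force
    then show ?thesis using gs unfolding s_def by blast
  qed
  then show thesis using that F inv_F by blast
qed

end

section \<open>Almost periodic functions\<close>

text \<open>Total boundedness of a distance, phrased with finite colourings whose classes have
  small diameter. Unlike nets, colourings combine by pairing colours, without appeal to the
  triangle inequality.\<close>

definition precompact :: "'g set \<Rightarrow> ('g \<Rightarrow> 'g \<Rightarrow> real) \<Rightarrow> bool" where
  "precompact X d \<longleftrightarrow>
    (\<forall>\<epsilon>>0. \<exists>c :: 'g \<Rightarrow> nat. finite (c ` X) \<and> (\<forall>g\<in>X. \<forall>h\<in>X. c g = c h \<longrightarrow> d g h < \<epsilon>))"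

lemma precompactE:
  assumes "precompact X d" "\<epsilon> > 0"
  obtains c :: "'g \<Rightarrow> nat" where "finite (c ` X)"
    "\<And>g h. g \<in> X \<Longrightarrow> h \<in> X \<Longrightarrow> c g = c h \<Longrightarrow> d g h < \<epsilon>"
proof -
  obtain c :: "'g \<Rightarrow> nat" where "finite (c ` X) \<and> (\<forall>g\<in>X. \<forall>h\<in>X. c g = c h \<longrightarrow> d g h < \<epsilon>)"
    using assms unfolding precompact_def by blast
  then show thesis by (intro that[of c]) auto
qed

lemma precompact_approx:
  assumes "\<And>\<epsilon>. \<epsilon> > 0 \<Longrightarrow> \<exists>d'. precompact X d' \<and> (\<forall>g\<in>X. \<forall>h\<in>X. d g h \<le> d' g h + \<epsilon>)"
  shows "precompact X d"
  unfolding precompact_def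
proof (intro allI impI)
  fix \<epsilon> :: real assume "\<epsilon> > 0"
  then have e: "\<epsilon> / 2 > 0" by simp
  obtain d' where d': "precompact X d'" "\<And>g h. g \<in> X \<Longrightarrow> h \<in> X \<Longrightarrow> d g h \<le> d' g h + \<epsilon>/2"
    using assms[OF e] by blast
  obtain c :: "'a \<Rightarrow> nat" where c: "finite (c ` X)"
    "\<And>g h. g \<in> X \<Longrightarrow> h \<in> X \<Longrightarrow> c g = c h \<Longrightarrow> d' g h < \<epsilon>/2"
    using precompactE[OF d'(1) e] by blast
  have "d g h < \<epsilon>" if "g \<in> X" "h \<in> X" "c g = c h" for g h
    using d'(2)[OF that(1,2)] c(2)[OF that] by simp
  then show "\<exists>c :: 'a \<Rightarrow> nat. finite (c ` X) \<and> (\<forall>g\<in>X. \<forall>h\<in>X. c g = c h \<longrightarrow> d g h < \<epsilon>)"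
    using c(1) by blast
qed

lemma precompact_mono:
  assumes "precompact X d'" "\<And>g h. g \<in> X \<Longrightarrow> h \<in> X \<Longrightarrow> d g h \<le> d' g h"
  shows "precompact X d"
  using assms by (intro precompact_approx exI[of _ d']) (auto intro: add_increasing2)

lemma precompact_add:
  assumes "precompact X d" "precompact X d'"
  shows "precompact X (\<lambda>g h. d g h + d' g h)"
  unfolding precompact_def
proof (intro allI impI)
  fix \<epsilon> :: real assume "\<epsilon> > 0"
  then have e: "\<epsilon> / 2 > 0" by simp
  obtain c :: "'a \<Rightarrow> nat" where c: "finite (c ` X)"
    "\<And>g h. g \<in> X \<Longrightarrow> h \<in> X \<Longrightarrow> c g = c h \<Longrightarrow> d g h < \<epsilon>/2"
    using precompactE[OF assms(1) e] by blast
  obtain c' :: "'a \<Rightarrow> nat" where c': "finite (c' ` X)"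
    "\<And>g h. g \<in> X \<Longrightarrow> h \<in> X \<Longrightarrow> c' g = c' h \<Longrightarrow> d' g h < \<epsilon>/2"
    using precompactE[OF assms(2) e] by blast
  have "(\<lambda>g. prod_encode (c g, c' g)) ` X \<subseteq> prod_encode ` (c ` X \<times> c' ` X)" by blast
  then have fin: "finite ((\<lambda>g. prod_encode (c g, c' g)) ` X)"
    using c(1) c'(1) by (meson finite_SigmaI finite_imageI finite_subset)
  have "d g h + d' g h < \<epsilon>"
    if "g \<in> X" "h \<in> X" "prod_encode (c g, c' g) = prod_encode (c h, c' h)" for g h
  proof -
    have "c g = c h" "c' g = c' h" using that(3) by auto
    then show ?thesis using c(2)[OF that(1,2)] c'(2)[OF that(1,2)] by simp
  qed
  then show "\<exists>c :: 'a \<Rightarrow> nat. finite (c ` X) \<and> (\<forall>g\<in>X. \<forall>h\<in>X. c g = c h \<longrightarrow> d g h + d' g h < \<epsilon>)"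
    using fin by (intro exI[of _ "\<lambda>g. prod_encode (c g, c' g)"]) blast
qed

lemma precompact_zero: "precompact X (\<lambda>g h. 0)"
  unfolding precompact_def
  by (intro allI impI exI[of _ "\<lambda>_. 0"]) (auto intro: finite_subset[of _ "{0}"])

lemma precompact_cmult:
  assumes "precompact X d" "k \<ge> 0"
  shows "precompact X (\<lambda>g h. k * d g h)"
proof (cases "k = 0")
  case True
  then show ?thesis by (simp add: precompact_zero)
next
  case False
  with assms(2) have k: "k > 0" by simp
  show ?thesis
    unfolding precompact_def
  proof (intro allI impI)
    fix \<epsilon> :: real assume "\<epsilon> > 0"
    then have "\<epsilon> / k > 0" using k by simp
    then obtain c :: "'a \<Rightarrow> nat" where c: "finite (c ` X)"
      "\<And>g h. g \<in> X \<Longrightarrow> h \<in> X \<Longrightarrow> c g = c h \<Longrightarrow> d g h < \<epsilon> / k"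
      using precompactE[OF assms(1)] by blast
    have "k * d g h < \<epsilon>" if "g \<in> X" "h \<in> X" "c g = c h" for g h
      using c(2)[OF that] k by (simp add: pos_less_divide_eq mult.commute)
    then show "\<exists>c :: 'a \<Rightarrow> nat. finite (c ` X) \<and> (\<forall>g\<in>X. \<forall>h\<in>X. c g = c h \<longrightarrow> k * d g h < \<epsilon>)"
      using c(1) by blast
  qed
qed

lemma precompact_avg:
  assumes "\<And>k. k \<in> set ks \<Longrightarrow> precompact X (\<lambda>g h. d k g h)"
  shows "precompact X (\<lambda>g h. avg ks (\<lambda>k. d k g h))"
proof -
  have "precompact X (\<lambda>g h. \<Sum>k\<leftarrow>ks. d k g h)"
    using assms by (induction ks) (auto intro: precompact_zero precompact_add)
  then have "precompact X (\<lambda>g h. (1 / real (length ks)) * (\<Sum>k\<leftarrow>ks. d k g h))"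
    by (rule precompact_cmult) simp
  then show ?thesis by (simp add: avg_def)
qed

lemma precompact_bounded_real:
  assumes "\<And>g. g \<in> X \<Longrightarrow> \<bar>\<alpha> g\<bar> \<le> C"
  shows "precompact X (\<lambda>g h. \<bar>\<alpha> g - \<alpha> h\<bar>)"
  unfolding precompact_def
proof (intro allI impI)
  fix \<epsilon> :: real assume e: "\<epsilon> > 0"
  define c where "c g = nat \<lfloor>(\<alpha> g + C) / \<epsilon>\<rfloor>" for g
  have nn: "0 \<le> (\<alpha> g + C) / \<epsilon>" if "g \<in> X" for g
    using assms[OF that] e by (intro divide_nonneg_pos) auto
  have "c g \<le> nat \<lfloor>2 * C / \<epsilon>\<rfloor>" if "g \<in> X" for g
    using assms[OF that] e unfolding c_def
    by (intro nat_mono floor_mono divide_right_mono) auto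
  then have "c ` X \<subseteq> {.. nat \<lfloor>2 * C / \<epsilon>\<rfloor>}" by auto
  then have fin: "finite (c ` X)" by (rule finite_subset) simp
  have "\<bar>\<alpha> g - \<alpha> h\<bar> < \<epsilon>" if "g \<in> X" "h \<in> X" "c g = c h" for g h
  proof -
    have "\<lfloor>(\<alpha> g + C) / \<epsilon>\<rfloor> = \<lfloor>(\<alpha> h + C) / \<epsilon>\<rfloor>"
      using that(3) nn[OF that(1)] nn[OF that(2)] unfolding c_def
      by (metis eq_nat_nat_iff zero_le_floor)
    then have "\<bar>(\<alpha> g + C) / \<epsilon> - (\<alpha> h + C) / \<epsilon>\<bar> < 1" by linarith
    also have "(\<alpha> g + C) / \<epsilon> - (\<alpha> h + C) / \<epsilon> = (\<alpha> g - \<alpha> h) / \<epsilon>"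
      by (simp add: diff_divide_distrib add_divide_distrib)
    finally show ?thesis using e by (simp add: abs_divide)
  qed
  then show "\<exists>c :: 'a \<Rightarrow> nat. finite (c ` X) \<and> (\<forall>g\<in>X. \<forall>h\<in>X. c g = c h \<longrightarrow> \<bar>\<alpha> g - \<alpha> h\<bar> < \<epsilon>)"
    using fin by blast
qed

text \<open>Elements of one colour differ by an almost period, so one representative for each colour gives a
  finite set of translations that reaches an almost period from anywhere.\<close>

lemma (in comm_group) precompact_syndetic:
  assumes d: "precompact (carrier G) d" and \<epsilon>: "\<epsilon> > 0"
    and inv: "\<And>g h k. \<lbrakk>g \<in> carrier G; h \<in> carrier G; k \<in> carrier G\<rbrakk> \<Longrightarrow> d (k \<otimes> g) (k \<otimes> h) = d g h"
  shows "syndetic G {g \<in> carrier G. d g \<one> < \<epsilon>}"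
proof -
  obtain c :: "'a \<Rightarrow> nat" where c: "finite (c ` carrier G)"
    "\<And>g h. g \<in> carrier G \<Longrightarrow> h \<in> carrier G \<Longrightarrow> c g = c h \<Longrightarrow> d g h < \<epsilon>"
    using precompactE[OF d \<epsilon>] by blast
  define r where "r = inv_into (carrier G) c"
  have r: "r (c t) \<in> carrier G" "c (r (c t)) = c t" if "t \<in> carrier G" for t
    using that by (auto simp: r_def inv_into_into f_inv_into_f)
  show ?thesis
  proof (rule syndeticI[of _ "(\<lambda>i. inv (r i)) ` c ` carrier G"])
    fix t assume t: "t \<in> carrier G"
    have "d (inv (r (c t)) \<otimes> t) (inv (r (c t)) \<otimes> r (c t)) = d t (r (c t))"
      using t r[OF t] by (intro inv) auto
    then have "d (inv (r (c t)) \<otimes> t) \<one> < \<epsilon>"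
      using c(2)[OF t r(1)[OF t]] r[OF t] by simp
    then show "\<exists>k\<in>(\<lambda>i. inv (r i)) ` c ` carrier G. k \<otimes> t \<in> {g \<in> carrier G. d g \<one> < \<epsilon>}"
      using t r[OF t] by auto
  qed (use c r in auto)
qed

context abelian_action
begin

definition orbit_dist :: "('x \<Rightarrow> real) \<Rightarrow> 'g \<Rightarrow> 'g \<Rightarrow> real" where
  "orbit_dist \<phi> g h = (\<integral>x. \<bar>\<phi> (S g x) - \<phi> (S h x)\<bar> \<partial>M)"

definition almost_periodic :: "('x \<Rightarrow> real) \<Rightarrow> bool" where
  "almost_periodic \<phi> \<longleftrightarrow> integrable M \<phi> \<and> precompact (carrier G) (orbit_dist \<phi>)"

lemma orbit_dist_translate:
  assumes "integrable M \<phi>" "g \<in> carrier G" "h \<in> carrier G" "k \<in> carrier G"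
  shows "orbit_dist \<phi> (k \<otimes> g) (k \<otimes> h) = orbit_dist \<phi> g h"
proof -
  have [measurable]: "\<phi> \<in> borel_measurable M" using assms(1) by simp
  have "orbit_dist \<phi> (k \<otimes> g) (k \<otimes> h) = (\<integral>x. \<bar>\<phi> (S g (S k x)) - \<phi> (S h (S k x))\<bar> \<partial>M)"
    unfolding orbit_dist_def m_comm[OF assms(4,2)] m_comm[OF assms(4,3)]
    using assms by (intro Bochner_Integration.integral_cong refl) (simp add: S_mult)
  also have "\<dots> = orbit_dist \<phi> g h"
    unfolding orbit_dist_def using assms
    by (intro integral_S[OF assms(4), of "\<lambda>x. \<bar>\<phi> (S g x) - \<phi> (S h x)\<bar>"]
        borel_measurable_abs borel_measurable_diff S_comp_measurable) auto
  finally show ?thesis .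
qed

lemma orbit_dist_triangle:
  assumes "integrable M \<phi>" "g \<in> carrier G" "h \<in> carrier G" "k \<in> carrier G"
  shows "orbit_dist \<phi> g k \<le> orbit_dist \<phi> g h + orbit_dist \<phi> h k"
  unfolding orbit_dist_def by (intro L1_triangle integrable_S assms)

lemma orbit_dist_one: "orbit_dist \<phi> g \<one> = (\<integral>x. \<bar>\<phi> (S g x) - \<phi> x\<bar> \<partial>M)"
  unfolding orbit_dist_def by (intro Bochner_Integration.integral_cong refl) (simp add: S_one)

lemma orbit_dist_approx:
  assumes "integrable M \<phi>" "integrable M \<psi>" "g \<in> carrier G" "h \<in> carrier G"
  shows "orbit_dist \<phi> g h \<le> orbit_dist \<psi> g h + 2 * (\<integral>x. \<bar>\<phi> x - \<psi> x\<bar> \<partial>M)"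
proof -
  note i = integrable_S[OF assms(3,1)] integrable_S[OF assms(4,1)]
    integrable_S[OF assms(3,2)] integrable_S[OF assms(4,2)]
  have *: "(\<integral>x. \<bar>\<phi> (S k x) - \<psi> (S k x)\<bar> \<partial>M) = (\<integral>x. \<bar>\<phi> x - \<psi> x\<bar> \<partial>M)" if "k \<in> carrier G" for k
    using assms(1,2) by (intro integral_S[OF that, of "\<lambda>x. \<bar>\<phi> x - \<psi> x\<bar>"]) auto
  have "orbit_dist \<phi> g h \<le> (\<integral>x. \<bar>\<phi> (S g x) - \<psi> (S g x)\<bar> \<partial>M) + (\<integral>x. \<bar>\<psi> (S g x) - \<phi> (S h x)\<bar> \<partial>M)"
    unfolding orbit_dist_def by (intro L1_triangle i)
  also have "(\<integral>x. \<bar>\<psi> (S g x) - \<phi> (S h x)\<bar> \<partial>M) \<le>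
      orbit_dist \<psi> g h + (\<integral>x. \<bar>\<psi> (S h x) - \<phi> (S h x)\<bar> \<partial>M)"
    unfolding orbit_dist_def by (intro L1_triangle i)
  finally show ?thesis
    using *[OF assms(3)] *[OF assms(4)] by (simp add: abs_minus_commute)
qed

lemma almost_periodic_approx:
  assumes "integrable M \<phi>"
    and "\<And>\<epsilon>. \<epsilon> > 0 \<Longrightarrow> \<exists>\<psi>. almost_periodic \<psi> \<and> (\<integral>x. \<bar>\<phi> x - \<psi> x\<bar> \<partial>M) < \<epsilon>"
  shows "almost_periodic \<phi>"
  unfolding almost_periodic_def
proof (intro conjI precompact_approx assms(1))
  fix \<epsilon> :: real assume "\<epsilon> > 0"
  then obtain \<psi> where \<psi>: "almost_periodic \<psi>" "(\<integral>x. \<bar>\<phi> x - \<psi> x\<bar> \<partial>M) < \<epsilon> / 2"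
    using assms(2)[of "\<epsilon>/2"] by auto
  have "orbit_dist \<phi> g h \<le> orbit_dist \<psi> g h + \<epsilon>" if "g \<in> carrier G" "h \<in> carrier G" for g h
    using orbit_dist_approx[OF assms(1) _ that, of \<psi>] \<psi> by (simp add: almost_periodic_def)
  then show "\<exists>d'. precompact (carrier G) d' \<and>
      (\<forall>g\<in>carrier G. \<forall>h\<in>carrier G. orbit_dist \<phi> g h \<le> d' g h + \<epsilon>)"
    using \<psi>(1) unfolding almost_periodic_def by blast
qed

lemma almost_periodic_limit:
  assumes "\<And>n. almost_periodic (\<phi> n)" "integrable M w" "\<psi> \<in> borel_measurable M"
    and "\<And>n x. x \<in> space M \<Longrightarrow> \<bar>\<phi> n x\<bar> \<le> w x"
    and "\<And>x. x \<in> space M \<Longrightarrow> (\<lambda>n. \<phi> n x) \<longlonglongrightarrow> \<psi> x"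
  shows "almost_periodic \<psi>"
proof -
  have i: "integrable M (\<phi> n)" for n using assms(1) by (simp add: almost_periodic_def)
  have \<psi>w: "\<bar>\<psi> x\<bar> \<le> w x" if "x \<in> space M" for x
    by (rule LIMSEQ_le_const2[OF tendsto_rabs[OF assms(5)[OF that]]]) (use assms(4) that in auto)
  have i\<psi>: "integrable M \<psi>"
    by (rule Bochner_Integration.integrable_bound[OF assms(2,3)])
      (use \<psi>w in \<open>auto intro!: AE_I2 order.trans[OF _ abs_ge_self]\<close>)
  have "(\<lambda>n. \<integral>x. \<bar>\<psi> x - \<phi> n x\<bar> \<partial>M) \<longlonglongrightarrow> (\<integral>x. 0 \<partial>M)"
  proof (rule integral_dominated_convergence[where w = "\<lambda>x. 2 * w x"])
    show "AE x in M. (\<lambda>n. \<bar>\<psi> x - \<phi> n x\<bar>) \<longlonglongrightarrow> 0"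
    proof (rule AE_I2)
      fix x assume "x \<in> space M"
      from assms(5)[OF this] have "(\<lambda>n. \<bar>\<psi> x - \<phi> n x\<bar>) \<longlonglongrightarrow> \<bar>\<psi> x - \<psi> x\<bar>"
        by (intro tendsto_intros)
      then show "(\<lambda>n. \<bar>\<psi> x - \<phi> n x\<bar>) \<longlonglongrightarrow> 0" by simp
    qed
    show "AE x in M. norm \<bar>\<psi> x - \<phi> n x\<bar> \<le> 2 * w x" for n
    proof (rule AE_I2)
      fix x assume "x \<in> space M"
      then show "norm \<bar>\<psi> x - \<phi> n x\<bar> \<le> 2 * w x"
        using \<psi>w[of x] assms(4)[of x n] by simp
    qed
  qed (use i i\<psi> assms(2) in auto)
  then have lim: "(\<lambda>n. \<integral>x. \<bar>\<psi> x - \<phi> n x\<bar> \<partial>M) \<longlonglongrightarrow> 0" by simp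
  show ?thesis
  proof (rule almost_periodic_approx[OF i\<psi>])
    fix \<epsilon> :: real assume "\<epsilon> > 0"
    from order_tendstoD(2)[OF lim this] obtain n where "(\<integral>x. \<bar>\<psi> x - \<phi> n x\<bar> \<partial>M) < \<epsilon>"
      using eventually_happens by force
    then show "\<exists>\<phi>. almost_periodic \<phi> \<and> (\<integral>x. \<bar>\<psi> x - \<phi> x\<bar> \<partial>M) < \<epsilon>"
      using assms(1) by blast
  qed
qed

text \<open>Two source functions are allowed so that sums of functions and unions of sets are covered.\<close>

lemma almost_periodic_lipschitz:
  assumes "almost_periodic \<phi>" "almost_periodic \<psi>" "integrable M \<theta>" "L \<ge> 0"
    and "\<And>x y. x \<in> space M \<Longrightarrow> y \<in> space M \<Longrightarrow> \<bar>\<theta> x - \<theta> y\<bar> \<le> L * (\<bar>\<phi> x - \<phi> y\<bar> + \<bar>\<psi> x - \<psi> y\<bar>)"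
  shows "almost_periodic \<theta>"
proof -
  have i: "integrable M \<phi>" "integrable M \<psi>" and
    pc: "precompact (carrier G) (orbit_dist \<phi>)" "precompact (carrier G) (orbit_dist \<psi>)"
    using assms(1,2) by (auto simp: almost_periodic_def)
  have "orbit_dist \<theta> g h \<le> L * (orbit_dist \<phi> g h + orbit_dist \<psi> g h)"
    if gh: "g \<in> carrier G" "h \<in> carrier G" for g h
  proof -
    note iS = integrable_S[OF gh(1)] integrable_S[OF gh(2)]
    have "orbit_dist \<theta> g h \<le>
        (\<integral>x. L * (\<bar>\<phi> (S g x) - \<phi> (S h x)\<bar> + \<bar>\<psi> (S g x) - \<psi> (S h x)\<bar>) \<partial>M)"
      unfolding orbit_dist_def using assms(5) S_space gh
      by (intro integral_mono integrable_mult_right Bochner_Integration.integrable_add integrable_abs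
          Bochner_Integration.integrable_diff iS i assms(3)) auto
    also have "\<dots> = L * (orbit_dist \<phi> g h + orbit_dist \<psi> g h)"
      unfolding orbit_dist_def using iS[OF i(1)] iS[OF i(2)] by simp
    finally show ?thesis .
  qed
  then have "precompact (carrier G) (orbit_dist \<theta>)"
    by (rule precompact_mono[OF precompact_cmult[OF precompact_add[OF pc] assms(4)]])
  then show ?thesis using assms(3) by (simp add: almost_periodic_def)
qed

lemma almost_periodic_const: "almost_periodic (\<lambda>_. c)"
  by (simp add: almost_periodic_def orbit_dist_def[abs_def] precompact_zero)

lemma almost_periodic_cmult:
  assumes "almost_periodic \<phi>"
  shows "almost_periodic (\<lambda>x. c * \<phi> x)"
  using assms by (intro almost_periodic_lipschitz[OF assms almost_periodic_const[of 0], of _ "\<bar>c\<bar>"])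
    (auto simp: almost_periodic_def abs_mult[symmetric] right_diff_distrib)

lemma almost_periodic_add:
  assumes "almost_periodic \<phi>" "almost_periodic \<psi>"
  shows "almost_periodic (\<lambda>x. \<phi> x + \<psi> x)"
  using assms by (intro almost_periodic_lipschitz[OF assms, of _ 1]) (auto simp: almost_periodic_def)

lemma almost_periodic_S:
  assumes "almost_periodic \<phi>" "k \<in> carrier G"
  shows "almost_periodic (\<lambda>x. \<phi> (S k x))"
proof -
  have i: "integrable M \<phi>" using assms(1) by (simp add: almost_periodic_def)
  have "orbit_dist (\<lambda>x. \<phi> (S k x)) g h = orbit_dist \<phi> g h" if "g \<in> carrier G" "h \<in> carrier G" for g h
  proof -
    have "orbit_dist (\<lambda>x. \<phi> (S k x)) g h = orbit_dist \<phi> (k \<otimes> g) (k \<otimes> h)"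
      unfolding orbit_dist_def using assms(2) that
      by (intro Bochner_Integration.integral_cong refl) (simp add: S_mult)
    then show ?thesis using orbit_dist_translate[OF i that assms(2)] by simp
  qed
  then have "precompact (carrier G) (orbit_dist (\<lambda>x. \<phi> (S k x)))"
    using assms(1) by (auto simp: almost_periodic_def intro: precompact_mono)
  then show ?thesis using integrable_S[OF assms(2) i] by (simp add: almost_periodic_def)
qed

text \<open>An analogue of the Kronecker factor for the action of \<open>G\<close>. Conditional
  expectation onto it is the projection onto almost periodic functions.\<close>

definition ap_sets :: "'x set set" where
  "ap_sets = {B \<in> sets M. almost_periodic (indicator B)}"

definition ap_algebra :: "'x measure" where
  "ap_algebra = sigma (space M) ap_sets"

lemma sigma_algebra_ap_sets: "sigma_algebra (space M) ap_sets"
  unfolding sigma_algebra_iff2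
proof (intro conjI allI impI ballI)
  show "ap_sets \<subseteq> Pow (space M)" using sets.sets_into_space by (auto simp: ap_sets_def)
  have [simp]: "indicat_real {} = (\<lambda>_::'x. 0)" by auto
  show "{} \<in> ap_sets" using almost_periodic_const[of 0] by (simp add: ap_sets_def)
  show "space M - B \<in> ap_sets" if "B \<in> ap_sets" for B
  proof -
    have B: "B \<in> sets M" "almost_periodic (indicator B)" using that by (auto simp: ap_sets_def)
    have "almost_periodic (indicator (space M - B))"
      using B by (intro almost_periodic_lipschitz[OF B(2) almost_periodic_const[of 0], of _ 1]
          unit_ball_integrable unit_ball_indicator) (auto simp: indicator_def)
    then show ?thesis using B by (simp add: ap_sets_def)
  qed
  have Un: "B \<union> C \<in> ap_sets" if "B \<in> ap_sets" "C \<in> ap_sets" for B C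
  proof -
    have B: "B \<in> sets M" "almost_periodic (indicator B)" using that by (auto simp: ap_sets_def)
    have C: "C \<in> sets M" "almost_periodic (indicator C)" using that by (auto simp: ap_sets_def)
    have "almost_periodic (indicator (B \<union> C))"
      using B C by (intro almost_periodic_lipschitz[OF B(2) C(2), of _ 1]
          unit_ball_integrable unit_ball_indicator) (auto simp: indicator_def)
    then show ?thesis using B C by (simp add: ap_sets_def)
  qed
  fix A :: "nat \<Rightarrow> 'x set" assume A: "range A \<subseteq> ap_sets"
  have fin: "(\<Union>i<n. A i) \<in> ap_sets" for n
  proof (induction n)
    case 0
    show ?case using almost_periodic_const[of 0] by (simp add: ap_sets_def)
  next
    case (Suc n)
    then show ?case using Un[of "A n" "\<Union>i<n. A i"] A by (auto simp: lessThan_Suc)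
  qed
  have "almost_periodic (indicator (\<Union>i. A i))"
  proof (rule almost_periodic_limit[where \<phi> = "\<lambda>n. indicator (\<Union>i<n. A i)" and w = "\<lambda>_. 1"])
    show "almost_periodic (indicator (\<Union>i<n. A i))" for n using fin by (simp add: ap_sets_def)
    show "indicat_real (\<Union>i. A i) \<in> borel_measurable M"
      using A by (intro borel_measurable_indicator sets.countable_UN) (auto simp: ap_sets_def)
    show "(\<lambda>n. indicat_real (\<Union>i<n. A i) x) \<longlonglongrightarrow> indicat_real (\<Union>i. A i) x" for x
      by (rule LIMSEQ_indicator_UN)
  qed (auto simp: indicator_def)
  then show "(\<Union>i. A i) \<in> ap_sets"
    using A by (auto simp: ap_sets_def)
qed

lemma sets_ap_algebra: "sets ap_algebra = ap_sets"
  using sigma_algebra.sets_measure_of_eq[OF sigma_algebra_ap_sets] by (simp add: ap_algebra_def)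

lemma space_ap_algebra: "space ap_algebra = space M"
  using sets.sets_into_space by (auto simp: ap_algebra_def space_measure_of_conv)

lemma subalgebra_ap: "subalgebra M ap_algebra"
  by (auto simp: subalgebra_def space_ap_algebra sets_ap_algebra ap_sets_def)

text \<open>The indicator of a superlevel set is a limit of Lipschitz functions of \<open>\<phi>\<close>, namely of ramps of
  increasing slope.\<close>

lemma almost_periodic_measurable:
  assumes \<phi>: "almost_periodic \<phi>"
  shows "\<phi> \<in> borel_measurable ap_algebra"
proof (subst borel_measurable_iff_greater, intro allI)
  fix t :: real
  have [measurable]: "\<phi> \<in> borel_measurable M" using \<phi> by (auto simp: almost_periodic_def)
  define B where "B = {x \<in> space M. t < \<phi> x}"
  have B: "B \<in> sets M" unfolding B_def by measurable
  define \<psi> where "\<psi> n x = min 1 (max 0 (real n * (\<phi> x - t)))" for n x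
  have i: "integrable M (\<psi> n)" for n
    unfolding \<psi>_def by (rule integrable_const_bound[where B = 1]) auto
  have "almost_periodic (indicator B)"
  proof (rule almost_periodic_limit[where \<phi> = \<psi> and w = "\<lambda>_. 1"])
    show "almost_periodic (\<psi> n)" for n
    proof (rule almost_periodic_lipschitz[OF \<phi> almost_periodic_const[of 0] i, of "real n"])
      fix x y
      have "\<bar>\<psi> n x - \<psi> n y\<bar> \<le> \<bar>real n * (\<phi> x - t) - real n * (\<phi> y - t)\<bar>"
        unfolding \<psi>_def by (simp add: min_def max_def abs_if)
      also have "\<dots> = real n * \<bar>\<phi> x - \<phi> y\<bar>"
        by (simp add: right_diff_distrib[symmetric] abs_mult)
      finally show "\<bar>\<psi> n x - \<psi> n y\<bar> \<le> real n * (\<bar>\<phi> x - \<phi> y\<bar> + \<bar>(0::real) - 0\<bar>)" by simp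
    qed simp
    show "(\<lambda>n. \<psi> n x) \<longlonglongrightarrow> indicator B x" if x: "x \<in> space M" for x
    proof (cases "t < \<phi> x")
      case True
      obtain N :: nat where N: "1 < real N * (\<phi> x - t)"
        using ex_less_of_nat_mult[of "\<phi> x - t" 1] True by auto
      have "\<psi> n x = 1" if "n \<ge> N" for n
      proof -
        have "real N * (\<phi> x - t) \<le> real n * (\<phi> x - t)"
          using that True by (intro mult_right_mono) auto
        then show ?thesis using N by (simp add: \<psi>_def)
      qed
      then have "eventually (\<lambda>n. \<psi> n x = 1) sequentially"
        using eventually_sequentially by blast
      then show ?thesis using True x by (simp add: B_def tendsto_eventually)
    next
      case False
      have "\<psi> n x = 0" for n
      proof -
        have "real n * (\<phi> x - t) \<le> 0" using False by (intro mult_nonneg_nonpos) auto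
        then show ?thesis by (simp add: \<psi>_def max_absorb1)
      qed
      then show ?thesis using False by (simp add: B_def)
    qed
  qed (use B in \<open>auto simp: \<psi>_def\<close>)
  then show "{w \<in> space ap_algebra. t < \<phi> w} \<in> sets ap_algebra"
    using B by (simp add: sets_ap_algebra ap_sets_def space_ap_algebra B_def)
qed

lemma measurable_almost_periodic:
  assumes "\<phi> \<in> borel_measurable ap_algebra" "\<And>x. 0 \<le> \<phi> x" "integrable M \<phi>"
  shows "almost_periodic \<phi>"
  using assms
proof (induction \<phi> rule: borel_measurable_induct_real)
  case (set A)
  then show ?case by (simp add: sets_ap_algebra ap_sets_def)
next
  case (mult u c)
  show ?case
  proof (cases "c = 0")
    case True
    then show ?thesis using almost_periodic_const[of 0] by simp
  next
    case False
    then have "integrable M u" using mult.prems by simp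
    then show ?thesis using mult.IH by (intro almost_periodic_cmult)
  qed
next
  case (add u v)
  have m: "u \<in> borel_measurable M" "v \<in> borel_measurable M"
    using add.hyps by (auto intro: measurable_from_subalg[OF subalgebra_ap])
  have "integrable M u" "integrable M v"
    using m add.hyps by (auto intro!: Bochner_Integration.integrable_bound[OF add.prems] AE_I2)
  then show ?case using add.IH by (intro almost_periodic_add)
next
  case (seq U)
  have m: "U n \<in> borel_measurable M" for n
    using seq.hyps(1) by (rule measurable_from_subalg[OF subalgebra_ap])
  have lim: "(\<lambda>n. U n x) \<longlonglongrightarrow> \<phi> x" if "x \<in> space M" for x
    using seq.hyps(4) that by (simp add: space_ap_algebra)
  have le: "U n x \<le> \<phi> x" if "x \<in> space M" for n x
    using incseq_le[OF _ lim[OF that]] seq.hyps(3) by (simp add: incseq_def le_fun_def)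
  have "integrable M (U n)" for n
    using le seq.hyps(2) by (intro Bochner_Integration.integrable_bound[OF seq.prems m] AE_I2)
      (auto intro: order.trans[OF _ abs_ge_self])
  then have "almost_periodic (U n)" for n using seq.IH by blast
  then show ?case
  proof (rule almost_periodic_limit[OF _ seq.prems])
    show "\<bar>U n x\<bar> \<le> \<phi> x" if "x \<in> space M" for n x
      using le[OF that, of n] seq.hyps(2)[of n x] by linarith
  qed (use lim seq.prems in auto)
qed

end

section \<open>Projection onto the almost periodic functions\<close>

lemma am_gm_three:
  fixes x y m :: real
  assumes "x > 0" "y > 0" "m > 0"
  shows "3 \<le> x * y / m\<^sup>2 + m / x + m / y"
proof -
  define a b where "a = x / m" and "b = y / m"
  have ab: "a > 0" "b > 0" using assms by (auto simp: a_def b_def)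
  define s where "s = sqrt (a * b)"
  have s: "s > 0" "s\<^sup>2 = a * b" using ab by (auto simp: s_def)
  have "s \<le> (a + b) / 2" unfolding s_def using ab by (intro arith_geo_mean_sqrt) auto
  moreover have "0 \<le> s * ((s - 1)\<^sup>2 * (s + 2))" using s by simp
  moreover have "s * ((s - 1)\<^sup>2 * (s + 2)) = (s\<^sup>2)\<^sup>2 + 2 * s - 3 * s\<^sup>2"
    by (simp add: power2_eq_square algebra_simps)
  ultimately have "3 * (a * b) \<le> (a * b)\<^sup>2 + a + b"
    using s by simp
  then have "3 \<le> ((a * b)\<^sup>2 + a + b) / (a * b)"
    using ab by (simp add: pos_le_divide_eq)
  also have "\<dots> = a * b + 1 / a + 1 / b"
    using ab by (simp add: field_simps power2_eq_square)
  also have "\<dots> = x * y / m\<^sup>2 + m / x + m / y"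
    using assms by (simp add: a_def b_def power2_eq_square)
  finally show ?thesis .
qed

text \<open>The hypotheses on \<open>p\<close> and \<open>q\<close> hold for conditional expectations of \<open>f\<close>, because
  \<open>\<integral>f / p = \<integral>p / p\<close> for these; \<open>\<eta>\<close> only keeps the denominators positive. The bound is the integral of
  \<open>f * 3 \<le> f * (p * q / m\<^sup>2 + m / p + m / q)\<close>, where \<open>m\<close> is the integral of \<open>f\<close>.\<close>

lemma (in prob_space) cube_le_integral_product:
  fixes f p q :: "'a \<Rightarrow> real"
  assumes [measurable]: "f \<in> borel_measurable M" "p \<in> borel_measurable M" "q \<in> borel_measurable M"
    and f: "\<And>x. x \<in> space M \<Longrightarrow> 0 \<le> f x \<and> f x \<le> 1"
    and p: "\<And>x. x \<in> space M \<Longrightarrow> 0 \<le> p x \<and> p x \<le> 1"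
    and q: "\<And>x. x \<in> space M \<Longrightarrow> 0 \<le> q x \<and> q x \<le> 1"
    and fp: "\<And>\<eta>. 0 < \<eta> \<Longrightarrow> (\<integral>x. f x / (p x + \<eta>) \<partial>M) \<le> 1"
    and fq: "\<And>\<eta>. 0 < \<eta> \<Longrightarrow> (\<integral>x. f x / (q x + \<eta>) \<partial>M) \<le> 1"
  shows "(\<integral>x. f x \<partial>M) ^ 3 \<le> (\<integral>x. f x * (p x * q x) \<partial>M)"
proof -
  define m where "m = (\<integral>x. f x \<partial>M)"
  have ub: "f \<in> unit_ball M" "p \<in> unit_ball M" "q \<in> unit_ball M"
    using f p q by (auto intro!: unit_ballI)
  have i: "integrable M f" "integrable M (\<lambda>x. f x * (p x * q x))"
    using ub by (auto intro!: unit_ball_integrable unit_ball_mult)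
  have pos: "0 \<le> (\<integral>x. f x * (p x * q x) \<partial>M)"
    using f p q by (intro Bochner_Integration.integral_nonneg) auto
  have "m \<ge> 0" unfolding m_def using f by (intro Bochner_Integration.integral_nonneg) auto
  show ?thesis
  proof (cases "m = 0")
    case True
    then show ?thesis using pos by (simp add: m_def)
  next
    case False
    with \<open>m \<ge> 0\<close> have m: "m > 0" by simp
    have "m ^ 3 \<le> (\<integral>x. f x * (p x * q x) \<partial>M) + 3 * \<eta>" if \<eta>: "0 < \<eta>" "\<eta> \<le> 1" for \<eta>
    proof -
      have bd: "norm (f x / (p x + \<eta>)) \<le> 1/\<eta>" "norm (f x / (q x + \<eta>)) \<le> 1/\<eta>"
        if "x \<in> space M" for x
        using f[OF that] p[OF that] q[OF that] \<eta> by (auto simp: abs_divide intro!: frac_le)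
      have ii: "integrable M (\<lambda>x. f x / (p x + \<eta>))" "integrable M (\<lambda>x. f x / (q x + \<eta>))"
        by (rule integrable_const_bound[where B = "1/\<eta>", OF AE_I2[OF bd(1)]], assumption, measurable)
          (rule integrable_const_bound[where B = "1/\<eta>", OF AE_I2[OF bd(2)]], assumption, measurable)
      have "(\<integral>x. 3 * f x \<partial>M) \<le> (\<integral>x. (f x * (p x * q x) + 3 * \<eta>) / m\<^sup>2 +
          m * (f x / (p x + \<eta>)) + m * (f x / (q x + \<eta>)) \<partial>M)"
      proof (rule integral_mono)
        fix x assume x: "x \<in> space M"
        note b = f[OF x] p[OF x] q[OF x]
        have "f x * 3 \<le> f x * ((p x + \<eta>) * (q x + \<eta>) / m\<^sup>2 + m / (p x + \<eta>) + m / (q x + \<eta>))"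
          using b \<eta> m by (intro mult_left_mono am_gm_three) auto
        also have "\<dots> = f x * ((p x + \<eta>) * (q x + \<eta>)) / m\<^sup>2 +
            m * (f x / (p x + \<eta>)) + m * (f x / (q x + \<eta>))"
          by (simp add: distrib_left mult.commute)
        also have "f x * ((p x + \<eta>) * (q x + \<eta>)) \<le> f x * (p x * q x) + 3 * \<eta>"
        proof -
          have "f x * (p x + q x + \<eta>) \<le> 1 * 3" using b \<eta> by (intro mult_mono) auto
          then have "\<eta> * (f x * (p x + q x + \<eta>)) \<le> \<eta> * 3" using \<eta> by (intro mult_left_mono) auto
          moreover have "f x * ((p x + \<eta>) * (q x + \<eta>)) =
              f x * (p x * q x) + \<eta> * (f x * (p x + q x + \<eta>))"
            by (simp add: algebra_simps)
          ultimately show ?thesis by simp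
        qed
        finally show "3 * f x \<le> (f x * (p x * q x) + 3 * \<eta>) / m\<^sup>2 +
            m * (f x / (p x + \<eta>)) + m * (f x / (q x + \<eta>))"
          by (simp add: divide_right_mono mult.commute)
      qed (intro Bochner_Integration.integrable_add integrable_divide integrable_mult_right i ii
          integrable_const)+
      also have "\<dots> = ((\<integral>x. f x * (p x * q x) \<partial>M) + 3 * \<eta>) / m\<^sup>2 +
          m * (\<integral>x. f x / (p x + \<eta>) \<partial>M) + m * (\<integral>x. f x / (q x + \<eta>) \<partial>M)"
        using i ii by (simp add: prob_space del: times_divide_eq_right)
      also have "\<dots> \<le> ((\<integral>x. f x * (p x * q x) \<partial>M) + 3 * \<eta>) / m\<^sup>2 + m * 1 + m * 1"
        using fp[OF \<eta>(1)] fq[OF \<eta>(1)] m by (intro add_mono mult_left_mono) auto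
      finally have "m \<le> ((\<integral>x. f x * (p x * q x) \<partial>M) + 3 * \<eta>) / m\<^sup>2"
        by (simp add: m_def)
      then show ?thesis
        using m by (simp add: pos_le_divide_eq power2_eq_square power3_eq_cube mult.assoc)
    qed
    note * = this
    have "m ^ 3 \<le> (\<integral>x. f x * (p x * q x) \<partial>M) + e" if "e > 0" for e
    proof -
      have "3 * min 1 (e / 3) \<le> e" by simp
      moreover have "m ^ 3 \<le> (\<integral>x. f x * (p x * q x) \<partial>M) + 3 * min 1 (e / 3)"
        using that by (intro *) auto
      ultimately show ?thesis by linarith
    qed
    then show ?thesis unfolding m_def by (rule field_le_epsilon)
  qed
qed

context abelian_action
begin

text \<open>The conditional expectation onto the almost periodic sets; it is clipped to the unit interval,
  which changes it on a null set only.\<close>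

lemma almost_periodic_projection:
  fixes f :: "'x \<Rightarrow> real"
  assumes [measurable]: "f \<in> borel_measurable M"
    and f: "\<And>x. x \<in> space M \<Longrightarrow> 0 \<le> f x \<and> f x \<le> 1"
  obtains p where "almost_periodic p" "\<And>x. 0 \<le> p x \<and> p x \<le> 1"
    "\<And>\<psi>. \<lbrakk>almost_periodic \<psi>; \<psi> \<in> unit_ball M\<rbrakk> \<Longrightarrow> (\<integral>x. f x * \<psi> x \<partial>M) = (\<integral>x. p x * \<psi> x \<partial>M)"
proof -
  interpret finite_measure_subalgebra M ap_algebra
    by unfold_locales (rule subalgebra_ap)
  define E where "E = real_cond_exp M ap_algebra f"
  have [measurable]: "E \<in> borel_measurable ap_algebra" unfolding E_def by simp
  then have EM: "E \<in> borel_measurable M" by (rule measurable_from_subalg[OF subalgebra_ap])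
  define p where "p x = max 0 (min 1 (E x))" for x
  have ub: "f \<in> unit_ball M" using f by (auto intro!: unit_ballI)
  have i: "integrable M f" using ub by (rule unit_ball_integrable)
  have p01: "0 \<le> p x \<and> p x \<le> 1" for x by (simp add: p_def)
  have pm: "p \<in> borel_measurable ap_algebra" unfolding p_def by measurable
  then have pM: "p \<in> borel_measurable M" by (rule measurable_from_subalg[OF subalgebra_ap])
  have ip: "integrable M p"
    using pM p01 by (intro unit_ball_integrable unit_ballI) auto
  have "AE x in M. E x \<ge> 0"
    unfolding E_def using f by (intro real_cond_exp_pos) auto
  moreover have "AE x in M. E x \<le> real_cond_exp M ap_algebra (\<lambda>_. 1) x"
    unfolding E_def using f i by (intro real_cond_exp_mono) auto
  moreover have "AE x in M. real_cond_exp M ap_algebra (\<lambda>_. 1) x = 1"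
    by (intro real_cond_exp_F_meas) auto
  ultimately have Ep: "AE x in M. p x = E x"
    by eventually_elim (auto simp: p_def)
  show thesis
  proof (rule that)
    show "almost_periodic p" by (rule measurable_almost_periodic[OF pm _ ip]) (use p01 in auto)
    show "0 \<le> p x \<and> p x \<le> 1" for x by (rule p01)
    fix \<psi> assume \<psi>: "almost_periodic \<psi>" "\<psi> \<in> unit_ball M"
    have m: "\<psi> \<in> borel_measurable ap_algebra" by (rule almost_periodic_measurable[OF \<psi>(1)])
    have [measurable]: "\<psi> \<in> borel_measurable M" using \<psi>(2) by (rule unit_ball_measurable)
    have "(\<integral>x. f x * \<psi> x \<partial>M) = (\<integral>x. \<psi> x * f x \<partial>M)" by (simp add: mult.commute)
    also have "\<dots> = (\<integral>x. \<psi> x * E x \<partial>M)"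
      unfolding E_def using ub \<psi>(2) m
      by (intro real_cond_exp_intg(2)[symmetric] unit_ball_integrable unit_ball_mult) auto
    also have "\<dots> = (\<integral>x. p x * \<psi> x \<partial>M)"
      by (rule integral_cong_AE) (use Ep EM pM in \<open>auto simp: mult.commute\<close>)
    finally show "(\<integral>x. f x * \<psi> x \<partial>M) = (\<integral>x. p x * \<psi> x \<partial>M)" .
  qed
qed

text \<open>The function \<open>\<eta> / (p + \<eta>)\<close> is a Lipschitz function of \<open>p\<close>, so it is almost periodic and does not
  distinguish \<open>f\<close> from \<open>p\<close>; and \<open>p / (p + \<eta>) \<le> 1\<close>.\<close>

lemma projection_quotient_le_1:
  assumes p: "almost_periodic p" "\<And>x. 0 \<le> p x \<and> p x \<le> 1"
    and proj: "\<And>\<psi>. \<lbrakk>almost_periodic \<psi>; \<psi> \<in> unit_ball M\<rbrakk> \<Longrightarrow> (\<integral>x. f x * \<psi> x \<partial>M) = (\<integral>x. p x * \<psi> x \<partial>M)"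
    and \<eta>: "0 < (\<eta>::real)"
  shows "(\<integral>x. f x / (p x + \<eta>) \<partial>M) \<le> 1"
proof -
  have [measurable]: "p \<in> borel_measurable M" using p(1) by (auto simp: almost_periodic_def)
  define \<psi> where "\<psi> x = \<eta> / (p x + \<eta>)" for x
  have p0: "0 < p x + \<eta>" for x using p(2)[of x] \<eta> by linarith
  have \<psi>01: "0 \<le> \<psi> x \<and> \<psi> x \<le> 1" for x
    unfolding \<psi>_def using p0[of x] p(2)[of x] \<eta> by simp
  have "\<psi> \<in> borel_measurable M" unfolding \<psi>_def by measurable
  then have ub: "\<psi> \<in> unit_ball M" using \<psi>01 by (auto intro!: unit_ballI)
  have ap: "almost_periodic \<psi>"
  proof (rule almost_periodic_lipschitz[OF p(1) almost_periodic_const[of 0] unit_ball_integrable[OF ub], of "1/\<eta>"])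
    fix x y
    have "\<psi> x - \<psi> y = \<eta> * (p y - p x) / ((p x + \<eta>) * (p y + \<eta>))"
      unfolding \<psi>_def using p0[of x] p0[of y] by (simp add: field_simps)
    also have "\<dots> = (\<eta> / (p x + \<eta>)) * ((p y - p x) / (p y + \<eta>))" by simp
    finally have "\<bar>\<psi> x - \<psi> y\<bar> = (\<eta> / (p x + \<eta>)) * (\<bar>p y - p x\<bar> / (p y + \<eta>))"
      using p0[of x] p0[of y] \<eta> by (simp add: abs_mult)
    also have "\<dots> \<le> 1 * (\<bar>p y - p x\<bar> / \<eta>)"
      using p0[of x] p0[of y] \<eta> p(2)[of x] p(2)[of y]
      by (intro mult_mono divide_left_mono) auto
    finally show "\<bar>\<psi> x - \<psi> y\<bar> \<le> 1 / \<eta> * (\<bar>p x - p y\<bar> + \<bar>(0::real) - 0\<bar>)"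
      by (simp add: abs_minus_commute)
  qed (use \<eta> in auto)
  have "\<eta> * (\<integral>x. f x / (p x + \<eta>) \<partial>M) = (\<integral>x. f x * \<psi> x \<partial>M)"
    unfolding \<psi>_def by (subst integral_mult_right_zero[symmetric]) (simp add: mult.commute)
  also have "\<dots> = (\<integral>x. p x * \<psi> x \<partial>M)" by (rule proj[OF ap ub])
  also have "\<dots> \<le> (\<integral>x. \<eta> \<partial>M)"
  proof (rule integral_mono)
    have "p \<in> unit_ball M" using p(2) by (auto intro!: unit_ballI)
    then show "integrable M (\<lambda>x. p x * \<psi> x)"
      using ub by (intro unit_ball_integrable unit_ball_mult)
    show "p x * \<psi> x \<le> \<eta>" for x
      unfolding \<psi>_def using p0[of x] p(2)[of x] \<eta> by (simp add: divide_le_eq)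
  qed auto
  finally show ?thesis using \<eta> by (simp add: prob_space)
qed

end

section \<open>Weak mixing of functions orthogonal to the almost periodic ones\<close>

definition kernel_op :: "'x measure \<Rightarrow> ('x \<times> 'x \<Rightarrow> real) \<Rightarrow> ('x \<Rightarrow> real) \<Rightarrow> 'x \<Rightarrow> real" where
  "kernel_op M K v x = (\<integral>y. K (x, y) * v y \<partial>M)"

context prob_space
begin

lemma unit_ball_section:
  assumes "K \<in> unit_ball (M \<Otimes>\<^sub>M M)" "x \<in> space M"
  shows "(\<lambda>y. K (x, y)) \<in> unit_ball M"
  using assms by (auto simp: unit_ball_def space_pair_measure intro: measurable_compose[OF measurable_Pair1'])

lemma kernel_op_unit_ball:
  assumes K: "K \<in> unit_ball (M \<Otimes>\<^sub>M M)" and v: "v \<in> unit_ball M"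
  shows "kernel_op M K v \<in> unit_ball M"
proof (rule unit_ballI)
  have [measurable]: "K \<in> borel_measurable (M \<Otimes>\<^sub>M M)" "v \<in> borel_measurable M"
    using K v by (auto simp: unit_ball_def)
  show "kernel_op M K v \<in> borel_measurable M"
    unfolding kernel_op_def[abs_def] by measurable
  show "\<bar>kernel_op M K v x\<bar> \<le> 1" if "x \<in> space M" for x
    unfolding kernel_op_def by (intro abs_integral_unit_ball_le unit_ball_mult unit_ball_section K v that)
qed

lemma kernel_op_L1_le:
  assumes K: "K \<in> unit_ball (M \<Otimes>\<^sub>M M)" and K': "K' \<in> unit_ball (M \<Otimes>\<^sub>M M)" and v: "v \<in> unit_ball M"
  shows "(\<integral>x. \<bar>kernel_op M K v x - kernel_op M K' v x\<bar> \<partial>M) \<le> (\<integral>z. \<bar>K z - K' z\<bar> \<partial>(M \<Otimes>\<^sub>M M))"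
proof -
  interpret P: pair_prob_space M M ..
  have i: "integrable (M \<Otimes>\<^sub>M M) (\<lambda>z. \<bar>K z - K' z\<bar>)"
    using K K' by (intro integrable_abs Bochner_Integration.integrable_diff P.unit_ball_integrable)
  have "(\<integral>x. \<bar>kernel_op M K v x - kernel_op M K' v x\<bar> \<partial>M) \<le> (\<integral>x. (\<integral>y. \<bar>K (x, y) - K' (x, y)\<bar> \<partial>M) \<partial>M)"
  proof (rule integral_mono)
    show "integrable M (\<lambda>x. \<bar>kernel_op M K v x - kernel_op M K' v x\<bar>)"
      using K K' v
      by (intro integrable_abs Bochner_Integration.integrable_diff unit_ball_integrable kernel_op_unit_ball)
    show "integrable M (\<lambda>x. \<integral>y. \<bar>K (x, y) - K' (x, y)\<bar> \<partial>M)"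
      using P.integrable_fst'[OF i] by simp
    fix x assume x: "x \<in> space M"
    note s = unit_ball_section[OF K x] unit_ball_section[OF K' x]
    have "kernel_op M K v x - kernel_op M K' v x = (\<integral>y. v y * (K (x, y) - K' (x, y)) \<partial>M)"
      unfolding kernel_op_def
      using s v by (subst Bochner_Integration.integral_diff[symmetric])
        (auto intro!: unit_ball_integrable unit_ball_mult simp: algebra_simps)
    then show "\<bar>kernel_op M K v x - kernel_op M K' v x\<bar> \<le> (\<integral>y. \<bar>K (x, y) - K' (x, y)\<bar> \<partial>M)"
      using abs_integral_mult_le(2)[OF v Bochner_Integration.integrable_diff[OF
          unit_ball_integrable[OF s(1)] unit_ball_integrable[OF s(2)]]] by simp
  qed
  also have "\<dots> = (\<integral>z. \<bar>K z - K' z\<bar> \<partial>(M \<Otimes>\<^sub>M M))"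
    using P.integral_fst'[OF i] by simp
  finally show ?thesis .
qed

end

context abelian_action
begin

lemma product_action:
  "abelian_action G (M \<Otimes>\<^sub>M M) (\<lambda>g z. (S g (fst z), S g (snd z)))"
proof -
  interpret P: pair_prob_space M M ..
  show ?thesis
  proof unfold_locales
    fix g assume g: "g \<in> carrier G"
    note [measurable] = S_measurable[OF g]
    have "distr (M \<Otimes>\<^sub>M M) (M \<Otimes>\<^sub>M M) (\<lambda>z. (S g (fst z), S g (snd z))) =
        distr (M \<Otimes>\<^sub>M M) (M \<Otimes>\<^sub>M M) (\<lambda>(x, y). (S g x, S g y))"
      by (simp add: case_prod_unfold)
    also have "\<dots> = distr M M (S g) \<Otimes>\<^sub>M distr M M (S g)"
      by (rule pair_measure_distr[symmetric])
        (use S_measurable[OF g] distr_S[OF g] sigma_finite_measure_axioms in auto)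
    finally show "measure_preserving (M \<Otimes>\<^sub>M M) (\<lambda>z. (S g (fst z), S g (snd z)))"
      using distr_S[OF g] by (simp add: measure_preserving_def)
  qed (auto simp: space_pair_measure S_mult S_one)
qed

text \<open>The integral kernel of the averages of the rank one operators \<open>v \<mapsto> \<langle>f \<circ> S g, v\<rangle> (f \<circ> S g)\<close>.\<close>

definition corr_kernel :: "('x \<Rightarrow> real) \<Rightarrow> 'g list \<Rightarrow> 'x \<times> 'x \<Rightarrow> real" where
  "corr_kernel f gs z = avg gs (\<lambda>g. f (S g (fst z)) * f (S g (snd z)))"

lemma corr_kernel_unit_ball:
  assumes "f \<in> unit_ball M" "averaging gs"
  shows "corr_kernel f gs \<in> unit_ball (M \<Otimes>\<^sub>M M)"
proof -
  have "(\<lambda>z. f (S g (fst z)) * f (S g (snd z))) \<in> unit_ball (M \<Otimes>\<^sub>M M)" if "g \<in> set gs" for g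
  proof (rule unit_ball_mult)
    have u: "(\<lambda>x. f (S g x)) \<in> unit_ball M"
      by (rule unit_ball_S[OF averaging_in[OF assms(2) that] assms(1)])
    show "(\<lambda>z. f (S g (fst z))) \<in> unit_ball (M \<Otimes>\<^sub>M M)" "(\<lambda>z. f (S g (snd z))) \<in> unit_ball (M \<Otimes>\<^sub>M M)"
      using u by (auto simp: unit_ball_def space_pair_measure intro: measurable_compose[OF measurable_fst]
          measurable_compose[OF measurable_snd])
  qed
  then show ?thesis
    unfolding corr_kernel_def[abs_def] using assms(2) by (intro unit_ball_avg) (auto simp: averaging_def)
qed

lemma kernel_op_corr_kernel:
  assumes f: "f \<in> unit_ball M" and gs: "averaging gs" and v: "v \<in> unit_ball M"
  shows "kernel_op M (corr_kernel f gs) v x = avg gs (\<lambda>g. f (S g x) * (\<integral>y. v y * f (S g y) \<partial>M))"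
proof -
  have i: "integrable M (\<lambda>y. f (S g x) * (v y * f (S g y)))" if "g \<in> set gs" for g
    using unit_ball_mult[OF v unit_ball_S[OF averaging_in[OF gs that] f]]
    by (intro integrable_mult_right unit_ball_integrable)
  have "kernel_op M (corr_kernel f gs) v x = (\<integral>y. avg gs (\<lambda>g. f (S g x) * (v y * f (S g y))) \<partial>M)"
    unfolding kernel_op_def corr_kernel_def
    by (simp only: avg_multc[symmetric] fst_conv snd_conv) (simp only: mult_ac)
  also have "\<dots> = avg gs (\<lambda>g. \<integral>y. f (S g x) * (v y * f (S g y)) \<partial>M)"
    using i by (rule avg_integrable)
  finally show ?thesis by simp
qed

lemma kernel_op_equivariant:
  assumes K: "K \<in> unit_ball (M \<Otimes>\<^sub>M M)" and v: "v \<in> unit_ball M" and g: "g \<in> carrier G"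
    and inv: "AE z in M \<Otimes>\<^sub>M M. K (S g (fst z), S g (snd z)) = K z"
  shows "AE x in M. kernel_op M K v (S g x) = kernel_op M K (\<lambda>y. v (S g y)) x"
proof -
  interpret P: pair_prob_space M M ..
  have "AE x in M. AE y in M. K (S g x, S g y) = K (x, y)"
    using P.AE_pair[OF inv] by simp
  then show ?thesis
    using AE_space
  proof eventually_elim
    fix x assume x: "AE y in M. K (S g x, S g y) = K (x, y)" "x \<in> space M"
    have Sx: "S g x \<in> space M" by (rule S_space[OF g x(2)])
    note m = unit_ball_measurable[OF unit_ball_section[OF K Sx]]
      unit_ball_measurable[OF unit_ball_section[OF K x(2)]] unit_ball_measurable[OF v]
    have "kernel_op M K v (S g x) = (\<integral>y. K (S g x, S g y) * v (S g y) \<partial>M)"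
      unfolding kernel_op_def
      using m by (intro integral_S[OF g, symmetric, of "\<lambda>y. K (S g x, y) * v y"]) measurable
    also have "\<dots> = (\<integral>y. K (x, y) * v (S g y) \<partial>M)"
      using S_comp_measurable[OF g m(1)] S_comp_measurable[OF g m(3)] m x(1)
      by (intro integral_cong_AE) auto
    finally show "kernel_op M K v (S g x) = kernel_op M K (\<lambda>y. v (S g y)) x"
      by (simp add: kernel_op_def)
  qed
qed

text \<open>An operator that commutes with the action and is a limit of operators of finite rank has
  almost periodic functions as values: the orbit of \<open>kernel_op M K v\<close> is the image of a
  bounded set, and finite rank operators map bounded sets to precompact ones.\<close>

lemma kernel_op_almost_periodic:
  assumes f: "f \<in> unit_ball M" and K: "K \<in> unit_ball (M \<Otimes>\<^sub>M M)" and v: "v \<in> unit_ball M"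
    and inv: "\<And>g. g \<in> carrier G \<Longrightarrow> AE z in M \<Otimes>\<^sub>M M. K (S g (fst z), S g (snd z)) = K z"
    and approx: "\<And>\<epsilon>. \<epsilon> > 0 \<Longrightarrow> \<exists>gs. averaging gs \<and> (\<integral>z. \<bar>corr_kernel f gs z - K z\<bar> \<partial>(M \<Otimes>\<^sub>M M)) < \<epsilon>"
  shows "almost_periodic (kernel_op M K v)"
  unfolding almost_periodic_def
proof (intro conjI precompact_approx)
  show "integrable M (kernel_op M K v)" by (intro unit_ball_integrable kernel_op_unit_ball K v)
  fix \<epsilon> :: real assume "\<epsilon> > 0"
  then obtain gs where gs: "averaging gs"
    and close: "(\<integral>z. \<bar>corr_kernel f gs z - K z\<bar> \<partial>(M \<Otimes>\<^sub>M M)) < \<epsilon> / 2"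
    using approx[of "\<epsilon>/2"] by auto
  define C where "C = corr_kernel f gs"
  have C: "C \<in> unit_ball (M \<Otimes>\<^sub>M M)" unfolding C_def by (rule corr_kernel_unit_ball[OF f gs])
  define \<alpha> where "\<alpha> k g = (\<integral>y. v (S g y) * f (S k y) \<partial>M)" for k g
  have \<alpha>: "\<bar>\<alpha> k g\<bar> \<le> 1" if "k \<in> set gs" "g \<in> carrier G" for k g
    unfolding \<alpha>_def using that v f averaging_in[OF gs]
    by (intro abs_integral_unit_ball_le unit_ball_mult unit_ball_S) auto
  have "precompact (carrier G) (\<lambda>g h. avg gs (\<lambda>k. \<bar>\<alpha> k g - \<alpha> k h\<bar>))"
    using \<alpha> by (intro precompact_avg precompact_bounded_real[where C = 1]) auto
  moreover have "orbit_dist (kernel_op M K v) g h \<le> avg gs (\<lambda>k. \<bar>\<alpha> k g - \<alpha> k h\<bar>) + \<epsilon>"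
    if g: "g \<in> carrier G" and h: "h \<in> carrier G" for g h
  proof -
    define w where "w k = (\<lambda>y. v (S k y))" for k
    have w: "w g \<in> unit_ball M" "w h \<in> unit_ball M"
      unfolding w_def by (intro unit_ball_S g h v)+
    note i = kernel_op_unit_ball[OF K w(1), THEN unit_ball_integrable]
      kernel_op_unit_ball[OF K w(2), THEN unit_ball_integrable]
      kernel_op_unit_ball[OF C w(1), THEN unit_ball_integrable]
      kernel_op_unit_ball[OF C w(2), THEN unit_ball_integrable]
    note iv = kernel_op_unit_ball[OF K v, THEN unit_ball_integrable, THEN integrable_S[rotated]]
    have "orbit_dist (kernel_op M K v) g h = (\<integral>x. \<bar>kernel_op M K (w g) x - kernel_op M K (w h) x\<bar> \<partial>M)"
      unfolding orbit_dist_def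
    proof (rule integral_cong_AE)
      show "AE x in M. \<bar>kernel_op M K v (S g x) - kernel_op M K v (S h x)\<bar> =
          \<bar>kernel_op M K (w g) x - kernel_op M K (w h) x\<bar>"
        using kernel_op_equivariant[OF K v g inv[OF g]] kernel_op_equivariant[OF K v h inv[OF h]]
        by eventually_elim (simp add: w_def)
    qed (use i iv[OF g] iv[OF h] in auto)
    also have "\<dots> \<le> (\<integral>x. \<bar>kernel_op M K (w g) x - kernel_op M C (w g) x\<bar> \<partial>M) +
        (\<integral>x. \<bar>kernel_op M C (w g) x - kernel_op M K (w h) x\<bar> \<partial>M)"
      by (intro L1_triangle i)
    also have "(\<integral>x. \<bar>kernel_op M C (w g) x - kernel_op M K (w h) x\<bar> \<partial>M) \<le>
        (\<integral>x. \<bar>kernel_op M C (w g) x - kernel_op M C (w h) x\<bar> \<partial>M) +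
        (\<integral>x. \<bar>kernel_op M C (w h) x - kernel_op M K (w h) x\<bar> \<partial>M)"
      by (intro L1_triangle i)
    also have "(\<integral>x. \<bar>kernel_op M C (w g) x - kernel_op M C (w h) x\<bar> \<partial>M) \<le>
        (\<integral>x. avg gs (\<lambda>k. \<bar>\<alpha> k g - \<alpha> k h\<bar>) \<partial>M)"
    proof (rule integral_mono)
      fix x assume x: "x \<in> space M"
      have "kernel_op M C (w g) x - kernel_op M C (w h) x = avg gs (\<lambda>k. f (S k x) * (\<alpha> k g - \<alpha> k h))"
        unfolding C_def kernel_op_corr_kernel[OF f gs w(1)] kernel_op_corr_kernel[OF f gs w(2)]
        by (simp add: avg_diff[symmetric] right_diff_distrib \<alpha>_def w_def)
      also have "\<bar>\<dots>\<bar> \<le> avg gs (\<lambda>k. \<bar>f (S k x) * (\<alpha> k g - \<alpha> k h)\<bar>)" by (rule abs_avg_le)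
      also have "\<dots> \<le> avg gs (\<lambda>k. \<bar>\<alpha> k g - \<alpha> k h\<bar>)"
      proof (rule avg_mono)
        fix k assume "k \<in> set gs"
        then have "\<bar>f (S k x)\<bar> \<le> 1"
          using unit_ball_bound[OF unit_ball_S[OF averaging_in[OF gs] f] x] by blast
        then show "\<bar>f (S k x) * (\<alpha> k g - \<alpha> k h)\<bar> \<le> \<bar>\<alpha> k g - \<alpha> k h\<bar>"
          by (simp add: abs_mult mult_left_le_one_le)
      qed
      finally show "\<bar>kernel_op M C (w g) x - kernel_op M C (w h) x\<bar> \<le> avg gs (\<lambda>k. \<bar>\<alpha> k g - \<alpha> k h\<bar>)" .
    qed (use i in auto)
    also have "(\<integral>x. avg gs (\<lambda>k. \<bar>\<alpha> k g - \<alpha> k h\<bar>) \<partial>M) = avg gs (\<lambda>k. \<bar>\<alpha> k g - \<alpha> k h\<bar>)"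
      by (simp add: prob_space)
    finally show ?thesis
      using kernel_op_L1_le[OF K C w(1)] kernel_op_L1_le[OF C K w(2)] close
      by (simp add: C_def abs_minus_commute)
  qed
  ultimately show "\<exists>d'. precompact (carrier G) d' \<and> (\<forall>g\<in>carrier G. \<forall>h\<in>carrier G.
      orbit_dist (kernel_op M K v) g h \<le> d' g h + \<epsilon>)"
    by blast
qed

text \<open>The averages of \<open>f(S g x) f(S g y)\<close> converge to an invariant kernel. Its operator takes
  almost periodic values, whereas all averages take values orthogonal to these; so the limit
  operator vanishes, and with it the mean of \<open>\<langle>f \<circ> S g, v\<rangle>\<^sup>2\<close>.\<close>

theorem weak_mixing:
  assumes f: "f \<in> unit_ball M"
    and orth: "\<And>\<psi>. \<lbrakk>almost_periodic \<psi>; \<psi> \<in> unit_ball M\<rbrakk> \<Longrightarrow> (\<integral>x. f x * \<psi> x \<partial>M) = 0"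
    and \<epsilon>: "\<epsilon> > 0"
  shows "\<exists>gs. averaging gs \<and> (\<forall>v\<in>unit_ball M. avg gs (\<lambda>g. (\<integral>x. v x * f (S g x) \<partial>M)\<^sup>2) \<le> \<epsilon>)"
proof -
  interpret P: abelian_action G "M \<Otimes>\<^sub>M M" "\<lambda>g z. (S g (fst z), S g (snd z))"
    by (rule product_action)
  have ff: "(\<lambda>z. f (fst z) * f (snd z)) \<in> unit_ball (M \<Otimes>\<^sub>M M)"
    using f by (intro unit_ball_mult) (auto simp: unit_ball_def space_pair_measure
        intro: measurable_compose[OF measurable_fst] measurable_compose[OF measurable_snd])
  obtain K where K: "K \<in> unit_ball (M \<Otimes>\<^sub>M M)"
    and inv: "\<And>g. g \<in> carrier G \<Longrightarrow> AE z in M \<Otimes>\<^sub>M M. K (S g (fst z), S g (snd z)) = K z"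
    and approx: "\<And>\<epsilon>. \<epsilon> > 0 \<Longrightarrow> \<exists>gs. averaging gs \<and>
      (\<integral>z. \<bar>corr_kernel f gs z - K z\<bar> \<partial>(M \<Otimes>\<^sub>M M)) < \<epsilon>"
    using P.mean_ergodic[OF ff] unfolding corr_kernel_def by auto
  have zero: "(\<integral>x. \<bar>kernel_op M K v x\<bar> \<partial>M) = 0" if v: "v \<in> unit_ball M" for v
  proof -
    define V where "V = kernel_op M K v"
    have V: "V \<in> unit_ball M" unfolding V_def by (rule kernel_op_unit_ball[OF K v])
    have apV: "almost_periodic V"
      unfolding V_def by (rule kernel_op_almost_periodic[OF f K v inv approx])
    have orthV: "(\<integral>x. V x * f (S g x) \<partial>M) = 0" if g: "g \<in> carrier G" for g
    proof -
      have ig: "inv g \<in> carrier G" using g by simp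
      have "(\<integral>x. V x * f (S g x) \<partial>M) = (\<integral>x. V (S (inv g) x) * f (S g (S (inv g) x)) \<partial>M)"
        using f V g by (intro integral_S[OF ig, symmetric, of "\<lambda>x. V x * f (S g x)"]
            borel_measurable_times S_comp_measurable unit_ball_measurable)
      also have "\<dots> = (\<integral>x. f x * V (S (inv g) x) \<partial>M)"
        using g ig by (intro Bochner_Integration.integral_cong refl)
          (simp add: S_mult[symmetric] S_one mult.commute)
      also have "\<dots> = 0"
        by (rule orth[OF almost_periodic_S[OF apV ig] unit_ball_S[OF ig V]])
      finally show ?thesis .
    qed
    have "(\<integral>x. (V x)\<^sup>2 \<partial>M) \<le> 0 + e" if e: "e > 0" for e
    proof -
      obtain gs where gs: "averaging gs" and
        close: "(\<integral>z. \<bar>corr_kernel f gs z - K z\<bar> \<partial>(M \<Otimes>\<^sub>M M)) < e"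
        using approx[OF e] by blast
      define W where "W = kernel_op M (corr_kernel f gs) v"
      have Wu: "W \<in> unit_ball M"
        unfolding W_def by (intro kernel_op_unit_ball corr_kernel_unit_ball f gs v)
      have W: "W x = avg gs (\<lambda>g. f (S g x) * (\<integral>y. v y * f (S g y) \<partial>M))" for x
        unfolding W_def by (rule kernel_op_corr_kernel[OF f gs v])
      have "(\<integral>x. V x * W x \<partial>M) = (\<integral>x. avg gs (\<lambda>g. V x * f (S g x) * (\<integral>y. v y * f (S g y) \<partial>M)) \<partial>M)"
        unfolding W by (simp add: avg_cmult[symmetric] mult.assoc)
      also have "\<dots> = avg gs (\<lambda>g. \<integral>x. V x * f (S g x) * (\<integral>y. v y * f (S g y) \<partial>M) \<partial>M)"
        using V f averaging_in[OF gs]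
        by (intro avg_integrable integrable_mult_left unit_ball_integrable unit_ball_mult unit_ball_S) auto
      also have "\<dots> = avg gs (\<lambda>g. 0)"
        using orthV averaging_in[OF gs] by (intro avg_cong) simp
      also have "\<dots> = 0" using averaging_nonempty[OF gs] by (simp add: avg_const)
      finally have VW: "(\<integral>x. V x * W x \<partial>M) = 0" .
      have iVW: "integrable M (\<lambda>x. V x - W x)"
        using V Wu by (intro Bochner_Integration.integrable_diff unit_ball_integrable)
      have "(\<integral>x. (V x)\<^sup>2 \<partial>M) = (\<integral>x. V x * (V x - W x) + V x * W x \<partial>M)"
        by (simp add: power2_eq_square algebra_simps)
      also have "\<dots> = (\<integral>x. V x * (V x - W x) \<partial>M) + (\<integral>x. V x * W x \<partial>M)"
        by (rule Bochner_Integration.integral_add[OF abs_integral_mult_le(1)[OF V iVW]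
              unit_ball_integrable[OF unit_ball_mult[OF V Wu]]])
      also have "\<dots> \<le> (\<integral>x. \<bar>V x - W x\<bar> \<partial>M)"
        using abs_integral_mult_le(2)[OF V iVW] VW by simp
      also have "\<dots> \<le> (\<integral>z. \<bar>K z - corr_kernel f gs z\<bar> \<partial>(M \<Otimes>\<^sub>M M))"
        unfolding V_def W_def by (intro kernel_op_L1_le K corr_kernel_unit_ball f gs v)
      also have "\<dots> \<le> e" using close by (simp add: abs_minus_commute)
      finally show ?thesis by simp
    qed
    then have "(\<integral>x. (V x)\<^sup>2 \<partial>M) \<le> 0" by (rule field_le_epsilon)
    moreover have "(\<integral>x. \<bar>V x\<bar> \<partial>M)\<^sup>2 \<le> (\<integral>x. (V x)\<^sup>2 \<partial>M)"
      using V by (intro L1_le_L2) (auto intro!: unit_ball_integrable unit_ball_mult simp: power2_eq_square)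
    ultimately have "(\<integral>x. \<bar>V x\<bar> \<partial>M)\<^sup>2 \<le> 0" by linarith
    then show ?thesis by (simp add: V_def)
  qed
  obtain gs where gs: "averaging gs" and
    close: "(\<integral>z. \<bar>corr_kernel f gs z - K z\<bar> \<partial>(M \<Otimes>\<^sub>M M)) < \<epsilon>"
    using approx[OF \<epsilon>] by blast
  have "avg gs (\<lambda>g. (\<integral>x. v x * f (S g x) \<partial>M)\<^sup>2) \<le> \<epsilon>" if v: "v \<in> unit_ball M" for v
  proof -
    define W where "W = kernel_op M (corr_kernel f gs) v"
    have Wu: "W \<in> unit_ball M"
      unfolding W_def by (intro kernel_op_unit_ball corr_kernel_unit_ball f gs v)
    have V: "kernel_op M K v \<in> unit_ball M" by (rule kernel_op_unit_ball[OF K v])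
    have "avg gs (\<lambda>g. (\<integral>x. v x * f (S g x) \<partial>M)\<^sup>2) =
        avg gs (\<lambda>g. \<integral>x. v x * f (S g x) * (\<integral>y. v y * f (S g y) \<partial>M) \<partial>M)"
      by (simp add: power2_eq_square)
    also have "\<dots> = (\<integral>x. avg gs (\<lambda>g. v x * f (S g x) * (\<integral>y. v y * f (S g y) \<partial>M)) \<partial>M)"
      using v f averaging_in[OF gs]
      by (intro avg_integrable(2)[symmetric] integrable_mult_left unit_ball_integrable unit_ball_mult
          unit_ball_S) auto
    also have "\<dots> = (\<integral>x. v x * W x \<partial>M)"
      unfolding W_def kernel_op_corr_kernel[OF f gs v] by (simp add: avg_cmult[symmetric] mult.assoc)
    also have "\<dots> \<le> (\<integral>x. \<bar>W x\<bar> \<partial>M)"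
      using abs_integral_mult_le(2)[OF v unit_ball_integrable[OF Wu]] by simp
    also have "\<dots> \<le> (\<integral>x. \<bar>W x - kernel_op M K v x\<bar> \<partial>M) + (\<integral>x. \<bar>kernel_op M K v x - 0\<bar> \<partial>M)"
      using L1_triangle[OF unit_ball_integrable[OF Wu] unit_ball_integrable[OF V], of "\<lambda>_. 0"] by simp
    also have "\<dots> = (\<integral>x. \<bar>W x - kernel_op M K v x\<bar> \<partial>M)" using zero[OF v] by simp
    also have "\<dots> \<le> (\<integral>z. \<bar>corr_kernel f gs z - K z\<bar> \<partial>(M \<Otimes>\<^sub>M M))"
      unfolding W_def by (intro kernel_op_L1_le K corr_kernel_unit_ball f gs v)
    finally show ?thesis using close by simp
  qed
  then show ?thesis using gs by blast
qed

text \<open>The bound above is uniform in \<open>v\<close>, and translating the group element amounts to translating \<open>v\<close>.\<close>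

corollary weak_mixing_mean:
  assumes f: "f \<in> unit_ball M"
    and orth: "\<And>\<psi>. \<lbrakk>almost_periodic \<psi>; \<psi> \<in> unit_ball M\<rbrakk> \<Longrightarrow> (\<integral>x. f x * \<psi> x \<partial>M) = 0"
    and v: "v \<in> unit_ball M"
  shows "mean_le (\<lambda>g. (\<integral>x. v x * f (S g x) \<partial>M)\<^sup>2) 0"
  unfolding mean_le_def
proof (intro allI impI)
  fix \<epsilon> :: real assume "\<epsilon> > 0"
  then obtain gs where gs: "averaging gs" and
    le: "\<And>v. v \<in> unit_ball M \<Longrightarrow> avg gs (\<lambda>g. (\<integral>x. v x * f (S g x) \<partial>M)\<^sup>2) \<le> \<epsilon>"
    using weak_mixing[OF f orth] by blast
  have "avg gs (\<lambda>g. (\<integral>x. v x * f (S (g \<otimes> t) x) \<partial>M)\<^sup>2) \<le> 0 + \<epsilon>" if t: "t \<in> carrier G" for t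
  proof -
    have it: "inv t \<in> carrier G" using t by simp
    have eq: "(\<integral>x. v x * f (S (g \<otimes> t) x) \<partial>M) = (\<integral>x. v (S (inv t) x) * f (S g x) \<partial>M)"
      if g: "g \<in> carrier G" for g
    proof -
      have "(\<integral>x. v x * f (S (g \<otimes> t) x) \<partial>M) = (\<integral>x. v (S (inv t) x) * f (S (g \<otimes> t) (S (inv t) x)) \<partial>M)"
        using f v g t by (intro integral_S[OF it, symmetric, of "\<lambda>x. v x * f (S (g \<otimes> t) x)"]
            borel_measurable_times S_comp_measurable unit_ball_measurable m_closed)
      also have "\<dots> = (\<integral>x. v (S (inv t) x) * f (S g x) \<partial>M)"
        using g t it by (intro Bochner_Integration.integral_cong refl)
          (simp add: S_mult[symmetric] m_assoc)
      finally show ?thesis .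
    qed
    have "avg gs (\<lambda>g. (\<integral>x. v x * f (S (g \<otimes> t) x) \<partial>M)\<^sup>2) =
        avg gs (\<lambda>g. (\<integral>x. v (S (inv t) x) * f (S g x) \<partial>M)\<^sup>2)"
      using eq averaging_in[OF gs] by (intro avg_cong) simp
    then show ?thesis using le[OF unit_ball_S[OF it v]] by simp
  qed
  then show "\<exists>gs. averaging gs \<and> (\<forall>t\<in>carrier G.
      avg gs (\<lambda>g. (\<integral>x. v x * f (S (g \<otimes> t) x) \<partial>M)\<^sup>2) \<le> 0 + \<epsilon>)"
    using gs by blast
qed

end

section \<open>Invariant functions of a subgroup of finite index\<close>

context abelian_action
begin

definition invariant_sets :: "'g set \<Rightarrow> 'x set set" where
  "invariant_sets H = {B \<in> sets M. \<forall>h\<in>H. AE x in M. S h x \<in> B \<longleftrightarrow> x \<in> B}"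

lemma invariant_setsD:
  assumes "B \<in> invariant_sets H"
  shows "B \<in> sets M" "h \<in> H \<Longrightarrow> AE x in M. S h x \<in> B \<longleftrightarrow> x \<in> B"
  using assms by (auto simp: invariant_sets_def)

lemma invariant_sets_Int:
  assumes "B \<in> invariant_sets H" "D \<in> invariant_sets H"
  shows "B \<inter> D \<in> invariant_sets H"
  unfolding invariant_sets_def
proof (intro CollectI conjI ballI)
  show "B \<inter> D \<in> sets M" using assms by (auto simp: invariant_sets_def)
  fix h assume "h \<in> H"
  from invariant_setsD(2)[OF assms(1) this] invariant_setsD(2)[OF assms(2) this]
  show "AE x in M. S h x \<in> B \<inter> D \<longleftrightarrow> x \<in> B \<inter> D" by eventually_elim auto
qed

lemma invariant_sets_Diff:
  assumes "B \<in> invariant_sets H" "D \<in> invariant_sets H"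
  shows "B - D \<in> invariant_sets H"
  unfolding invariant_sets_def
proof (intro CollectI conjI ballI)
  show "B - D \<in> sets M" using assms by (auto simp: invariant_sets_def)
  fix h assume "h \<in> H"
  from invariant_setsD(2)[OF assms(1) this] invariant_setsD(2)[OF assms(2) this]
  show "AE x in M. S h x \<in> B - D \<longleftrightarrow> x \<in> B - D" by eventually_elim auto
qed

lemma invariant_sets_space: "H \<subseteq> carrier G \<Longrightarrow> space M \<in> invariant_sets H"
  by (auto simp: invariant_sets_def S_space subset_iff)

lemma invariant_sets_Un:
  assumes "H \<subseteq> carrier G" "B \<in> invariant_sets H" "D \<in> invariant_sets H"
  shows "B \<union> D \<in> invariant_sets H"
proof -
  have "B \<union> D = space M - ((space M - B) - D)"
    using sets.sets_into_space[OF invariant_setsD(1)[OF assms(2)]]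
      sets.sets_into_space[OF invariant_setsD(1)[OF assms(3)]] by auto
  then show ?thesis
    using invariant_sets_Diff invariant_sets_space[OF assms(1)] assms(2,3) by metis
qed

lemma invariant_sets_Union:
  assumes "H \<subseteq> carrier G" "finite \<B>" "\<B> \<subseteq> invariant_sets H"
  shows "\<Union>\<B> \<in> invariant_sets H"
  using assms(2,3)
proof (induction \<B>)
  case empty
  show ?case by (auto simp: invariant_sets_def)
next
  case (insert B \<B>)
  then show ?case using invariant_sets_Un[OF assms(1)] by simp
qed

lemma prob_S_vimage:
  assumes "g \<in> carrier G" "B \<in> sets M"
  shows "prob {x \<in> space M. S g x \<in> B} = prob B"
proof -
  have "prob B = measure (distr M M (S g)) B" by (simp add: distr_S[OF assms(1)])
  also have "\<dots> = prob (S g -` B \<inter> space M)"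
    using assms by (intro measure_distr S_measurable) auto
  also have "S g -` B \<inter> space M = {x \<in> space M. S g x \<in> B}" by auto
  finally show ?thesis by simp
qed

text \<open>The translates of \<open>B\<close> by coset representatives cover the space up to a null set, by ergodicity
  of the whole action; so their number bounds the measure of \<open>B\<close> below.\<close>

lemma invariant_set_prob_ge:
  assumes H: "subgroup H G" "finite (rcosets H)" and cnt: "countable (carrier G)"
    and erg: "\<And>E. \<lbrakk>E \<in> sets M; \<And>g x. \<lbrakk>g \<in> carrier G; x \<in> space M\<rbrakk> \<Longrightarrow> S g x \<in> E \<longleftrightarrow> x \<in> E\<rbrakk> \<Longrightarrow>
      prob E = 0 \<or> prob E = 1"
    and B: "B \<in> invariant_sets H" "prob B > 0"
  shows "1 \<le> real (card (rcosets H)) * prob B"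
proof -
  have Bs: "B \<in> sets M" using B(1) by (rule invariant_setsD)
  define E where "E = (\<Union>g\<in>carrier G. {x \<in> space M. S g x \<in> B})"
  have ms: "{x \<in> space M. S g x \<in> B} \<in> sets M" if "g \<in> carrier G" for g
    using measurable_sets[OF S_measurable[OF that] Bs] by (simp add: vimage_def Int_def conj_commute)
  have E: "E \<in> sets M"
    unfolding E_def using ms cnt by (intro sets.countable_UN') auto
  have "S k x \<in> E \<longleftrightarrow> x \<in> E" if k: "k \<in> carrier G" and x: "x \<in> space M" for k x
  proof
    assume "S k x \<in> E"
    then obtain g where "g \<in> carrier G" "S g (S k x) \<in> B" by (auto simp: E_def)
    then show "x \<in> E" using k x by (auto simp: E_def S_mult intro!: bexI[of _ "g \<otimes> k"])
  next
    assume "x \<in> E"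
    then obtain g where g: "g \<in> carrier G" "S g x \<in> B" by (auto simp: E_def)
    have "S (g \<otimes> inv k) (S k x) = S g x"
      using g(1) k x by (simp add: S_mult[symmetric] S_space m_assoc)
    then show "S k x \<in> E"
      using g k x by (auto simp: E_def S_space intro!: bexI[of _ "g \<otimes> inv k"])
  qed
  then have "prob E = 0 \<or> prob E = 1" by (intro erg[OF E])
  moreover have "B \<subseteq> E"
  proof
    fix x assume x: "x \<in> B"
    then have xs: "x \<in> space M" using sets.sets_into_space[OF Bs] by blast
    then have "S \<one> x \<in> B" using x by (simp add: S_one)
    then show "x \<in> E" unfolding E_def using xs by blast
  qed
  then have "prob B \<le> prob E" by (intro finite_measure_mono E)
  ultimately have E1: "prob E = 1" using B(2) by auto
  have "\<exists>r. r \<in> carrier G \<and> C = H #> r" if "C \<in> rcosets H" for C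
    using that by (auto simp: RCOSETS_def)
  then obtain r where r: "\<And>C. C \<in> rcosets H \<Longrightarrow> r C \<in> carrier G \<and> C = H #> r C" by metis
  define U where "U = (\<Union>C\<in>rcosets H. {x \<in> space M. S (r C) x \<in> B})"
  have U: "U \<in> sets M" unfolding U_def using H(2) r ms by (intro sets.finite_UN) auto
  have "AE x in M. \<forall>g\<in>carrier G. S g x \<in> B \<longrightarrow> x \<in> U"
    unfolding AE_ball_countable[OF cnt]
  proof
    fix g assume g: "g \<in> carrier G"
    define C where "C = H #> g"
    have C: "C \<in> rcosets H" unfolding C_def using g H(1) by (intro rcosetsI subgroup.subset)
    have "g \<in> H #> r C"
      using r[OF C] rcos_self[OF g H(1)] by (simp add: C_def)
    then obtain h where h: "h \<in> H" "g = h \<otimes> r C" by (auto simp: r_coset_def)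
    have hG: "h \<in> carrier G" using h(1) H(1) subgroup.mem_carrier by metis
    have "AE x in M. S h (S (r C) x) \<in> B \<longleftrightarrow> S (r C) x \<in> B"
      using AE_S[OF conjunct1[OF r[OF C]] invariant_setsD(2)[OF B(1) h(1)]] .
    then show "AE x in M. S g x \<in> B \<longrightarrow> x \<in> U"
      using AE_space
    proof eventually_elim
      case (elim x)
      then show ?case using C r[OF C] hG by (auto simp: U_def h(2) S_mult)
    qed
  qed
  then have "AE x in M. x \<in> E \<longrightarrow> x \<in> U"
    using AE_space by eventually_elim (auto simp: E_def)
  then have "prob E \<le> prob U" by (rule finite_measure_mono_AE[OF _ U])
  also have "\<dots> \<le> (\<Sum>C\<in>rcosets H. prob {x \<in> space M. S (r C) x \<in> B})"
    unfolding U_def using H(2) r ms by (intro finite_measure_subadditive_finite) auto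
  also have "\<dots> = (\<Sum>C\<in>rcosets H. prob B)"
    using r Bs by (intro sum.cong refl prob_S_vimage) auto
  finally show ?thesis using E1 by simp
qed

text \<open>Since non-null invariant sets are not too small, a disjoint family of them of maximal size
  exists. Its members admit no further invariant subdivision and together exhaust the space.\<close>

lemma finite_atoms:
  assumes H: "subgroup H G" "finite (rcosets H)" and cnt: "countable (carrier G)"
    and erg: "\<And>E. \<lbrakk>E \<in> sets M; \<And>g x. \<lbrakk>g \<in> carrier G; x \<in> space M\<rbrakk> \<Longrightarrow> S g x \<in> E \<longleftrightarrow> x \<in> E\<rbrakk> \<Longrightarrow>
      prob E = 0 \<or> prob E = 1"
  obtains \<B> where "finite \<B>" "\<B> \<subseteq> invariant_sets H" "disjoint \<B>" "AE x in M. x \<in> \<Union>\<B>"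
    "\<And>B. B \<in> \<B> \<Longrightarrow> prob B > 0"
    "\<And>B D. \<lbrakk>B \<in> \<B>; D \<in> invariant_sets H\<rbrakk> \<Longrightarrow> prob (B \<inter> D) = 0 \<or> prob (B - D) = 0"
proof -
  have HG: "H \<subseteq> carrier G" by (rule subgroup.subset[OF H(1)])
  define n where "n = card (rcosets H)"
  have ge: "1 \<le> real n * prob B" if "B \<in> invariant_sets H" "prob B > 0" for B
    unfolding n_def by (rule invariant_set_prob_ge[OF H cnt erg that])
  define P where "P \<B> \<longleftrightarrow> finite \<B> \<and> \<B> \<subseteq> invariant_sets H \<and> disjoint \<B> \<and> (\<forall>B\<in>\<B>. prob B > 0)" for \<B>
  have "card \<B> \<le> n" if "P \<B>" for \<B>
  proof -
    have p: "finite \<B>" "\<B> \<subseteq> invariant_sets H" "disjoint \<B>" "\<And>B. B \<in> \<B> \<Longrightarrow> prob B > 0"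
      using that by (auto simp: P_def)
    have "real (card \<B>) = (\<Sum>B\<in>\<B>. 1)" by simp
    also have "\<dots> \<le> (\<Sum>B\<in>\<B>. real n * prob B)"
      using p ge by (intro sum_mono) auto
    also have "\<dots> = real n * (\<Sum>B\<in>\<B>. prob B)" by (simp add: sum_distrib_left)
    also have "(\<Sum>B\<in>\<B>. prob B) = prob (\<Union>B\<in>\<B>. B)"
      using p by (intro finite_measure_finite_Union[symmetric])
        (auto simp: disjoint_family_on_def disjoint_def invariant_sets_def)
    also have "real n * \<dots> \<le> real n * 1" by (intro mult_left_mono) auto
    finally show ?thesis by simp
  qed
  moreover have "P {}" by (simp add: P_def)
  ultimately obtain \<B> where PB: "P \<B>" and max: "\<And>\<C>. P \<C> \<Longrightarrow> card \<C> \<le> card \<B>"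
    using ex_has_greatest_nat[of P "{}" card "Suc n"] by (auto simp: less_Suc_eq_le)
  then have p: "finite \<B>" "\<B> \<subseteq> invariant_sets H" "disjoint \<B>" "\<And>B. B \<in> \<B> \<Longrightarrow> prob B > 0"
    by (auto simp: P_def)
  define R where "R = space M - \<Union>\<B>"
  have R: "R \<in> invariant_sets H"
    unfolding R_def using p HG
    by (intro invariant_sets_Diff invariant_sets_space invariant_sets_Union)
  have "prob R = 0"
  proof (rule ccontr)
    assume "prob R \<noteq> 0"
    then have pos: "prob R > 0" using measure_nonneg[of M R] by linarith
    have "R \<notin> \<B>"
    proof
      assume "R \<in> \<B>"
      then have "R = {}" unfolding R_def by auto
      then show False using pos by simp
    qed
    moreover have "P (insert R \<B>)"
      using p R pos by (auto simp: P_def disjoint_def R_def)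
    ultimately show False using max[of "insert R \<B>"] p(1) by simp
  qed
  then have "AE x in M. x \<notin> R"
    using invariant_setsD(1)[OF R] by (simp add: prob_eq_0)
  then have cover: "AE x in M. x \<in> \<Union>\<B>"
    using AE_space by eventually_elim (auto simp: R_def)
  have "prob (B \<inter> D) = 0 \<or> prob (B - D) = 0" if B: "B \<in> \<B>" and D: "D \<in> invariant_sets H" for B D
  proof (rule ccontr)
    assume "\<not> ?thesis"
    then have pos: "prob (B \<inter> D) > 0" "prob (B - D) > 0"
      using measure_nonneg[of M "B \<inter> D"] measure_nonneg[of M "B - D"] by linarith+
    then have ne: "B \<inter> D \<noteq> {}" "B - D \<noteq> {}" by force+
    have dis: "\<And>C. C \<in> \<B> - {B} \<Longrightarrow> C \<inter> B = {}" using p(3) B by (auto simp: disjoint_def)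
    define \<C> where "\<C> = insert (B \<inter> D) (insert (B - D) (\<B> - {B}))"
    have BH: "B \<in> invariant_sets H" using B p(2) by blast
    have "P \<C>"
      unfolding P_def
    proof (intro conjI)
      show "disjoint \<C>" using p(3) dis unfolding \<C>_def disjoint_def by blast
      show "\<C> \<subseteq> invariant_sets H"
        using p(2) invariant_sets_Int[OF BH D] invariant_sets_Diff[OF BH D] by (auto simp: \<C>_def)
    qed (use p pos in \<open>auto simp: \<C>_def\<close>)
    moreover have "card \<C> = Suc (card \<B>)"
    proof -
      have n1: "B - D \<notin> \<B> - {B}" "B \<inter> D \<notin> \<B> - {B}" using ne dis by blast+
      have n2: "B \<inter> D \<noteq> B - D" using ne by blast
      have "card \<C> = Suc (Suc (card (\<B> - {B})))"
        unfolding \<C>_def using n1 n2 p(1) by simp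
      then show ?thesis using card_Suc_Diff1[OF p(1) B] by simp
    qed
    ultimately show False using max[of \<C>] by simp
  qed
  then show thesis using that[of \<B>] p cover by blast
qed

text \<open>On an atom an invariant function equals its mean: one of the sets where it lies
  below and not below the mean is null, and then so is the other deviation.\<close>

theorem invariant_functions_finite_dim:
  assumes H: "subgroup H G" "finite (rcosets H)" and cnt: "countable (carrier G)"
    and erg: "\<And>E. \<lbrakk>E \<in> sets M; \<And>g x. \<lbrakk>g \<in> carrier G; x \<in> space M\<rbrakk> \<Longrightarrow> S g x \<in> E \<longleftrightarrow> x \<in> E\<rbrakk> \<Longrightarrow>
      prob E = 0 \<or> prob E = 1"
  obtains \<B> where "finite \<B>" "\<B> \<subseteq> sets M"
    "\<And>F. \<lbrakk>F \<in> unit_ball M; \<And>h. h \<in> H \<Longrightarrow> AE x in M. F (S h x) = F x\<rbrakk> \<Longrightarrow>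
      \<exists>c. (\<forall>B\<in>\<B>. \<bar>c B\<bar> \<le> 1) \<and> (AE x in M. F x = (\<Sum>B\<in>\<B>. c B * indicator B x))"
proof -
  obtain \<B> where \<B>: "finite \<B>" "\<B> \<subseteq> invariant_sets H" "disjoint \<B>" "AE x in M. x \<in> \<Union>\<B>"
    "\<And>B. B \<in> \<B> \<Longrightarrow> prob B > 0"
    "\<And>B D. \<lbrakk>B \<in> \<B>; D \<in> invariant_sets H\<rbrakk> \<Longrightarrow> prob (B \<inter> D) = 0 \<or> prob (B - D) = 0"
    using finite_atoms[OF H cnt erg] by blast
  have Bs: "B \<in> sets M" if "B \<in> \<B>" for B using that \<B>(2) by (auto simp: invariant_sets_def)
  have "\<exists>c. (\<forall>B\<in>\<B>. \<bar>c B\<bar> \<le> 1) \<and> (AE x in M. F x = (\<Sum>B\<in>\<B>. c B * indicator B x))"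
    if F: "F \<in> unit_ball M" and inv: "\<And>h. h \<in> H \<Longrightarrow> AE x in M. F (S h x) = F x" for F
  proof -
    have [measurable]: "F \<in> borel_measurable M" using F by (rule unit_ball_measurable)
    define c where "c B = (\<integral>x. F x * indicator B x \<partial>M) / prob B" for B
    have c1: "\<bar>c B\<bar> \<le> 1" if B: "B \<in> \<B>" for B
    proof -
      have "\<bar>\<integral>x. F x * indicator B x \<partial>M\<bar> \<le> (\<integral>x. \<bar>indicator B x\<bar> \<partial>M)"
        using unit_ball_integrable[OF unit_ball_indicator[OF Bs[OF B]]]
        by (rule abs_integral_mult_le(2)[OF F])
      also have "\<dots> = prob B" using Bs[OF B] by simp
      finally show ?thesis using \<B>(5)[OF B] by (simp add: c_def abs_divide divide_le_eq)
    qed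
    have const: "AE x in M. x \<in> B \<longrightarrow> F x = c B" if B: "B \<in> \<B>" for B
    proof -
      note [measurable] = Bs[OF B]
      define D where "D = {x \<in> space M. F x < c B}"
      have Ds[measurable]: "D \<in> sets M" unfolding D_def by measurable
      have D: "D \<in> invariant_sets H"
        unfolding invariant_sets_def
      proof (intro CollectI conjI ballI Ds)
        fix h assume h: "h \<in> H"
        have hG: "h \<in> carrier G" using h H(1) subgroup.mem_carrier by metis
        show "AE x in M. S h x \<in> D \<longleftrightarrow> x \<in> D"
          using inv[OF h] AE_space by eventually_elim (auto simp: D_def S_space[OF hG])
      qed
      define u where "u x = (F x - c B) * indicator B x" for x
      have iF: "integrable M (\<lambda>x. F x * indicator B x)"
        using F by (intro unit_ball_integrable unit_ball_mult unit_ball_indicator Bs[OF B])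
      have iB: "integrable M (\<lambda>x. c B * indicator B x)"
        by (intro integrable_mult_right unit_ball_integrable unit_ball_indicator Bs[OF B])
      have u: "u = (\<lambda>x. F x * indicator B x - c B * indicator B x)"
        by (rule ext) (simp add: u_def left_diff_distrib)
      have iu: "integrable M u" unfolding u using iF iB by (rule Bochner_Integration.integrable_diff)
      have "(\<integral>x. u x \<partial>M) = (\<integral>x. F x * indicator B x \<partial>M) - c B * prob B"
        unfolding u using iF iB Bs[OF B] by simp
      also have "\<dots> = 0" using \<B>(5)[OF B] by (simp add: c_def)
      finally have u0: "(\<integral>x. u x \<partial>M) = 0" .
      have "AE x in M. u x = 0"
      proof (cases "prob (B \<inter> D) = 0")
        case True
        then have "AE x in M. x \<notin> B \<inter> D" by (simp add: prob_eq_0)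
        then have "AE x in M. 0 \<le> u x"
          using AE_space by eventually_elim (auto simp: u_def D_def indicator_def)
        then show ?thesis using integral_nonneg_eq_0_iff_AE[OF iu] u0 by simp
      next
        case False
        then have "prob (B - D) = 0" using \<B>(6)[OF B D] by simp
        then have "AE x in M. x \<notin> B - D" by (simp add: prob_eq_0)
        then have "AE x in M. 0 \<le> - u x"
          using AE_space by eventually_elim (auto simp: u_def D_def indicator_def)
        then show ?thesis
          using integral_nonneg_eq_0_iff_AE[of M "\<lambda>x. - u x"] iu u0 by simp
      qed
      then show ?thesis by eventually_elim (auto simp: u_def)
    qed
    have "AE x in M. \<forall>B\<in>\<B>. x \<in> B \<longrightarrow> F x = c B"
      using \<B>(1) const by (intro AE_finite_allI)
    then have "AE x in M. F x = (\<Sum>B\<in>\<B>. c B * indicator B x)"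
      using \<B>(4)
    proof eventually_elim
      fix x assume x: "\<forall>B\<in>\<B>. x \<in> B \<longrightarrow> F x = c B" "x \<in> \<Union>\<B>"
      then obtain B where B: "B \<in> \<B>" "x \<in> B" by blast
      have "x \<notin> C" if "C \<in> \<B> - {B}" for C
        using \<B>(3) that B by (auto simp: disjoint_def)
      then have "(\<Sum>B\<in>\<B>. c B * indicator B x) = c B"
        using B \<B>(1) by (subst sum.remove[of _ B]) (auto intro!: sum.neutral)
      then show "F x = (\<Sum>B\<in>\<B>. c B * indicator B x)" using x(1) B by simp
    qed
    then show ?thesis using c1 by blast
  qed
  then show thesis using that \<B>(1) Bs by blast
qed

end

section \<open>Averages along two powers of the action\<close>

text \<open>The elements can be chosen one after the other: each earlier one excludes only a set of upper
  mean zero, whereas \<open>B\<close> has positive lower density.\<close>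

lemma (in comm_group) exists_pairwise_small:
  fixes Q :: "'a \<Rightarrow> 'a \<Rightarrow> real"
  assumes B: "mean_le (indicator (- B)) (1 - \<kappa>)" "\<kappa> > 0"
    and Q: "\<And>g. g \<in> carrier G \<Longrightarrow> mean_le (Q g) 0" "\<And>g h. 0 \<le> Q g h" and \<eta>: "\<eta> > 0"
  shows "\<exists>h :: nat \<Rightarrow> 'a. \<forall>j<N. h j \<in> B \<inter> carrier G \<and> (\<forall>i<j. Q (h i) (h j) < \<eta>)"
proof (induction N)
  case 0
  show ?case by simp
next
  case (Suc N)
  then obtain h where h: "\<And>j. j < N \<Longrightarrow> h j \<in> B \<inter> carrier G"
    "\<And>i j. \<lbrakk>j < N; i < j\<rbrakk> \<Longrightarrow> Q (h i) (h j) < \<eta>"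
    by blast
  have "mean_le (\<lambda>k. indicator (- B) k + (1/\<eta>) * (\<Sum>i<N. Q (h i) k)) (1 - \<kappa> + (1/\<eta>) * (\<Sum>i<N. 0))"
    using h(1) Q(1) \<eta> by (intro mean_le_add B mean_le_cmult mean_le_sum) auto
  from mean_le_exists[OF this, of 1] B(2)
  obtain k where k: "k \<in> carrier G" "indicator (- B) k + (1/\<eta>) * (\<Sum>i<N. Q (h i) k) < 1"
    by auto
  have s: "0 \<le> (1/\<eta>) * (\<Sum>i<N. Q (h i) k)" using Q(2) \<eta> by (intro mult_nonneg_nonneg sum_nonneg) auto
  have kB: "k \<in> B"
  proof (rule ccontr)
    assume "k \<notin> B"
    then show False using k(2) s by simp
  qed
  have "Q (h i) k < \<eta>" if "i < N" for i
  proof -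
    have "Q (h i) k \<le> (\<Sum>i<N. Q (h i) k)" using that Q(2) by (intro member_le_sum) auto
    also have "\<dots> < \<eta>" using k(2) kB \<eta> by (simp add: divide_less_eq)
    finally show ?thesis .
  qed
  then have "\<forall>j<Suc N. (h(N := k)) j \<in> B \<inter> carrier G \<and>
      (\<forall>i<j. Q ((h(N := k)) i) ((h(N := k)) j) < \<eta>)"
    using h k(1) kB by (auto simp: less_Suc_eq)
  then show ?case by blast
qed

context abelian_action
begin

lemma power_action: "abelian_action G M (\<lambda>g. S (g [^] (c::int)))"
  by unfold_locales (simp_all add: S_preserves int_pow_distrib S_mult S_one)

text \<open>Along the action, correlations of \<open>F\<^sub>1\<close> and \<open>F\<^sub>2\<close> have the mean that results from
  replacing \<open>F\<^sub>2\<close> by its invariant part, here a combination of finitely many indicators.\<close>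

lemma mean_correlation_le:
  assumes F1: "F1 \<in> unit_ball M" and F2: "F2 \<in> unit_ball M"
    and \<B>: "finite \<B>" "\<B> \<subseteq> sets M"
    and fin: "\<And>F. \<lbrakk>F \<in> unit_ball M; \<And>g. g \<in> carrier G \<Longrightarrow> AE x in M. F (S g x) = F x\<rbrakk> \<Longrightarrow>
      \<exists>c. (\<forall>B\<in>\<B>. \<bar>c B\<bar> \<le> 1) \<and> (AE x in M. F x = (\<Sum>B\<in>\<B>. c B * indicator B x))"
  shows "mean_le (\<lambda>g. \<integral>x. F1 x * F2 (S g x) \<partial>M) (\<Sum>B\<in>\<B>. \<bar>\<integral>x. F1 x * indicator B x \<partial>M\<bar>)"
  unfolding mean_le_def
proof (intro allI impI)
  fix \<epsilon> :: real assume \<epsilon>: "\<epsilon> > 0"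
  obtain F where F: "F \<in> unit_ball M" and inv: "\<And>g. g \<in> carrier G \<Longrightarrow> AE x in M. F (S g x) = F x"
    and approx: "\<And>\<epsilon>. \<epsilon> > 0 \<Longrightarrow> \<exists>gs. averaging gs \<and> (\<integral>x. \<bar>ergodic_avg gs F2 x - F x\<bar> \<partial>M) < \<epsilon>"
    using mean_ergodic[OF F2] by blast
  obtain c where c: "\<And>B. B \<in> \<B> \<Longrightarrow> \<bar>c B\<bar> \<le> 1" "AE x in M. F x = (\<Sum>B\<in>\<B>. c B * indicator B x)"
    using fin[OF F inv] by blast
  obtain gs where gs: "averaging gs" and close: "(\<integral>x. \<bar>ergodic_avg gs F2 x - F x\<bar> \<partial>M) < \<epsilon>"
    using approx[OF \<epsilon>] by blast
  define E where "E = ergodic_avg gs F2"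
  have E: "E \<in> unit_ball M" unfolding E_def by (rule ergodic_avg_unit_ball[OF gs F2])
  have [measurable]: "F1 \<in> borel_measurable M" "F \<in> borel_measurable M"
    using F1 F by (auto intro: unit_ball_measurable)
  have i: "integrable M (\<lambda>x. F1 x * (c B * indicator B x))" if "B \<in> \<B>" for B
  proof -
    have "(\<lambda>x. F1 x * indicator B x) \<in> unit_ball M"
      using that \<B>(2) by (intro unit_ball_mult F1 unit_ball_indicator) auto
    then have "integrable M (\<lambda>x. c B * (F1 x * indicator B x))"
      by (intro integrable_mult_right unit_ball_integrable)
    then show ?thesis by (simp only: mult.left_commute[of _ "c B"])
  qed
  have "(\<integral>x. F1 x * F x \<partial>M) = (\<integral>x. (\<Sum>B\<in>\<B>. F1 x * (c B * indicator B x)) \<partial>M)"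
  proof (rule integral_cong_AE)
    show "AE x in M. F1 x * F x = (\<Sum>B\<in>\<B>. F1 x * (c B * indicator B x))"
      using c(2) by eventually_elim (simp only: sum_distrib_left)
    show "(\<lambda>x. \<Sum>B\<in>\<B>. F1 x * (c B * indicator B x)) \<in> borel_measurable M"
      using i by (intro borel_measurable_sum borel_measurable_integrable)
  qed measurable
  also have "\<dots> = (\<Sum>B\<in>\<B>. \<integral>x. F1 x * (c B * indicator B x) \<partial>M)"
    using i by (rule Bochner_Integration.integral_sum)
  also have "\<dots> = (\<Sum>B\<in>\<B>. c B * (\<integral>x. F1 x * indicator B x \<partial>M))"
  proof (rule sum.cong[OF refl])
    fix B
    show "(\<integral>x. F1 x * (c B * indicator B x) \<partial>M) = c B * (\<integral>x. F1 x * indicator B x \<partial>M)"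
      by (simp only: mult.left_commute[of _ "c B"] integral_mult_right_zero)
  qed
  also have "\<dots> \<le> (\<Sum>B\<in>\<B>. \<bar>\<integral>x. F1 x * indicator B x \<partial>M\<bar>)"
  proof (rule sum_mono)
    fix B assume "B \<in> \<B>"
    then have "\<bar>c B * (\<integral>x. F1 x * indicator B x \<partial>M)\<bar> \<le> \<bar>\<integral>x. F1 x * indicator B x \<partial>M\<bar>"
      using c(1) by (simp add: abs_mult mult_left_le_one_le)
    then show "c B * (\<integral>x. F1 x * indicator B x \<partial>M) \<le> \<bar>\<integral>x. F1 x * indicator B x \<partial>M\<bar>" by linarith
  qed
  finally have main: "(\<integral>x. F1 x * F x \<partial>M) \<le> (\<Sum>B\<in>\<B>. \<bar>\<integral>x. F1 x * indicator B x \<partial>M\<bar>)" .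
  have "avg gs (\<lambda>g. \<integral>x. F1 x * F2 (S (g \<otimes> t) x) \<partial>M) \<le> (\<Sum>B\<in>\<B>. \<bar>\<integral>x. F1 x * indicator B x \<partial>M\<bar>) + \<epsilon>"
    if t: "t \<in> carrier G" for t
  proof -
    note Et = unit_ball_S[OF t E] and Ft = unit_ball_S[OF t F]
    have iEF: "integrable M (\<lambda>x. E (S t x) - F (S t x))"
      using Et Ft by (intro Bochner_Integration.integrable_diff unit_ball_integrable)
    have "avg gs (\<lambda>g. \<integral>x. F1 x * F2 (S (g \<otimes> t) x) \<partial>M) = (\<integral>x. avg gs (\<lambda>g. F1 x * F2 (S (g \<otimes> t) x)) \<partial>M)"
      using averaging_in[OF gs] t F1 F2
      by (intro avg_integrable(2)[symmetric] unit_ball_integrable unit_ball_mult unit_ball_S) auto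
    also have "\<dots> = (\<integral>x. F1 x * E (S t x) \<partial>M)"
      unfolding E_def avg_cmult[symmetric] using averaging_in[OF gs] t
      by (intro Bochner_Integration.integral_cong refl avg_cong) (simp add: S_mult)
    also have "\<dots> = (\<integral>x. F1 x * (E (S t x) - F (S t x)) + F1 x * F (S t x) \<partial>M)"
      by (simp add: right_diff_distrib)
    also have "\<dots> = (\<integral>x. F1 x * (E (S t x) - F (S t x)) \<partial>M) + (\<integral>x. F1 x * F (S t x) \<partial>M)"
      by (rule Bochner_Integration.integral_add[OF abs_integral_mult_le(1)[OF F1 iEF]
            unit_ball_integrable[OF unit_ball_mult[OF F1 Ft]]])
    also have "(\<integral>x. F1 x * (E (S t x) - F (S t x)) \<partial>M) \<le> (\<integral>x. \<bar>E (S t x) - F (S t x)\<bar> \<partial>M)"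
      using abs_integral_mult_le(2)[OF F1 iEF] by linarith
    also have "\<dots> = (\<integral>x. \<bar>E x - F x\<bar> \<partial>M)"
      using E by (intro integral_S[OF t, of "\<lambda>x. \<bar>E x - F x\<bar>"] borel_measurable_abs
          borel_measurable_diff unit_ball_measurable F)
    also have "(\<integral>x. F1 x * F (S t x) \<partial>M) = (\<integral>x. F1 x * F x \<partial>M)"
      using inv[OF t] unit_ball_measurable[OF Ft] by (intro integral_cong_AE) auto
    finally show ?thesis using main close by (simp add: E_def)
  qed
  then show "\<exists>gs. averaging gs \<and> (\<forall>t\<in>carrier G. avg gs (\<lambda>g. \<integral>x. F1 x * F2 (S (g \<otimes> t) x) \<partial>M)
      \<le> (\<Sum>B\<in>\<B>. \<bar>\<integral>x. F1 x * indicator B x \<partial>M\<bar>) + \<epsilon>)"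
    using gs by blast
qed

text \<open>Van der Corput's trick with finitely many shifts \<open>h j\<close>. Squaring and substituting
  \<open>S (g [^] a) x\<close> for \<open>x\<close> leaves correlations along \<open>g [^] (b - a)\<close> only; their means
  see just the products of shifts of \<open>f\<^sub>1\<close>, tested on the finitely many sets in \<open>\<B>\<close>.\<close>

lemma van_der_Corput:
  fixes a b :: int and h :: "nat \<Rightarrow> 'g"
  assumes f: "f0 \<in> unit_ball M" "f1 \<in> unit_ball M" "f2 \<in> unit_ball M"
    and h: "\<And>j. j < N \<Longrightarrow> h j \<in> carrier G" and N: "N > 0"
    and \<B>: "finite \<B>" "\<B> \<subseteq> sets M"
    and fin: "\<And>F. \<lbrakk>F \<in> unit_ball M; \<And>g. g \<in> carrier G \<Longrightarrow> AE x in M. F (S (g [^] (b - a)) x) = F x\<rbrakk> \<Longrightarrow>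
      \<exists>c. (\<forall>B\<in>\<B>. \<bar>c B\<bar> \<le> 1) \<and> (AE x in M. F x = (\<Sum>B\<in>\<B>. c B * indicator B x))"
    and \<eta>: "\<eta> \<ge> 0"
    and small: "\<And>B j k. \<lbrakk>B \<in> \<B>; j < N; k < N; j \<noteq> k\<rbrakk> \<Longrightarrow>
      \<bar>\<integral>x. f1 (S (h j [^] a) x) * f1 (S (h k [^] a) x) * indicator B x \<partial>M\<bar> \<le> \<eta>"
  shows "mean_le (\<lambda>g. ((1 / real N) * (\<Sum>j<N. \<integral>x. f0 x *
      (f1 (S ((g \<otimes> h j) [^] a) x) * f2 (S ((g \<otimes> h j) [^] b) x)) \<partial>M))\<^sup>2)
    (1 / real N + real (card \<B>) * \<eta>)"
proof -
  interpret C: abelian_action G M "\<lambda>g. S (g [^] (b - a))" by (rule power_action)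
  define u where "u g x = f1 (S (g [^] a) x) * f2 (S (g [^] b) x)" for g x
  define F1 where "F1 j k x = f1 (S (h j [^] a) x) * f1 (S (h k [^] a) x)" for j k x
  define F2 where "F2 j k x = f2 (S (h j [^] b) x) * f2 (S (h k [^] b) x)" for j k x
  define D where "D j k g = (\<integral>x. F1 j k x * F2 j k (S (g [^] (b - a)) x) \<partial>M)" for j k g
  have u: "u g \<in> unit_ball M" if "g \<in> carrier G" for g
    unfolding u_def[abs_def] using that f by (intro unit_ball_mult unit_ball_S) auto
  have F12: "F1 j k \<in> unit_ball M" "F2 j k \<in> unit_ball M" if "j < N" "k < N" for j k
    unfolding F1_def[abs_def] F2_def[abs_def] using that f h by (auto intro!: unit_ball_mult unit_ball_S)
  have D1: "\<bar>D j k g\<bar> \<le> 1" if "j < N" "k < N" "g \<in> carrier G" for j k g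
    unfolding D_def using that F12 by (intro abs_integral_unit_ball_le unit_ball_mult unit_ball_S) auto
  have corr: "(\<integral>x. u (g \<otimes> h j) x * u (g \<otimes> h k) x \<partial>M) = D j k g"
    if jk: "j < N" "k < N" and g: "g \<in> carrier G" for j k g
  proof -
    have ga: "g [^] a \<in> carrier G" "g [^] (b - a) \<in> carrier G" using g by auto
    have gb: "g [^] b = g [^] (b - a) \<otimes> g [^] a"
      using g int_pow_mult[of g "b - a" a] by simp
    have e: "u (g \<otimes> h i) x = f1 (S (h i [^] a) (S (g [^] a) x)) *
        f2 (S (h i [^] b) (S (g [^] (b - a)) (S (g [^] a) x)))"
      if i: "i < N" and x: "x \<in> space M" for i x
    proof -
      have "(g \<otimes> h i) [^] a = h i [^] a \<otimes> g [^] a" "(g \<otimes> h i) [^] b = h i [^] b \<otimes> (g [^] (b - a) \<otimes> g [^] a)"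
        using g h[OF i] by (simp_all add: int_pow_distrib m_comm gb)
      then show ?thesis
        unfolding u_def using g h[OF i] x ga by (simp add: S_mult S_space)
    qed
    have "(\<integral>x. u (g \<otimes> h j) x * u (g \<otimes> h k) x \<partial>M) =
        (\<integral>x. F1 j k (S (g [^] a) x) * F2 j k (S (g [^] (b - a)) (S (g [^] a) x)) \<partial>M)"
      by (intro Bochner_Integration.integral_cong refl)
        (simp add: e[OF jk(1)] e[OF jk(2)] F1_def F2_def)
    also have "\<dots> = D j k g"
      unfolding D_def
      by (intro integral_S[OF ga(1), of "\<lambda>x. F1 j k x * F2 j k (S (g [^] (b - a)) x)"]
          unit_ball_measurable unit_ball_mult unit_ball_S F12 jk ga)
    finally show ?thesis .
  qed
  define d where "d j k = (if j = k then 1 else 0) + real (card \<B>) * \<eta>" for j k :: nat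
  have mean_D: "mean_le (D j k) (d j k)" if jk: "j < N" "k < N" for j k
  proof (cases "j = k")
    case True
    have "D j k g \<le> 1" if "g \<in> carrier G" for g using D1[OF jk that] by linarith
    then show ?thesis using True \<eta> by (intro mean_le_mono[OF mean_le_const[of 1]]) (auto simp: d_def)
  next
    case False
    have m: "mean_le (D j k) (\<Sum>B\<in>\<B>. \<bar>\<integral>x. F1 j k x * indicator B x \<partial>M\<bar>)"
      unfolding D_def[abs_def] by (rule C.mean_correlation_le[OF F12[OF jk] \<B> fin])
    have "(\<Sum>B\<in>\<B>. \<bar>\<integral>x. F1 j k x * indicator B x \<partial>M\<bar>) \<le> (\<Sum>B\<in>\<B>. \<eta>)"
      unfolding F1_def by (rule sum_mono) (rule small[OF _ jk False])
    then have "(\<Sum>B\<in>\<B>. \<bar>\<integral>x. F1 j k x * indicator B x \<partial>M\<bar>) \<le> d j k"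
      using False by (simp add: d_def)
    then show ?thesis by (rule mean_le_mono[OF m order_refl])
  qed
  have "mean_le (\<lambda>g. (1 / real N ^ 2) * (\<Sum>j<N. \<Sum>k<N. D j k g)) ((1 / real N ^ 2) * (\<Sum>j<N. \<Sum>k<N. d j k))"
    using mean_D by (intro mean_le_cmult mean_le_sum) auto
  moreover have "((1 / real N) * (\<Sum>j<N. \<integral>x. f0 x * u (g \<otimes> h j) x \<partial>M))\<^sup>2 \<le>
      (1 / real N ^ 2) * (\<Sum>j<N. \<Sum>k<N. D j k g)" if g: "g \<in> carrier G" for g
  proof -
    have ug: "u (g \<otimes> h j) \<in> unit_ball M" if "j < N" for j using u g h[OF that] by simp
    define W where "W x = (\<Sum>j<N. u (g \<otimes> h j) x)" for x
    have iW: "integrable M W"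
      unfolding W_def using ug by (intro Bochner_Integration.integrable_sum unit_ball_integrable) auto
    have W2: "(W x)\<^sup>2 = (\<Sum>j<N. \<Sum>k<N. u (g \<otimes> h j) x * u (g \<otimes> h k) x)" for x
      unfolding W_def power2_eq_square by (rule sum_product)
    have iuu: "integrable M (\<lambda>x. u (g \<otimes> h j) x * u (g \<otimes> h k) x)" if "j < N" "k < N" for j k
      using ug that by (intro unit_ball_integrable unit_ball_mult)
    have iW2: "integrable M (\<lambda>x. (W x)\<^sup>2)"
      unfolding W2 using iuu by (intro Bochner_Integration.integrable_sum) auto
    have "(\<Sum>j<N. \<integral>x. f0 x * u (g \<otimes> h j) x \<partial>M) = (\<integral>x. f0 x * W x \<partial>M)"
      unfolding W_def sum_distrib_left using ug f(1)
      by (intro Bochner_Integration.integral_sum[symmetric] unit_ball_integrable unit_ball_mult) auto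
    moreover have "\<bar>\<integral>x. f0 x * W x \<partial>M\<bar> \<le> (\<integral>x. \<bar>W x\<bar> \<partial>M)" by (rule abs_integral_mult_le[OF f(1) iW])
    ultimately have "(\<Sum>j<N. \<integral>x. f0 x * u (g \<otimes> h j) x \<partial>M)\<^sup>2 \<le> (\<integral>x. \<bar>W x\<bar> \<partial>M)\<^sup>2"
      by (simp add: abs_le_square_iff[symmetric])
    also have "\<dots> \<le> (\<integral>x. (W x)\<^sup>2 \<partial>M)" by (rule L1_le_L2[OF iW iW2])
    also have "\<dots> = (\<Sum>j<N. \<Sum>k<N. D j k g)"
    proof -
      have "(\<integral>x. (W x)\<^sup>2 \<partial>M) = (\<Sum>j<N. \<integral>x. (\<Sum>k<N. u (g \<otimes> h j) x * u (g \<otimes> h k) x) \<partial>M)"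
        unfolding W2 using iuu
        by (intro Bochner_Integration.integral_sum Bochner_Integration.integrable_sum) auto
      also have "\<dots> = (\<Sum>j<N. \<Sum>k<N. \<integral>x. u (g \<otimes> h j) x * u (g \<otimes> h k) x \<partial>M)"
        using iuu by (intro sum.cong refl Bochner_Integration.integral_sum) auto
      also have "\<dots> = (\<Sum>j<N. \<Sum>k<N. D j k g)"
        using corr[OF _ _ g] by (intro sum.cong refl) auto
      finally show ?thesis .
    qed
    finally show ?thesis
      using N by (simp add: power_mult_distrib power_divide divide_right_mono)
  qed
  moreover have "(1 / real N ^ 2) * (\<Sum>j<N. \<Sum>k<N. d j k) = 1 / real N + real (card \<B>) * \<eta>"
  proof -
    have "(\<Sum>j<N. \<Sum>k<N. d j k) = real N + real N * (real N * (real (card \<B>) * \<eta>))"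
      unfolding d_def by (simp add: sum.distrib distrib_left)
    also have "\<dots> = real N ^ 2 * (1 / real N + real (card \<B>) * \<eta>)"
      using N by (simp add: power2_eq_square distrib_left)
    finally show ?thesis using N by simp
  qed
  ultimately show ?thesis
    unfolding u_def by (rule mean_le_mono[OF _ _ eq_refl])
qed

end

section \<open>Large intersections\<close>

context abelian_action
begin

text \<open>Finite index of the multiples of \<open>b - a\<close> enters as the hypothesis \<open>fin\<close>. The recurrence times
  come from an almost period \<open>g\<close> at which the averages of both error terms over the shifts \<open>g \<otimes> h j\<close>
  are small: the main term is large at all these shifts, so \<open>f\<close> itself returns at one of them.\<close>

lemma syndetic_large_intersections:
  fixes a b :: int
  assumes A: "A \<in> sets M" and \<epsilon>: "\<epsilon> > 0"
    and \<B>: "finite \<B>" "\<B> \<subseteq> sets M"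
    and fin: "\<And>F. \<lbrakk>F \<in> unit_ball M; \<And>g. g \<in> carrier G \<Longrightarrow> AE x in M. F (S (g [^] (b - a)) x) = F x\<rbrakk> \<Longrightarrow>
      \<exists>c. (\<forall>B\<in>\<B>. \<bar>c B\<bar> \<le> 1) \<and> (AE x in M. F x = (\<Sum>B\<in>\<B>. c B * indicator B x))"
  shows "syndetic G {g \<in> carrier G.
      prob (A \<inter> (S (g [^] a) -` A \<inter> space M) \<inter> (S (g [^] b) -` A \<inter> space M)) > prob A ^ 3 - \<epsilon>}"
proof -
  interpret A: abelian_action G M "\<lambda>g. S (g [^] a)" by (rule power_action)
  interpret B: abelian_action G M "\<lambda>g. S (g [^] b)" by (rule power_action)
  define f :: "'x \<Rightarrow> real" where "f = indicator A"
  have f: "f \<in> unit_ball M" unfolding f_def by (rule unit_ball_indicator[OF A])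
  have fm: "f \<in> borel_measurable M" by (rule unit_ball_measurable[OF f])
  have f01: "0 \<le> f x \<and> f x \<le> 1" for x by (simp add: f_def)
  obtain p where p: "A.almost_periodic p" "\<And>x. 0 \<le> p x \<and> p x \<le> 1"
    "\<And>\<psi>. \<lbrakk>A.almost_periodic \<psi>; \<psi> \<in> unit_ball M\<rbrakk> \<Longrightarrow> (\<integral>x. f x * \<psi> x \<partial>M) = (\<integral>x. p x * \<psi> x \<partial>M)"
    using A.almost_periodic_projection[OF fm f01] by blast
  obtain q where q: "B.almost_periodic q" "\<And>x. 0 \<le> q x \<and> q x \<le> 1"
    "\<And>\<psi>. \<lbrakk>B.almost_periodic \<psi>; \<psi> \<in> unit_ball M\<rbrakk> \<Longrightarrow> (\<integral>x. f x * \<psi> x \<partial>M) = (\<integral>x. q x * \<psi> x \<partial>M)"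
    using B.almost_periodic_projection[OF fm f01] by blast
  have pi: "integrable M p" "integrable M q"
    using p(1) q(1) by (auto simp: A.almost_periodic_def B.almost_periodic_def)
  have pq: "p \<in> unit_ball M" "q \<in> unit_ball M"
    using p(2) q(2) pi by (auto intro!: unit_ballI)
  have cube: "prob A ^ 3 \<le> (\<integral>x. f x * (p x * q x) \<partial>M)"
  proof -
    have "(\<integral>x. f x \<partial>M) ^ 3 \<le> (\<integral>x. f x * (p x * q x) \<partial>M)"
      using f01 p(2) q(2) A.projection_quotient_le_1[OF p] B.projection_quotient_le_1[OF q]
      by (intro cube_le_integral_product fm unit_ball_measurable pq) auto
    then show ?thesis using A by (simp add: f_def)
  qed
  define f1 where "f1 x = f x - p x" for x
  define f2 where "f2 x = f x - q x" for x
  have abs1: "\<bar>f1 x\<bar> \<le> 1" "\<bar>f2 x\<bar> \<le> 1" for x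
    using f01[of x] p(2)[of x] q(2)[of x] by (auto simp: f1_def f2_def)
  have f12: "f1 \<in> unit_ball M" "f2 \<in> unit_ball M"
    using abs1 fm pi by (auto intro!: unit_ballI simp: f1_def[abs_def] f2_def[abs_def])
  have orth1: "(\<integral>x. f1 x * \<psi> x \<partial>M) = 0" if "A.almost_periodic \<psi>" "\<psi> \<in> unit_ball M" for \<psi>
    using p(3)[OF that] unit_ball_integrable[OF unit_ball_mult[OF f that(2)]]
      unit_ball_integrable[OF unit_ball_mult[OF pq(1) that(2)]]
    by (simp add: f1_def left_diff_distrib)
  have orth2: "(\<integral>x. f2 x * \<psi> x \<partial>M) = 0" if "B.almost_periodic \<psi>" "\<psi> \<in> unit_ball M" for \<psi>
    using q(3)[OF that] unit_ball_integrable[OF unit_ball_mult[OF f that(2)]]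
      unit_ball_integrable[OF unit_ball_mult[OF pq(2) that(2)]]
    by (simp add: f2_def left_diff_distrib)

  \<comment> \<open>The final loss is at most \<open>4 * \<delta>\<close>: twice \<open>\<delta>\<close> because \<open>g \<otimes> h j\<close> is a product of two almost periods,
    and \<open>\<delta>\<close> for each of the two error terms.\<close>
  define \<delta> where "\<delta> = \<epsilon> / 8"
  have \<delta>: "\<delta> > 0" using \<epsilon> by (simp add: \<delta>_def)
  define d where "d g h = A.orbit_dist p g h + B.orbit_dist q g h" for g h
  have d_inv: "d (k \<otimes> g) (k \<otimes> h) = d g h" if "g \<in> carrier G" "h \<in> carrier G" "k \<in> carrier G" for g h k
    unfolding d_def using A.orbit_dist_translate[OF pi(1) that] B.orbit_dist_translate[OF pi(2) that] by simp
  define R where "R = {g \<in> carrier G. d g \<one> < \<delta>}"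
  have "precompact (carrier G) d"
    unfolding d_def[abs_def] using p(1) q(1)
    by (intro precompact_add) (auto simp: A.almost_periodic_def B.almost_periodic_def)
  then have "syndetic G R"
    unfolding R_def using \<delta> d_inv by (rule precompact_syndetic)
  then obtain \<kappa> where \<kappa>: "\<kappa> > 0" and mean_R: "mean_le (indicator (- R)) (1 - \<kappa>)"
    using syndetic_mean_le by blast

  \<comment> \<open>Both squared errors have mean at most \<open>2 * \<rho>\<close>, so by Chebyshev's inequality one of them exceeds
    \<open>\<delta>\<^sup>2\<close> on a set of density at most \<open>\<kappa> / 2\<close>, less than the density \<open>\<kappa>\<close> of \<open>R\<close>.\<close>
  define m where "m = real (card \<B>)"
  define \<rho> where "\<rho> = \<kappa> * \<delta>\<^sup>2 / 8"
  have \<rho>: "\<rho> > 0" using \<kappa> \<delta> by (simp add: \<rho>_def)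
  obtain N0 :: nat where N0: "inverse (real (Suc N0)) < \<rho>" using reals_Archimedean[OF \<rho>] by blast
  define N where "N = Suc N0"
  have N: "N > 0" "1 / real N \<le> \<rho>" using N0 by (simp_all add: N_def inverse_eq_divide)
  define \<eta> where "\<eta> = \<rho> / (m + 1)"
  have m0: "m \<ge> 0" by (simp add: m_def)
  have \<eta>: "\<eta> > 0" using \<rho> m0 by (simp add: \<eta>_def)
  have m\<eta>: "m * \<eta> \<le> \<rho>" using \<rho> m0 by (simp add: \<eta>_def field_simps)

  define c1 where "c1 D g h = (\<integral>x. f1 (S (g [^] a) x) * indicator D x * f1 (S (h [^] a) x) \<partial>M)" for D g h
  define c2 where "c2 D g h = (\<integral>x. f2 (S (g [^] b) x) * indicator D x * f2 (S (h [^] b) x) \<partial>M)" for D g h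
  define Q where "Q g h = (\<Sum>D\<in>\<B>. (c1 D g h)\<^sup>2 + (c2 D g h)\<^sup>2)" for g h
  have "mean_le (Q g) 0" if g: "g \<in> carrier G" for g
  proof -
    have "mean_le (\<lambda>h. (c1 D g h)\<^sup>2 + (c2 D g h)\<^sup>2) (0 + 0)" if "D \<in> \<B>" for D
      unfolding c1_def c2_def using that \<B>(2) g f12
      by (intro mean_le_add A.weak_mixing_mean[OF f12(1) orth1] B.weak_mixing_mean[OF f12(2) orth2]
          unit_ball_mult A.unit_ball_S B.unit_ball_S unit_ball_indicator) auto
    then have "mean_le (\<lambda>h. \<Sum>D\<in>\<B>. (c1 D g h)\<^sup>2 + (c2 D g h)\<^sup>2) (\<Sum>D\<in>\<B>. 0 + 0)"
      by (rule mean_le_sum[OF \<B>(1)])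
    then show ?thesis by (simp add: Q_def[abs_def])
  qed
  moreover have "0 \<le> Q g h" for g h unfolding Q_def by (intro sum_nonneg) auto
  moreover have "\<eta>\<^sup>2 > 0" using \<eta> by simp
  ultimately obtain h :: "nat \<Rightarrow> 'g" where h: "\<And>j. j < N \<Longrightarrow> h j \<in> R \<inter> carrier G"
    "\<And>i j. \<lbrakk>j < N; i < j\<rbrakk> \<Longrightarrow> Q (h i) (h j) < \<eta>\<^sup>2"
    using exists_pairwise_small[OF mean_R \<kappa>, of Q "\<eta>\<^sup>2" N] by blast
  have hG: "h j \<in> carrier G" if "j < N" for j using h(1)[OF that] by blast
  have c_le: "\<bar>c1 D (h i) (h j)\<bar> \<le> \<eta> \<and> \<bar>c2 D (h i) (h j)\<bar> \<le> \<eta>" if "D \<in> \<B>" "i < j" "j < N" for D i j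
  proof -
    have "(c1 D (h i) (h j))\<^sup>2 + (c2 D (h i) (h j))\<^sup>2 \<le> Q (h i) (h j)"
      unfolding Q_def using that \<B>(1)
      by (intro member_le_sum[of D \<B> "\<lambda>D. (c1 D (h i) (h j))\<^sup>2 + (c2 D (h i) (h j))\<^sup>2"]) auto
    then have "(c1 D (h i) (h j))\<^sup>2 + (c2 D (h i) (h j))\<^sup>2 \<le> \<eta>\<^sup>2" using h(2)[OF that(3,2)] by linarith
    then have "(c1 D (h i) (h j))\<^sup>2 \<le> \<eta>\<^sup>2" "(c2 D (h i) (h j))\<^sup>2 \<le> \<eta>\<^sup>2"
      using zero_le_power2[of "c1 D (h i) (h j)"] zero_le_power2[of "c2 D (h i) (h j)"] by linarith+
    then show ?thesis using \<eta> by (auto simp: abs_le_square_iff[symmetric])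
  qed
  have small1: "\<bar>\<integral>x. f1 (S (h j [^] a) x) * f1 (S (h k [^] a) x) * indicator D x \<partial>M\<bar> \<le> \<eta>"
    if D: "D \<in> \<B>" and jk: "j < N" "k < N" "j \<noteq> k" for D j k
  proof -
    have eq: "(\<integral>x. f1 (S (h j [^] a) x) * f1 (S (h k [^] a) x) * indicator D x \<partial>M) = c1 D (h j) (h k)"
      "(\<integral>x. f1 (S (h j [^] a) x) * f1 (S (h k [^] a) x) * indicator D x \<partial>M) = c1 D (h k) (h j)"
      unfolding c1_def by (simp_all add: mult_ac)
    show ?thesis
    proof (cases "j < k")
      case True
      then show ?thesis using c_le[OF D True jk(2)] by (simp only: eq(1))
    next
      case False
      then have "k < j" using jk(3) by simp
      then show ?thesis using c_le[OF D _ jk(1)] by (simp only: eq(2))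
    qed
  qed
  have small2: "\<bar>\<integral>x. f2 (S (h j [^] b) x) * f2 (S (h k [^] b) x) * indicator D x \<partial>M\<bar> \<le> \<eta>"
    if D: "D \<in> \<B>" and jk: "j < N" "k < N" "j \<noteq> k" for D j k
  proof -
    have eq: "(\<integral>x. f2 (S (h j [^] b) x) * f2 (S (h k [^] b) x) * indicator D x \<partial>M) = c2 D (h j) (h k)"
      "(\<integral>x. f2 (S (h j [^] b) x) * f2 (S (h k [^] b) x) * indicator D x \<partial>M) = c2 D (h k) (h j)"
      unfolding c2_def by (simp_all add: mult_ac)
    show ?thesis
    proof (cases "j < k")
      case True
      then show ?thesis using c_le[OF D True jk(2)] by (simp only: eq(1))
    next
      case False
      then have "k < j" using jk(3) by simp
      then show ?thesis using c_le[OF D _ jk(1)] by (simp only: eq(2))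
    qed
  qed
  \<comment> \<open>For the second error term the roles of \<open>a\<close> and \<open>b\<close> are exchanged, and the correlations run along
    \<open>a - b\<close>; inversion in \<open>G\<close> makes the invariant functions the same.\<close>
  have fin': "\<exists>c. (\<forall>B\<in>\<B>. \<bar>c B\<bar> \<le> 1) \<and> (AE x in M. F x = (\<Sum>B\<in>\<B>. c B * indicator B x))"
    if F: "F \<in> unit_ball M" and inv: "\<And>g. g \<in> carrier G \<Longrightarrow> AE x in M. F (S (g [^] (a - b)) x) = F x" for F
  proof (rule fin[OF F])
    fix g assume g: "g \<in> carrier G"
    have "inv g [^] (a - b) = g [^] (b - a)" using g int_pow_neg[of g "a - b"] by (simp add: int_pow_inv)
    then show "AE x in M. F (S (g [^] (b - a)) x) = F x" using inv[of "inv g"] g by simp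
  qed

  define r where "r u v g = (\<integral>x. f x * (u (S (g [^] a) x) * v (S (g [^] b) x)) \<partial>M)" for u v g
  define r1 where "r1 g = (1 / real N) * (\<Sum>j<N. r f1 f (g \<otimes> h j))" for g
  define r2 where "r2 g = (1 / real N) * (\<Sum>j<N. r p f2 (g \<otimes> h j))" for g
  have mean1: "mean_le (\<lambda>g. (r1 g)\<^sup>2) (1 / real N + m * \<eta>)"
    unfolding r1_def r_def m_def
    using van_der_Corput[OF f f12(1) f hG N(1) \<B> fin less_imp_le[OF \<eta>] small1] by simp
  have mean2: "mean_le (\<lambda>g. (r2 g)\<^sup>2) (1 / real N + m * \<eta>)"
    unfolding r2_def r_def m_def
    using van_der_Corput[OF f f12(2) pq(1) hG N(1) \<B> fin' less_imp_le[OF \<eta>] small2]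
    by (simp add: mult.commute)
  \<comment> \<open>Elements of \<open>Z\<close> lie in \<open>R\<close> and have both errors at most \<open>\<delta>\<close>.\<close>
  define Z where "Z = {g \<in> carrier G. indicator (- R) g + (1 / \<delta>\<^sup>2) * ((r1 g)\<^sup>2 + (r2 g)\<^sup>2) < 1}"
  have "syndetic G Z"
    unfolding Z_def
  proof (rule syndetic_level)
    show "mean_le (\<lambda>g. indicator (- R) g + (1 / \<delta>\<^sup>2) * ((r1 g)\<^sup>2 + (r2 g)\<^sup>2))
        (1 - \<kappa> + (1 / \<delta>\<^sup>2) * ((1 / real N + m * \<eta>) + (1 / real N + m * \<eta>)))"
      by (intro mean_le_add mean_R mean_le_cmult mean1 mean2) simp
    have "(1 / \<delta>\<^sup>2) * ((1 / real N + m * \<eta>) + (1 / real N + m * \<eta>)) \<le> (1 / \<delta>\<^sup>2) * ((\<rho> + \<rho>) + (\<rho> + \<rho>))"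
      using N(2) m\<eta> by (intro mult_left_mono add_mono) auto
    also have "\<dots> = \<kappa> / 2" using \<delta> by (simp add: \<rho>_def)
    also have "\<dots> < \<kappa>" using \<kappa> by simp
    finally show "1 - \<kappa> + (1 / \<delta>\<^sup>2) * ((1 / real N + m * \<eta>) + (1 / real N + m * \<eta>)) < 1" by simp
  qed
  then obtain K where K: "finite K" "K \<subseteq> carrier G" "\<And>t. t \<in> carrier G \<Longrightarrow> \<exists>k\<in>K. k \<otimes> t \<in> Z"
    using syndeticE by blast

  have large: "\<exists>j<N. r f f (g \<otimes> h j) > prob A ^ 3 - \<epsilon>" if gZ: "g \<in> Z" for g
  proof -
    have g: "g \<in> carrier G" and lt: "indicator (- R) g + (1 / \<delta>\<^sup>2) * ((r1 g)\<^sup>2 + (r2 g)\<^sup>2) < 1"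
      using gZ by (auto simp: Z_def)
    have nn: "0 \<le> (1 / \<delta>\<^sup>2) * ((r1 g)\<^sup>2 + (r2 g)\<^sup>2)" by simp
    have gR: "g \<in> R"
    proof (rule ccontr)
      assume "g \<notin> R"
      then have "indicat_real (- R) g = 1" by simp
      then show False using lt nn by linarith
    qed
    then have "(r1 g)\<^sup>2 + (r2 g)\<^sup>2 < \<delta>\<^sup>2" using lt \<delta> by (simp add: divide_less_eq)
    then have "(r1 g)\<^sup>2 \<le> \<delta>\<^sup>2" "(r2 g)\<^sup>2 \<le> \<delta>\<^sup>2"
      using zero_le_power2[of "r1 g"] zero_le_power2[of "r2 g"] by linarith+
    then have r12: "\<bar>r1 g\<bar> \<le> \<delta>" "\<bar>r2 g\<bar> \<le> \<delta>"
      using \<delta> by (auto simp: abs_le_square_iff[symmetric])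
    have main: "r p q (g \<otimes> h j) \<ge> prob A ^ 3 - 2 * \<delta>" if j: "j < N" for j
    proof -
      define k where "k = g \<otimes> h j"
      have k: "k \<in> carrier G" using g hG[OF j] by (simp add: k_def)
      have hj: "h j \<in> carrier G" "d (h j) \<one> < \<delta>" using h(1)[OF j] by (auto simp: R_def)
      have "d k \<one> \<le> d k g + d g \<one>"
        unfolding d_def using A.orbit_dist_triangle[OF pi(1) k g one_closed]
          B.orbit_dist_triangle[OF pi(2) k g one_closed] by linarith
      also have "d k g = d (h j) \<one>"
        using d_inv[OF hj(1) one_closed g] g by (simp add: k_def)
      finally have "d k \<one> \<le> 2 * \<delta>" using hj(2) gR by (simp add: R_def)
      moreover have "(\<integral>x. f x * (p x * q x) \<partial>M) - r p q k \<le> d k \<one>"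
      proof -
        define p' where "p' x = p (S (k [^] a) x)" for x
        define q' where "q' x = q (S (k [^] b) x)" for x
        have pq': "p' \<in> unit_ball M" "q' \<in> unit_ball M"
          unfolding p'_def[abs_def] q'_def[abs_def]
          using A.unit_ball_S[OF k pq(1)] B.unit_ball_S[OF k pq(2)] by auto
        note i = unit_ball_integrable[OF unit_ball_mult[OF f unit_ball_mult[OF pq]]]
          unit_ball_integrable[OF unit_ball_mult[OF f unit_ball_mult[OF pq']]]
        have ii: "integrable M (\<lambda>x. \<bar>p' x - p x\<bar>)" "integrable M (\<lambda>x. \<bar>q' x - q x\<bar>)"
          by (intro integrable_abs Bochner_Integration.integrable_diff pi unit_ball_integrable[OF pq'(1)]
              unit_ball_integrable[OF pq'(2)])+
        have "(\<integral>x. f x * (p x * q x) \<partial>M) - r p q k = (\<integral>x. f x * (p x * q x) - f x * (p' x * q' x) \<partial>M)"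
          unfolding r_def p'_def[symmetric] q'_def[symmetric]
          by (rule Bochner_Integration.integral_diff[OF i, symmetric])
        also have "\<dots> \<le> (\<integral>x. \<bar>p' x - p x\<bar> + \<bar>q' x - q x\<bar> \<partial>M)"
        proof (rule integral_mono)
          fix x
          have b: "\<bar>f x\<bar> \<le> 1" "\<bar>p x\<bar> \<le> 1" "\<bar>q' x\<bar> \<le> 1"
            using f01[of x] p(2)[of x] q(2)[of "S (k [^] b) x"] by (auto simp: q'_def)
          have "f x * (p x * q x) - f x * (p' x * q' x) = (f x * p x) * (q x - q' x) + (f x * q' x) * (p x - p' x)"
            by (simp add: algebra_simps)
          also have "\<dots> \<le> \<bar>(f x * p x) * (q x - q' x)\<bar> + \<bar>(f x * q' x) * (p x - p' x)\<bar>"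
            by (rule order.trans[OF abs_ge_self abs_triangle_ineq])
          also have "\<dots> \<le> 1 * \<bar>q x - q' x\<bar> + 1 * \<bar>p x - p' x\<bar>"
            unfolding abs_mult using b by (intro add_mono mult_right_mono mult_le_one) auto
          finally show "f x * (p x * q x) - f x * (p' x * q' x) \<le> \<bar>p' x - p x\<bar> + \<bar>q' x - q x\<bar>"
            by (simp add: abs_minus_commute)
        qed (use i ii in auto)
        also have "\<dots> = d k \<one>"
          unfolding d_def A.orbit_dist_one B.orbit_dist_one p'_def[symmetric] q'_def[symmetric]
          using ii by simp
        finally show ?thesis .
      qed
      ultimately show ?thesis using cube by (simp add: k_def)
    qed
    have split: "r f f k = r f1 f k + r p f2 k + r p q k" if k: "k \<in> carrier G" for k
    proof -
      have i: "integrable M (\<lambda>x. f x * (u (S (k [^] a) x) * v (S (k [^] b) x)))"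
        if "u \<in> unit_ball M" "v \<in> unit_ball M" for u v
        using unit_ball_mult[OF f unit_ball_mult[OF A.unit_ball_S[OF k that(1)] B.unit_ball_S[OF k that(2)]]]
        by (rule unit_ball_integrable)
      have "r f1 f k + r p f2 k + r p q k =
          (\<integral>x. f x * (f1 (S (k [^] a) x) * f (S (k [^] b) x)) +
            f x * (p (S (k [^] a) x) * f2 (S (k [^] b) x)) +
            f x * (p (S (k [^] a) x) * q (S (k [^] b) x)) \<partial>M)"
        unfolding r_def using i[OF f12(1) f] i[OF pq(1) f12(2)] i[OF pq] by simp
      also have "\<dots> = r f f k"
        unfolding r_def f1_def f2_def
        by (intro Bochner_Integration.integral_cong refl) (simp add: algebra_simps)
      finally show ?thesis by simp
    qed
    have "prob A ^ 3 - \<epsilon> < (1 / real N) * (\<Sum>j<N. r f f (g \<otimes> h j))"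
    proof -
      have "(\<Sum>j<N. r f f (g \<otimes> h j)) = (\<Sum>j<N. r f1 f (g \<otimes> h j)) + (\<Sum>j<N. r p f2 (g \<otimes> h j)) + (\<Sum>j<N. r p q (g \<otimes> h j))"
        using split g hG by (simp add: sum.distrib)
      then have "(1 / real N) * (\<Sum>j<N. r f f (g \<otimes> h j)) = r1 g + r2 g + (1 / real N) * (\<Sum>j<N. r p q (g \<otimes> h j))"
        by (simp add: r1_def r2_def add_divide_distrib)
      moreover have "(\<Sum>j<N. prob A ^ 3 - 2 * \<delta>) \<le> (\<Sum>j<N. r p q (g \<otimes> h j))"
        using main by (intro sum_mono) auto
      then have "prob A ^ 3 - 2 * \<delta> \<le> (1 / real N) * (\<Sum>j<N. r p q (g \<otimes> h j))"
        using N(1) by (simp add: field_simps)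
      ultimately show ?thesis using r12 \<epsilon> by (simp add: \<delta>_def)
    qed
    moreover have "(1 / real N) * (\<Sum>j<N. r f f (g \<otimes> h j)) \<le> prob A ^ 3 - \<epsilon>"
      if "\<And>j. j < N \<Longrightarrow> r f f (g \<otimes> h j) \<le> prob A ^ 3 - \<epsilon>"
    proof -
      have "(\<Sum>j<N. r f f (g \<otimes> h j)) \<le> (\<Sum>j<N. prob A ^ 3 - \<epsilon>)" using that by (intro sum_mono) auto
      then show ?thesis using N(1) by (simp add: field_simps)
    qed
    ultimately show ?thesis by (meson not_le)
  qed
  have r_prob: "r f f k = prob (A \<inter> (S (k [^] a) -` A \<inter> space M) \<inter> (S (k [^] b) -` A \<inter> space M))"
    if k: "k \<in> carrier G" for k
  proof -
    have m: "S (k [^] a) -` A \<inter> space M \<in> sets M" "S (k [^] b) -` A \<inter> space M \<in> sets M"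
      using k A by (auto intro!: measurable_sets[OF S_measurable])
    have "r f f k = (\<integral>x. indicator (A \<inter> (S (k [^] a) -` A \<inter> space M) \<inter> (S (k [^] b) -` A \<inter> space M)) x \<partial>M)"
      unfolding r_def f_def by (intro Bochner_Integration.integral_cong refl) (auto simp: indicator_def)
    also have "\<dots> = prob (A \<inter> (S (k [^] a) -` A \<inter> space M) \<inter> (S (k [^] b) -` A \<inter> space M))"
      using m A by simp
    finally show ?thesis .
  qed
  show ?thesis
  proof (rule syndeticI[of _ "(\<lambda>(j, k). h j \<otimes> k) ` ({..<N} \<times> K)"])
    fix t assume t: "t \<in> carrier G"
    then obtain k where k: "k \<in> K" "k \<otimes> t \<in> Z" using K(3) by blast
    have kG: "k \<in> carrier G" using k K(2) by blast
    obtain j where j: "j < N" "r f f (k \<otimes> t \<otimes> h j) > prob A ^ 3 - \<epsilon>" using large[OF k(2)] by blast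
    have "k \<otimes> t \<otimes> h j = h j \<otimes> k \<otimes> t" using kG t hG[OF j(1)] by (simp add: m_ac)
    then have "h j \<otimes> k \<otimes> t \<in> {g \<in> carrier G. prob (A \<inter> (S (g [^] a) -` A \<inter> space M) \<inter>
        (S (g [^] b) -` A \<inter> space M)) > prob A ^ 3 - \<epsilon>}"
      using j(2) kG t hG[OF j(1)] by (simp add: r_prob)
    then show "\<exists>k\<in>(\<lambda>(j, k). h j \<otimes> k) ` ({..<N} \<times> K). k \<otimes> t \<in> {g \<in> carrier G.
        prob (A \<inter> (S (g [^] a) -` A \<inter> space M) \<inter> (S (g [^] b) -` A \<inter> space M)) > prob A ^ 3 - \<epsilon>}"
      using k(1) j(1) by force
  qed (use K hG in auto)
qed

end

theorem theorem1p13: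
  fixes G :: "('g, 'm) monoid_scheme"
    and M :: "'x measure"
    and T :: "'g \<Rightarrow> 'x \<Rightarrow> 'x"
    and a b :: int
    and A :: "'x set"
    and \<epsilon> :: real
  assumes "comm_group G"
    and "countable (carrier G)"
    and "finite_index (multiples G (b - a)) G"
    and "ergodic_group_system G M T"
    and "A \<in> sets M"
    and "\<epsilon> > 0"
  shows "syndetic G {g \<in> carrier G.
           measure M (A \<inter> (T (g [^]\<^bsub>G\<^esub> a) -` A \<inter> space M) \<inter> (T (g [^]\<^bsub>G\<^esub> b) -` A \<inter> space M))
             > measure M A ^ 3 - \<epsilon>}"
proof -
  interpret E: ergodic_group_system G M T by (rule assms(4))
  interpret comm_group G by (rule assms(1))
  interpret T: abelian_action G M T
    by unfold_locales (simp_all add: E.measure_preserving E.action_mult E.action_one)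
  have erg: "measure M U = 0 \<or> measure M U = 1"
    if U: "U \<in> sets M" and inv: "\<And>g x. \<lbrakk>g \<in> carrier G; x \<in> space M\<rbrakk> \<Longrightarrow> T g x \<in> U \<longleftrightarrow> x \<in> U" for U
  proof -
    obtain c where c: "AE x in M. (indicator U x :: complex) = c"
      using E.ergodic[of "indicator U"] U inv by (auto simp: indicator_def)
    show ?thesis
    proof (cases "c = 0")
      case True
      from c have "AE x in M. x \<notin> U"
        by eventually_elim (use True in \<open>auto simp: indicator_def split: if_splits\<close>)
      then show ?thesis using U by (simp add: E.prob_eq_0)
    next
      case False
      from c have "AE x in M. x \<in> U"
        by eventually_elim (use False in \<open>auto simp: indicator_def split: if_splits\<close>)
      then show ?thesis using U by (simp add: E.prob_eq_1)
    qed
  qed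
  have H: "subgroup (multiples G (b - a)) G" "finite (rcosets\<^bsub>G\<^esub> (multiples G (b - a)))"
    using assms(3) by (auto simp: finite_index_def)
  show ?thesis
  proof (rule T.invariant_functions_finite_dim[OF H assms(2) erg])
    fix \<B>
    assume \<B>: "finite \<B>" "\<B> \<subseteq> sets M"
      and fin: "\<And>F. \<lbrakk>F \<in> unit_ball M; \<And>h. h \<in> multiples G (b - a) \<Longrightarrow> AE x in M. F (T h x) = F x\<rbrakk> \<Longrightarrow>
        \<exists>c. (\<forall>B\<in>\<B>. \<bar>c B\<bar> \<le> 1) \<and> (AE x in M. F x = (\<Sum>B\<in>\<B>. c B * indicator B x))"
    show ?thesis
    proof (rule T.syndetic_large_intersections[OF assms(5,6) \<B>])
      fix F assume F: "F \<in> unit_ball M"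
        and inv: "\<And>g. g \<in> carrier G \<Longrightarrow> AE x in M. F (T (g [^]\<^bsub>G\<^esub> (b - a)) x) = F x"
      show "\<exists>c. (\<forall>B\<in>\<B>. \<bar>c B\<bar> \<le> 1) \<and> (AE x in M. F x = (\<Sum>B\<in>\<B>. c B * indicator B x))"
      proof (rule fin[OF F])
        show "AE x in M. F (T h x) = F x" if "h \<in> multiples G (b - a)" for h
          using that inv by (auto simp: multiples_def)
      qed
    qed
  qed
qed

end
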